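(* Let $X\subset\mathbb R^2$ be a Suslinian smooth plane dendroid. If $E(X)$ is hereditarily disconnected, then $E(X)$ is zero-dimensional.
   Context: A continuum is a compact connected metric space. It is hereditarily unicoherent if every two of its subcontinua have connected intersection. A dendroid is a hereditarily unicoherent, arcwise connected continuum (hence uniquely arcwise connected); for $x,y$ in a dendroid $X$, $\alpha(x,y)$ denotes the unique arc in $X$ with endpoints $x$ and $y$ (with $\alpha(x,x)=\{x\}$). A plane dendroid is a dendroid $X\subset\mathbb R^2$. A dendroid $X$ is smooth if there exists $p\in X$ such that whenever $x_n\to x$ in $X$, $\alpha(x_n,p)\to\alpha(x,p)$ in the Hausdorff distance. A point $e\in X$ is an endpoint if $e$ is an endpoint of every arc in $X$ that contains it; $E(X)$ is the set of all endpoints of $X$, with the subspace topology. A continuum is Suslinian if it contains no uncountable collection of non-degenerate, pairwise-disjoint subcontinua. A space is hereditarily disconnected if it contains no non-degenerate (more than one point) connected subset, and zero-dimensional if it has a basis of clopen sets. *)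

theory Defs
  imports "HOL-Analysis.Analysis"
begin

definition nondegenerate :: "'a set \<Rightarrow> bool"
  where "nondegenerate S \<longleftrightarrow> (\<exists>x\<in>S. \<exists>y\<in>S. x \<noteq> y)"

text \<open>Continua are taken as subsets of an ambient metric space, with the induced metric.\<close>

definition continuum :: "'a::metric_space set \<Rightarrow> bool"
  where "continuum X \<longleftrightarrow> compact X \<and> connected X"

definition hereditarily_unicoherent :: "'a::metric_space set \<Rightarrow> bool"
  where "hereditarily_unicoherent X \<longleftrightarrow>
    (\<forall>K L. continuum K \<and> K \<subseteq> X \<and> continuum L \<and> L \<subseteq> X \<longrightarrow> connected (K \<inter> L))"

text \<open>\<open>arc_between A x y\<close>: the set \<open>A\<close> is a (non-degenerate) arc with endpoints \<open>x\<close> and \<open>y\<close>.\<close>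

definition arc_between :: "'a::metric_space set \<Rightarrow> 'a \<Rightarrow> 'a \<Rightarrow> bool"
  where "arc_between A x y \<longleftrightarrow>
    (\<exists>g. arc g \<and> path_image g = A \<and> pathstart g = x \<and> pathfinish g = y)"

definition arcwise_connected :: "'a::metric_space set \<Rightarrow> bool"
  where "arcwise_connected X \<longleftrightarrow>
    (\<forall>x\<in>X. \<forall>y\<in>X. x \<noteq> y \<longrightarrow> (\<exists>A\<subseteq>X. arc_between A x y))"

definition dendroid :: "'a::metric_space set \<Rightarrow> bool"
  where "dendroid X \<longleftrightarrow> continuum X \<and> hereditarily_unicoherent X \<and> arcwise_connected X"

text \<open>For \<open>x\<close>, \<open>y\<close> in a dendroid \<open>X\<close> the description below is well defined; see
  \<open>dendroid_alpha_eq\<close>.\<close>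

definition alpha :: "'a::metric_space set \<Rightarrow> 'a \<Rightarrow> 'a \<Rightarrow> 'a set"
  where "alpha X x y = (if x = y then {x} else (THE A. A \<subseteq> X \<and> arc_between A x y))"

text \<open>The real-valued suprema make this the Hausdorff distance for non-empty bounded
  sets; it is only applied to the compact sets \<open>alpha X x y\<close>.\<close>

definition hausdorff_dist :: "'a::metric_space set \<Rightarrow> 'a set \<Rightarrow> real"
  where "hausdorff_dist A B = max (SUP a\<in>A. infdist a B) (SUP b\<in>B. infdist b A)"

definition smooth_dendroid :: "'a::metric_space set \<Rightarrow> bool"
  where "smooth_dendroid X \<longleftrightarrow> dendroid X \<and>
    (\<exists>p\<in>X. \<forall>s x. (\<forall>n. s n \<in> X) \<and> x \<in> X \<and> s \<longlonglongrightarrow> x \<longrightarrow>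
      (\<lambda>n. hausdorff_dist (alpha X (s n) p) (alpha X x p)) \<longlonglongrightarrow> 0)"

definition endpoints :: "'a::metric_space set \<Rightarrow> 'a set"
  where "endpoints X =
    {e \<in> X. \<forall>A x y. A \<subseteq> X \<and> arc_between A x y \<and> e \<in> A \<longrightarrow> e = x \<or> e = y}"

definition Suslinian :: "'a::metric_space set \<Rightarrow> bool"
  where "Suslinian X \<longleftrightarrow> continuum X \<and>
    \<not> (\<exists>\<C>. uncountable \<C> \<and> pairwise disjnt \<C> \<and>
        (\<forall>K\<in>\<C>. continuum K \<and> K \<subseteq> X \<and> nondegenerate K))"

definition hereditarily_disconnected_space :: "'a topology \<Rightarrow> bool"
  where "hereditarily_disconnected_space T \<longleftrightarrow> \<not> (\<exists>S. connectedin T S \<and> nondegenerate S)"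

definition zero_dimensional_space :: "'a topology \<Rightarrow> bool"
  where "zero_dimensional_space T \<longleftrightarrow>
    (\<exists>\<B>. (\<forall>U\<in>\<B>. openin T U \<and> closedin T U) \<and>
         (\<forall>V. openin T V \<longrightarrow> (\<exists>\<U>\<subseteq>\<B>. \<Union>\<U> = V)))"

lemma arc_between_continuum:
  assumes "arc_between A x y"
  shows "continuum A" "x \<in> A" "y \<in> A"
  using assms unfolding arc_between_def continuum_def
  by (auto simp: compact_arc_image connected_arc_image)

lemma arc_between_subset:
  assumes A: "arc_between A x y" and C: "connected C" "C \<subseteq> A" "x \<in> C" "y \<in> C"
  shows "A \<subseteq> C"
proof
  fix z assume "z \<in> A"
  obtain g where g: "arc g" "path_image g = A" "pathstart g = x" "pathfinish g = y"
    using A unfolding arc_between_def by blast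
  obtain k where k: "homeomorphism {0..1} A g k"
    using homeomorphism_arc[OF g(1)] g(2) by metis
  have conn: "connected (k ` C)"
    using k C(1,2) connected_continuous_image continuous_on_subset homeomorphism_cont2 by metis
  have "k x = 0" "k y = 1"
    using k g(3,4) by (simp_all add: homeomorphism_def pathstart_def pathfinish_def flip: g(3,4))
  then have mem: "0 \<in> k ` C" "1 \<in> k ` C"
    using C(3,4) image_eqI by metis+
  have "k z \<in> {0..1}"
    using k \<open>z \<in> A\<close> unfolding homeomorphism_def by blast
  then have "k z \<in> k ` C"
    using connectedD_interval[OF conn mem] by simp
  then show "z \<in> C"
    using k \<open>z \<in> A\<close> C(2) homeomorphism_apply2[OF k] by (metis imageE subsetD)
qed

lemma dendroid_arc_unique:
  assumes "dendroid X" "A \<subseteq> X" "arc_between A x y" "B \<subseteq> X" "arc_between B x y"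
  shows "A = B"
proof -
  have "connected (A \<inter> B)"
    using assms(1,2,4) arc_between_continuum(1)[OF assms(3)] arc_between_continuum(1)[OF assms(5)]
    unfolding dendroid_def hereditarily_unicoherent_def by simp
  moreover have "x \<in> A \<inter> B" "y \<in> A \<inter> B"
    using arc_between_continuum(2,3)[OF assms(3)] arc_between_continuum(2,3)[OF assms(5)]
    by simp_all
  ultimately have "A \<subseteq> A \<inter> B" "B \<subseteq> A \<inter> B"
    by (rule arc_between_subset[OF assms(3) _ Int_lower1] arc_between_subset[OF assms(5) _ Int_lower2])+
  then show ?thesis by blast
qed

lemma dendroid_alpha_eq:
  assumes "dendroid X" "x \<noteq> y" "A \<subseteq> X" "arc_between A x y"
  shows "alpha X x y = A"
proof -
  have "(THE B. B \<subseteq> X \<and> arc_between B x y) = A"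
    by (rule the_equality) (use assms dendroid_arc_unique[OF assms(1)] in blast)+
  then show ?thesis
    using assms(2) by (simp add: alpha_def)
qed

end

(* Let p be the initial point of X and [p,x] the arc from p to x. For three points a, b, c none of
   which lies on the arc from p to another one, letting each point look at the arc joining the
   other two and adding up the changes of argument gives an angle rot a b c. It is a coboundary, it
   depends continuously on (a, b, c) by smoothness, and it is pi or -pi: in the plane the three legs of
   the triod can be extended to a common circle, where every single angle is less than pi. Hence
   its sign is a continuous cyclic order of the endpoints, and fixing one endpoint e0 gives a linear
   order whose rays are open.

   The sets of endpoints above a point d are order convex, and since X is Suslinian countably many
   of them form a network. So outside the countable set Z of their extreme points the topology is
   the order topology. If no clopen initial segment separated a from b, then [a,b] would be a
   complete dense order, and a separation of [a,b] would have a boundary point outside Z, which is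
   absurd; as the endpoints are hereditarily disconnected, any two of them are separated by a cut.
   Finally, for t on [p,z] close to z, the sets {e. dist(t,[p,e]) < r} with r off the values at Z
   become clopen after adding pairwise disjoint clopen intervals around the points of the level set
   r; planarity and smoothness prevent these from accumulating elsewhere. *)

theory Submission
  imports Defs
begin

section \<open>Logarithms of differences along arcs\<close>

text \<open>The three arcs may share initial pieces of any shape, so there is no cyclic order of
  directions at a branch point to start from. The sum of angles avoids this: its exponential is -1
  because everything cancels, so it is an odd multiple of pi that no admissible deformation can
  change, and the bound 3 pi leaves two values.

  The obstacle afterwards is that the endpoints may carry a topology finer than that of the order,
  so a set need not accumulate at its supremum. The boundary point of a separation is therefore
  sought outside Z as in the proof of Baire's theorem: nested intervals, the n-th avoiding the n-th
  point of Z, enclose a point at which both topologies agree.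

  Cuts separate points, but a clopen interval around a point of Z need not be small. Hence the
  metric function dist(t,[p,e]): smoothness makes it continuous and its low sublevel sets small, and
  only its level set, which misses Z for all but countably many r, has to be repaired with
  intervals.\<close>

lemma constant_if_exp_constant:
  fixes h :: "'a::topological_space \<Rightarrow> complex"
  assumes "connected S" "continuous_on S h" "\<And>x. x \<in> S \<Longrightarrow> exp (h x) = c" "x \<in> S" "y \<in> S"
  shows "h x = h y"
proof -
  have "h constant_on S"
  proof (rule continuous_discrete_range_constant[OF assms(1,2)])
    fix x assume "x \<in> S"
    \<comment> \<open>Two logarithms of one number differ by a multiple of
      \<open>2 * pi * \<i>\<close>, so the values of \<open>h\<close> are isolated.\<close>
    have "2 * pi \<le> norm (h y - h x)" if y: "y \<in> S" "h y \<noteq> h x" for y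
    proof -
      have "exp (h y) = exp (h x)"
        using assms(3) \<open>x \<in> S\<close> y by simp
      then obtain n :: int where n: "h y = h x + (of_int (2 * n) * pi) * \<i>"
        by (auto simp: exp_eq)
      then have "n \<noteq> 0"
        using y by auto
      then have "1 \<le> \<bar>real_of_int n\<bar>"
        by linarith
      moreover have "norm (h y - h x) = 2 * pi * \<bar>real_of_int n\<bar>"
        using n by (simp add: norm_mult)
      ultimately show ?thesis
        using pi_gt_zero by (simp del: pi_gt_zero)
    qed
    then show "\<exists>e>0. \<forall>y. y \<in> S \<and> h y \<noteq> h x \<longrightarrow> e \<le> norm (h y - h x)"
      by (intro exI[of _ "2 * pi"]) auto
  qed
  then show ?thesis
    using assms(4,5) unfolding constant_on_def by auto
qed

text \<open>\<open>f\<close> is a branch of \<open>log (z - q)\<close> along \<open>A\<close>; in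
  particular \<open>q \<notin> A\<close>.\<close>

definition log_on :: "complex \<Rightarrow> complex set \<Rightarrow> (complex \<Rightarrow> complex) \<Rightarrow> bool"
  where "log_on q A f \<longleftrightarrow> continuous_on A f \<and> (\<forall>z\<in>A. exp (f z) = z - q)"

text \<open>Meaningful only if \<open>A\<close> is connected and carries a logarithm.\<close>

definition turn :: "complex \<Rightarrow> complex set \<Rightarrow> complex \<Rightarrow> complex \<Rightarrow> complex"
  where "turn q A x y = (SOME v. \<exists>f. log_on q A f \<and> v = f y - f x)"

text \<open>Two branches on a connected set differ by a constant, which cancels in
  \<open>f y - f x\<close>.\<close>

lemma turn_eq:
  assumes "connected A" "x \<in> A" "y \<in> A" "log_on q A f"
  shows "turn q A x y = f y - f x"
  unfolding turn_def
proof (rule some_equality)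
  fix v assume "\<exists>g. log_on q A g \<and> v = g y - g x"
  then obtain g where g: "log_on q A g" and v: "v = g y - g x"
    by blast
  have "g x - f x = g y - f y"
  proof (rule constant_if_exp_constant[OF assms(1), where c = 1 and h = "\<lambda>z. g z - f z"])
    show "continuous_on A (\<lambda>z. g z - f z)"
      using g assms(4) by (auto simp: log_on_def intro: continuous_on_diff)
    fix z assume "z \<in> A"
    then have "exp (g z) = z - q" "exp (f z) = z - q"
      using g assms(4) by (auto simp: log_on_def)
    then show "exp (g z - f z) = 1"
      using exp_not_eq_zero[of "g z"] by (simp add: exp_diff)
  qed (use assms in auto)
  then have "g y = f y + (g x - f x)"
    by (simp add: algebra_simps)
  then show "v = f y - f x"
    using v by simp
qed (use assms in blast)

lemma log_on_subset: "log_on q A f \<Longrightarrow> B \<subseteq> A \<Longrightarrow> log_on q B f"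
  unfolding log_on_def by (meson continuous_on_subset subset_iff)

lemma exp_turn:
  assumes "connected A" "x \<in> A" "y \<in> A" "log_on q A f" "x \<noteq> q"
  shows "exp (turn q A x y) = (y - q) / (x - q)"
  using assms turn_eq[OF assms(1-4)] by (simp add: exp_diff log_on_def)

lemma log_on_arc_ex:
  assumes "arc g" "q \<notin> path_image g"
  obtains f where "log_on q (path_image g) f"
proof -
  have "contractible (path_image g)"
  proof -
    obtain h where "homeomorphism {0..1} (path_image g) g h"
      using homeomorphism_arc[OF assms(1)] .
    then show ?thesis
      using homeomorphic_contractible[of "{0..1::real}" "path_image g"] convex_imp_contractible[of "{0..1::real}"]
      by (meson convex_closed_interval convex_real_interval(5) homeomorphic_def)
  qed
  moreover have "continuous_on (path_image g) (\<lambda>z. z - q)"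
    by (intro continuous_intros)
  moreover have "z - q \<noteq> 0" if "z \<in> path_image g" for z
    using that assms(2) by auto
  ultimately obtain f where f: "continuous_on (path_image g) f"
      "\<And>z. z \<in> path_image g \<Longrightarrow> z - q = exp (f z)"
    using continuous_logarithm_on_contractible[of "path_image g" "\<lambda>z. z - q"] by blast
  show thesis
    by (rule that[of f]) (simp add: log_on_def f)
qed

text \<open>The quotients \<open>(z - q') / (z - q)\<close> lie in the open disc of radius 1 about
  1, where the principal \<open>Ln\<close> is continuous, so \<open>Ln\<close> turns a branch for
  \<open>q\<close> into one for \<open>q'\<close>.\<close>

lemma log_on_move_centre:
  assumes "log_on q A f" "\<And>z. z \<in> A \<Longrightarrow> dist q q' < dist q z"
  shows "log_on q' A (\<lambda>z. f z + Ln ((z - q') / (z - q)))"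
proof -
  have pos: "Re ((z - q') / (z - q)) > 0" if "z \<in> A" for z
  proof -
    have ne: "z \<noteq> q" and lt: "norm (q - q') < norm (z - q)"
      using assms(2)[OF that] by (auto simp: dist_norm norm_minus_commute)
    have "(z - q') / (z - q) = 1 + (q - q') / (z - q)"
      using ne by (simp add: divide_simps)
    moreover have "norm ((q - q') / (z - q)) < 1"
      using lt ne by (simp add: norm_divide divide_simps)
    ultimately show ?thesis
      using abs_Re_le_cmod[of "(q - q') / (z - q)"] by simp
  qed
  have ne: "z \<noteq> q" "z \<noteq> q'" if "z \<in> A" for z
    using assms(2)[OF that] pos[OF that] by auto
  have "continuous_on A (\<lambda>z. Ln ((z - q') / (z - q)))"
  proof (rule continuous_on_Ln')
    show "continuous_on A (\<lambda>z. (z - q') / (z - q))"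
      using ne by (intro continuous_intros) auto
    show "(z - q') / (z - q) \<notin> \<real>\<^sub>\<le>\<^sub>0" if "z \<in> A" for z
      using pos[OF that] by (auto simp: complex_nonpos_Reals_iff)
  qed
  then show ?thesis
    using assms(1) ne unfolding log_on_def
    by (auto intro: continuous_on_add simp: exp_add)
qed

text \<open>Moving the centre from \<open>q\<close> to \<open>u k\<close> changes the branch by
  principal logarithms, which tend to \<open>Ln 1 = 0\<close>.\<close>

lemma tendsto_turn_centre:
  assumes "connected A" "compact A" "log_on q A f" "x \<in> A" "y \<in> A" "(u \<longlongrightarrow> q) F"
  shows "((\<lambda>k. turn (u k) A x y) \<longlongrightarrow> turn q A x y) F"
proof -
  have q: "q \<notin> A"
    using assms(3) unfolding log_on_def by (metis exp_not_eq_zero right_minus_eq)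
  then obtain e where e: "e > 0" "\<And>z. z \<in> A \<Longrightarrow> e \<le> dist q z"
    using assms(2) separate_point_closed[of A q] compact_imp_closed by blast
  have ev: "\<forall>\<^sub>F k in F. dist (u k) q < e"
    using assms(6) e(1) by (rule tendstoD)
  have eq: "turn (u k) A x y = turn q A x y + Ln ((y - u k) / (y - q)) - Ln ((x - u k) / (x - q))"
    if "dist (u k) q < e" for k
  proof -
    have "log_on (u k) A (\<lambda>z. f z + Ln ((z - u k) / (z - q)))"
      by (rule log_on_move_centre[OF assms(3)]) (use e(2) that in \<open>force simp: dist_commute\<close>)
    from turn_eq[OF assms(1,4,5) this] turn_eq[OF assms(1,4,5,3)] show ?thesis
      by simp
  qed
  have L: "((\<lambda>k. Ln ((z - u k) / (z - q))) \<longlongrightarrow> Ln 1) F" if "z \<in> A" for z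
  proof (rule tendsto_Ln)
    have "z - q \<noteq> 0"
      using that q by auto
    then have "((\<lambda>k. (z - u k) / (z - q)) \<longlongrightarrow> (z - q) / (z - q)) F"
      by (intro tendsto_intros assms(6)) auto
    then show "((\<lambda>k. (z - u k) / (z - q)) \<longlongrightarrow> 1) F"
      using \<open>z - q \<noteq> 0\<close> by simp
  qed auto
  have "((\<lambda>k. turn q A x y + Ln ((y - u k) / (y - q)) - Ln ((x - u k) / (x - q)))
      \<longlongrightarrow> turn q A x y + Ln 1 - Ln 1) F"
    by (intro tendsto_intros L assms)
  then show ?thesis
    using ev by (subst tendsto_cong[where g = "\<lambda>k. turn q A x y + Ln ((y - u k) / (y - q)) - Ln ((x - u k) / (x - q))"])
      (auto elim!: eventually_mono simp: eq)
qed

section \<open>Rotation of a planar triod\<close>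

text \<open>The legs may share initial pieces. Connectedness of the intersections is what hereditary
  unicoherence provides and what Janiszewski's theorem asks for.\<close>

definition triod :: "complex \<Rightarrow> complex set \<Rightarrow> complex \<Rightarrow> complex set \<Rightarrow> complex \<Rightarrow> complex set \<Rightarrow> complex \<Rightarrow> bool"
  where "triod p A a B b C c \<longleftrightarrow>
    arc_between A p a \<and> arc_between B p b \<and> arc_between C p c \<and>
    connected (A \<inter> B) \<and> connected (B \<inter> C) \<and> connected (C \<inter> A) \<and>
    a \<notin> B \<union> C \<and> b \<notin> C \<union> A \<and> c \<notin> A \<union> B"

text \<open>The sum of the angles under which each end sees the arc joining the two other ends.\<close>

definition triod_turn :: "complex \<Rightarrow> complex set \<Rightarrow> complex \<Rightarrow> complex set \<Rightarrow> complex \<Rightarrow> complex set \<Rightarrow> complex \<Rightarrow> complex"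
  where "triod_turn p A a B b C c =
    (turn a C p c - turn a B p b) + (turn b A p a - turn b C p c) + (turn c B p b - turn c A p a)"

lemma triod_rotate: "triod p A a B b C c \<Longrightarrow> triod p B b C c A a"
  unfolding triod_def by (simp add: Int_commute)

lemma triod_turn_rotate: "triod_turn p B b C c A a = triod_turn p A a B b C c"
  unfolding triod_turn_def by simp

lemma arc_between_log_on_ex:
  assumes "arc_between A x y" "q \<notin> A"
  obtains f where "log_on q A f"
  using assms log_on_arc_ex unfolding arc_between_def by metis

lemma arc_between_connected: "arc_between A x y \<Longrightarrow> connected A"
  and arc_between_compact: "arc_between A x y \<Longrightarrow> compact A"
  using arc_between_continuum(1) unfolding continuum_def by blast+

lemma exp_turn_arc:
  assumes "arc_between A x y" "q \<notin> A"
  shows "exp (turn q A x y) = (y - q) / (x - q)"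
proof -
  obtain f where "log_on q A f"
    using arc_between_log_on_ex[OF assms] .
  then show ?thesis
    using exp_turn assms arc_between_continuum[OF assms(1)] arc_between_connected by metis
qed

text \<open>The point \<open>p\<close> cancels, and what remains is a product of three quotients
  \<open>(x - y) / (y - x) = - 1\<close>. So the imaginary part is an odd multiple of pi.\<close>

lemma exp_triod_turn:
  assumes "arc_between A p a" "arc_between B p b" "arc_between C p c"
    and "a \<notin> B \<union> C" "b \<notin> C \<union> A" "c \<notin> A \<union> B"
  shows "exp (triod_turn p A a B b C c) = - 1"
proof -
  have mem: "p \<in> A" "p \<in> B" "p \<in> C" "a \<in> A" "b \<in> B" "c \<in> C"
    using assms(1-3) arc_between_continuum by metis+
  then have ne: "a - b \<noteq> 0" "b - a \<noteq> 0" "a - c \<noteq> 0" "c - a \<noteq> 0" "b - c \<noteq> 0" "c - b \<noteq> 0"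
      "p - a \<noteq> 0" "p - b \<noteq> 0" "p - c \<noteq> 0"
    using assms(4-6) by auto
  have "exp (triod_turn p A a B b C c) =
      ((c - a) / (p - a) / ((b - a) / (p - a))) * ((a - b) / (p - b) / ((c - b) / (p - b))) *
      ((b - c) / (p - c) / ((a - c) / (p - c)))"
    using assms by (simp add: triod_turn_def exp_add exp_diff exp_turn_arc)
  also have "\<dots> = ((c - a) / (a - c)) * ((a - b) / (b - a)) * ((b - c) / (c - b))"
    using ne by (simp add: divide_simps)
  also have "\<dots> = - 1"
  proof -
    have "(x - y) / (y - x) = - 1" if "y - x \<noteq> 0" for x y :: complex
      using that by (simp add: divide_simps)
    then show ?thesis
      using ne by simp
  qed
  finally show ?thesis .
qed

section \<open>Sliding the end of a leg along it\<close>

lemma arc_initial_subpath: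
  fixes g :: "real \<Rightarrow> 'a::real_normed_vector"
  assumes "arc g" "0 < s" "s \<le> 1"
  shows "arc (subpath 0 s g)" "path_image (subpath 0 s g) = g ` {0..s}"
    "subpath 0 s g 0 = g 0" "subpath 0 s g 1 = g s"
  using arc_subpath_arc[OF assms(1), of 0 s] path_image_subpath[of 0 s g] assms(2,3)
  by (simp_all add: subpath_def)

lemma arc_between_initial:
  fixes g :: "real \<Rightarrow> 'a::real_normed_vector"
  assumes "arc g" "0 < s" "s \<le> 1"
  shows "arc_between (g ` {0..s}) (g 0) (g s)"
  unfolding arc_between_def using arc_initial_subpath[OF assms]
  by (intro exI[of _ "subpath 0 s g"]) (simp add: pathstart_def pathfinish_def)

text \<open>While the end of the first leg slides from \<open>g s\<close> to \<open>g 1\<close>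
  without touching the other legs, the sum varies continuously and its exponential stays -1, so it
  cannot change.\<close>

lemma triod_turn_shrink:
  assumes g: "arc g" "g 0 = p" and s: "0 < s" "s \<le> 1" "\<And>u. u \<in> {s..1} \<Longrightarrow> g u \<notin> B \<union> C"
    and B: "arc_between B p b" and C: "arc_between C p c"
    and b: "b \<notin> C \<union> path_image g" and c: "c \<notin> path_image g \<union> B"
  shows "triod_turn p (g ` {0..s}) (g s) B b C c = triod_turn p (path_image g) (g 1) B b C c"
proof -
  define W where "W u = triod_turn p (g ` {0..u}) (g u) B b C c" for u
  have cg: "continuous_on {0..1} g"
    using g(1) by (simp add: arc_def path_def)
  have p: "p \<in> B" "p \<in> C" "b \<in> B" "c \<in> C"
    using B C arc_between_continuum by metis+
  have sub: "arc_between (g ` {0..u}) p (g u)" if "u \<in> {s..1}" for u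
    using arc_between_initial[OF g(1), of u] that s g(2) by simp
  have img: "g ` {0..u} \<subseteq> path_image g" if "u \<in> {s..1}" for u
    using that s by (auto simp: path_image_def)
  obtain fb where fb: "log_on b (path_image g) fb"
    using log_on_arc_ex[OF g(1), of b] b by auto
  obtain fc where fc: "log_on c (path_image g) fc"
    using log_on_arc_ex[OF g(1), of c] c by auto
  have turn_sub: "turn q (g ` {0..u}) p (g u) = f (g u) - f p"
    if "u \<in> {s..1}" "log_on q (path_image g) f" for q f u
    using turn_eq[OF arc_between_connected[OF sub[OF that(1)]]
        arc_between_continuum(2,3)[OF sub[OF that(1)]] log_on_subset[OF that(2) img[OF that(1)]]] .
  \<comment> \<open>Two turns are centred at the moving end and are treated by
    \<open>tendsto_turn_centre\<close>; the two along the moving leg are read off the fixed branches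
    \<open>fb\<close> and \<open>fc\<close> on the whole leg.\<close>
  have W: "W u = (turn (g u) C p c - turn (g u) B p b) + ((fb (g u) - fb p) - turn b C p c)
      + (turn c B p b - (fc (g u) - fc p))" if "u \<in> {s..1}" for u
    unfolding W_def triod_turn_def turn_sub[OF that fb] turn_sub[OF that fc] by simp
  have ct: "continuous_on {s..1} (\<lambda>u. turn (g u) K x y)"
    if K: "arc_between K x y" "\<And>u. u \<in> {s..1} \<Longrightarrow> g u \<notin> K" for K x y
    unfolding continuous_on_def
  proof
    fix u assume u: "u \<in> {s..1}"
    obtain f where "log_on (g u) K f"
      using arc_between_log_on_ex K u by metis
    moreover have "(g \<longlongrightarrow> g u) (at u within {s..1})"
      using continuous_on_subset[OF cg, of "{s..1}"] s u unfolding continuous_on_def by auto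
    ultimately show "((\<lambda>u. turn (g u) K x y) \<longlongrightarrow> turn (g u) K x y) (at u within {s..1})"
      using tendsto_turn_centre arc_between_connected[OF K(1)] arc_between_compact[OF K(1)]
        arc_between_continuum(2,3)[OF K(1)] by metis
  qed
  have cf: "continuous_on {s..1} (\<lambda>u. f (g u))" if "log_on q (path_image g) f" for q f
    using that s unfolding log_on_def
    by (intro continuous_on_compose2[of "path_image g" f "{s..1}" g] continuous_on_subset[OF cg])
      (auto simp: path_image_def)
  have "continuous_on {s..1} W"
    by (subst continuous_on_cong[OF refl W]) (use s(3) in \<open>auto intro!: continuous_intros ct[OF B] ct[OF C] cf[OF fb] cf[OF fc]\<close>)
  moreover have "exp (W u) = - 1" if u: "u \<in> {s..1}" for u
    unfolding W_def
    by (rule exp_triod_turn[OF sub[OF u] B C]) (use s(3)[OF u] b c img[OF u] in auto)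
  ultimately have "W s = W 1"
    using s(1,2) by (intro constant_if_exp_constant[of "{s..1}" W "- 1"]) auto
  then show ?thesis
    by (simp add: W_def path_image_def)
qed

section \<open>Extending the legs to a common circle\<close>

lemma connected_Compl_triod:
  assumes "triod p A a B b C c"
  shows "connected (- (A \<union> B \<union> C))"
proof -
  have ar: "arc_between A p a" "arc_between B p b" "arc_between C p c"
    and co: "connected (A \<inter> B)" "connected (B \<inter> C)" "connected (C \<inter> A)"
    using assms unfolding triod_def by blast+
  have cc: "connected (- K)" if "arc_between K x y" for K :: "complex set" and x y
    using that connected_arc_complement[where ?'a = complex] unfolding arc_between_def by auto
  have "p \<in> A" "p \<in> B" "p \<in> C"
    using ar arc_between_continuum by metis+
  \<comment> \<open>\<open>A \<inter> C\<close> and \<open>B \<inter> C\<close> share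
    \<open>p\<close>. An arc does not separate the plane, so Janiszewski's theorem applies to
    \<open>A\<close> and \<open>B\<close>, and then to their union and \<open>C\<close>.\<close>
  then have "connected ((A \<union> B) \<inter> C)"
    using connected_Un[OF co(3,2)] by (auto simp: Int_Un_distrib Int_Un_distrib2 Int_commute)
  moreover have "connected (- (A \<union> B))"
    using Janiszewski_connected[of A B] ar[THEN arc_between_compact] ar[THEN cc] co compact_imp_closed by blast
  ultimately show ?thesis
    using Janiszewski_connected[of "A \<union> B" C] ar[THEN arc_between_compact] ar[THEN cc]
      compact_imp_closed compact_Un by blast
qed


text \<open>Otherwise the inverse of the parametrisation would embed a nonempty open set of the
  plane in the line, against invariance of dimension.\<close>

lemma interior_arc_empty:
  fixes g :: "real \<Rightarrow> complex"
  assumes "arc g" "open U" "U \<subseteq> path_image g"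
  shows "U = {}"
proof (rule ccontr)
  assume "U \<noteq> {}"
  obtain k where k: "homeomorphism {0..1} (path_image g) g k"
    using homeomorphism_arc[OF assms(1)] .
  have "continuous_on U k"
    using k assms(3) by (meson continuous_on_subset homeomorphism_cont2)
  moreover have "inj_on k U"
    using k assms(3) by (metis homeomorphism_apply2 inj_onI subsetD)
  ultimately have "DIM(complex) \<le> DIM(real)"
    using invariance_of_dimension[of U k] assms(2) \<open>U \<noteq> {}\<close> by blast
  then show False
    by simp
qed

text \<open>Take the first time at which the norm is at least \<open>R\<close>.\<close>

lemma exit_sphere:
  fixes \<gamma> :: "real \<Rightarrow> 'a::real_normed_vector"
  assumes "continuous_on {0..1} \<gamma>" "norm (\<gamma> 0) < R" "R \<le> norm (\<gamma> 1)"
  obtains u where "0 < u" "u \<le> 1" "norm (\<gamma> u) = R" "\<And>v. v \<in> {0..u} \<Longrightarrow> norm (\<gamma> v) \<le> R"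
proof -
  have cn: "continuous_on {0..1} (\<lambda>u. norm (\<gamma> u))"
    using assms(1) by (intro continuous_intros)
  define S where "S = {0..1} \<inter> (\<lambda>u. norm (\<gamma> u)) -` {R..}"
  have "closed S"
    unfolding S_def by (rule continuous_closed_preimage[OF cn]) auto
  then have "compact S"
    using compact_Int_closed[of "{0..1::real}" S] by (simp add: S_def Int_absorb2 inf.absorb2)
  moreover have "1 \<in> S"
    using assms(3) by (simp add: S_def)
  ultimately obtain u where u: "u \<in> S" "\<And>v. v \<in> S \<Longrightarrow> u \<le> v"
    using compact_attains_inf[of S] by blast
  have lt: "norm (\<gamma> v) < R" if "v \<in> {0..<u}" for v
    using u(2)[of v] that u(1) by (force simp: S_def)
  have u01: "0 \<le> u" "u \<le> 1" "R \<le> norm (\<gamma> u)"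
    using u(1) by (auto simp: S_def)
  then have "0 < u"
    using assms(2) by (cases "u = 0") auto
  have "norm (\<gamma> u) = R"
  proof (rule ccontr)
    assume "norm (\<gamma> u) \<noteq> R"
    then have "R < norm (\<gamma> u)"
      using u01 by simp
    moreover have "continuous_on {0..u} (\<lambda>u. norm (\<gamma> u))"
      using cn u01 by (auto intro: continuous_on_subset)
    ultimately obtain v where "0 \<le> v" "v \<le> u" "norm (\<gamma> v) = R"
      using IVT'[of "\<lambda>u. norm (\<gamma> u)" 0 R u] assms(2) u01 by force
    moreover have "v \<noteq> u"
      using \<open>norm (\<gamma> u) \<noteq> R\<close> calculation by auto
    ultimately show False
      using lt[of v] by simp
  qed
  then show thesis
    using that[of u] \<open>0 < u\<close> u01 lt by (metis atLeastAtMost_iff atLeastLessThan_iff less_eq_real_def)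
qed

text \<open>The complement of the triod is connected and accessible points are dense in its
  frontier, so an arc in the complement leads from far outside to a point \<open>a1\<close> of the
  leg near \<open>a\<close>. The new leg follows the old one up to \<open>a1\<close> and then this
  arc backwards until it first meets the circle. Both legs shrink to the same piece ending at
  \<open>a1\<close>, so \<open>triod_turn_shrink\<close>, applied twice, shows that the sums
  agree.\<close>

lemma triod_extend:
  assumes tri: "triod p A a B b C c" and R: "A \<union> B \<union> C \<subseteq> cball 0 R" "norm a < R"
  obtains A' a' where "triod p A' a' B b C c" "A' \<subseteq> cball 0 R" "norm a' = R"
    "triod_turn p A' a' B b C c = triod_turn p A a B b C c"
proof -
  have ar: "arc_between A p a" "arc_between B p b" "arc_between C p c"
    and co: "connected (A \<inter> B)" "connected (B \<inter> C)" "connected (C \<inter> A)"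
    and a: "a \<notin> B \<union> C" and b: "b \<notin> C \<union> A" and c: "c \<notin> A \<union> B"
    using tri unfolding triod_def by blast+
  have pBC: "p \<in> B" "p \<in> C"
    using ar arc_between_continuum by metis+
  obtain g where g: "arc g" "path_image g = A" "g 0 = p" "g 1 = a"
    using ar(1) unfolding arc_between_def pathstart_def pathfinish_def by blast
  have cg: "continuous_on {0..1} g" and gi: "inj_on g {0..1}"
    using g(1) by (simp_all add: arc_def path_def)
  have Ag: "A = g ` {0..1}"
    using g(2) by (simp add: path_image_def)
  define T where "T = A \<union> B \<union> C"
  have cT: "closed T" "closed (B \<union> C)"
    unfolding T_def using ar[THEN arc_between_compact] by (auto intro: compact_imp_closed)
  obtain \<eta> where \<eta>: "0 \<le> \<eta>" "\<eta> < 1" "\<And>u. u \<in> {\<eta>..1} \<Longrightarrow> g u \<notin> B \<union> C"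
  proof -
    have "\<exists>e>0. ball a e \<subseteq> - (B \<union> C)"
      using a open_contains_ball[THEN iffD1, OF open_Compl[OF cT(2)]] by blast
    then obtain e where e: "e > 0" "ball a e \<subseteq> - (B \<union> C)"
      by blast
    then obtain d where d: "d > 0" "\<And>u. u \<in> {0..1} \<Longrightarrow> dist u 1 < d \<Longrightarrow> dist (g u) a < e"
      using cg g(4) unfolding continuous_on_iff by (metis atLeastAtMost_iff le_numeral_extra(4) zero_le_one)
    show thesis
    proof (rule that[of "max 0 (1 - d / 2)"])
      fix u assume "u \<in> {max 0 (1 - d / 2)..1}"
      then have "dist (g u) a < e"
        using d by (intro d(2)) (auto simp: dist_real_def)
      then show "g u \<notin> B \<union> C"
        using e(2) by (auto simp: dist_commute)
    qed (use d(1) in auto)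
  qed
  \<comment> \<open>All of the triod except a final piece of the leg. A ball about \<open>a\<close>
    that misses \<open>K\<close> can meet the triod only in that piece.\<close>
  define K where "K = g ` {0..\<eta>} \<union> (B \<union> C)"
  have "closed K"
    unfolding K_def using \<eta>(1,2)
    by (intro closed_Un[OF _ cT(2)] compact_imp_closed compact_continuous_image continuous_on_subset[OF cg]) auto
  moreover have "a \<notin> K"
    using a \<eta>(1,2) gi g(4) unfolding K_def inj_on_def by force
  ultimately obtain r0 where r0: "r0 > 0" "ball a r0 \<subseteq> - K"
    using open_contains_ball[THEN iffD1, OF open_Compl] by blast
  define r where "r = min r0 (R - norm a)"
  have r: "r > 0" "ball a r \<subseteq> - K" "ball a r \<subseteq> ball 0 R"
  proof -
    show "r > 0" "ball a r \<subseteq> - K"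
      using r0 R(2) by (auto simp: r_def)
    show "ball a r \<subseteq> ball 0 R"
    proof
      fix z assume "z \<in> ball a r"
      then have "norm (z - a) < R - norm a"
        by (simp add: r_def dist_norm norm_minus_commute)
      then show "z \<in> ball 0 R"
        using norm_triangle_ineq[of a "z - a"] by simp
    qed
  qed
  define V where "V = frontier (- T) \<inter> ball a r"
  have "a \<in> T"
    using g(4) by (auto simp: T_def Ag)
  \<comment> \<open>Near \<open>a\<close> the triod is part of an arc and has no interior; so
    \<open>a\<close> is on the frontier of the complement and \<open>V\<close> is not empty.\<close>
  have "a \<notin> interior T"
  proof
    assume "a \<in> interior T"
    moreover have "interior T \<inter> ball a r \<subseteq> path_image g"
      using interior_subset[of T] r(2) by (auto simp: T_def K_def g(2))
    ultimately show False
      using interior_arc_empty[OF g(1) open_Int[OF open_interior open_ball]] r(1)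
      by (metis IntI centre_in_ball empty_iff)
  qed
  then have "a \<in> V"
    using \<open>a \<in> T\<close> r(1) cT(1) by (simp add: V_def frontier_complement) (simp add: frontier_def closure_closed)
  have frT: "frontier (- T) \<subseteq> T"
    using cT(1) by (simp add: frontier_complement frontier_subset_closed)
  obtain x0 where x0: "norm x0 > R" "x0 \<in> - T"
  proof
    have "R > 0"
      using R(2) norm_ge_zero[of a] by linarith
    then show "norm (complex_of_real (R + 1)) > R"
      by (simp del: of_real_add)
    then show "complex_of_real (R + 1) \<in> - T"
      using R(1) by (auto simp: T_def)
  qed
  have "open (- T)" "connected (- T)" "V \<noteq> {}"
    using cT(1) connected_Compl_triod[OF tri, folded T_def] \<open>a \<in> V\<close> by (blast intro: open_Compl)+
  moreover have "openin (top_of_set (frontier (- T))) V"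
    unfolding V_def by (rule openin_open_Int) simp
  ultimately obtain f where f: "arc f" "f ` {0..<1} \<subseteq> - T" "pathstart f = x0" "pathfinish f \<in> V"
    using dense_accessible_frontier_points_connected x0(2) by metis
  define \<gamma> where "\<gamma> = reversepath f"
  define a1 where "a1 = pathfinish f"
  have a1: "a1 \<in> T" "a1 \<in> ball a r" "a1 \<notin> K"
    using f(4) frT r(2) unfolding V_def a1_def by auto
  then obtain s where s: "s \<in> {0..1}" "a1 = g s"
    by (auto simp: T_def K_def Ag)
  have "s > \<eta>"
    using a1(3) s unfolding K_def by force
  then have s01: "0 < s" "s \<le> 1"
    using \<eta>(1) s by auto
  have gs: "g u \<notin> B \<union> C" if "u \<in> {s..1}" for u
    using \<eta>(3)[of u] that \<open>s > \<eta>\<close> by auto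
  have \<gamma>: "arc \<gamma>" "\<gamma> 0 = a1" "\<gamma> 1 = x0"
    using f(3) arc_reversepath[OF f(1)]
    by (simp_all add: \<gamma>_def a1_def reversepath_def pathstart_def pathfinish_def)
  have \<gamma>T: "\<gamma> u \<notin> T" if "u \<in> {0<..1}" for u
  proof -
    have "f (1 - u) \<in> f ` {0..<1}"
      using that by (intro imageI) auto
    then show ?thesis
      using f(2) unfolding \<gamma>_def reversepath_def by auto
  qed
  have "continuous_on {0..1} \<gamma>"
    using \<gamma>(1) by (simp add: arc_def path_def)
  moreover have "norm (\<gamma> 0) < R"
    using subsetD[OF r(3) a1(2)] \<gamma>(2) by simp
  ultimately obtain u where u: "0 < u" "u \<le> 1" "norm (\<gamma> u) = R" "\<And>v. v \<in> {0..u} \<Longrightarrow> norm (\<gamma> v) \<le> R"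
    using exit_sphere[of \<gamma> R] \<gamma>(3) x0(1) by (metis less_imp_le)
  define g1 where "g1 = subpath 0 s g"
  define \<delta> where "\<delta> = subpath 0 u \<gamma>"
  define h where "h = g1 +++ \<delta>"
  define A' where "A' = path_image h"
  have g1: "arc g1" "path_image g1 = g ` {0..s}" "g1 0 = p" "g1 1 = a1"
    using arc_initial_subpath[OF g(1) s01] g(3) s(2) by (simp_all add: g1_def)
  have \<delta>: "arc \<delta>" "path_image \<delta> = \<gamma> ` {0..u}" "\<delta> 0 = a1" "\<delta> 1 = \<gamma> u"
    using arc_initial_subpath[OF \<gamma>(1) u(1,2)] \<gamma>(2) by (simp_all add: \<delta>_def)
  have g1A: "path_image g1 \<subseteq> A"
    using s01 by (auto simp: g1(2) Ag)
  have \<delta>T: "z \<notin> T" if z: "z \<in> path_image \<delta>" "z \<noteq> a1" for z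
  proof -
    obtain v where v: "z = \<gamma> v" "0 \<le> v" "v \<le> u"
      using z(1) by (auto simp: \<delta>(2))
    then have "v \<noteq> 0"
      using z(2) \<gamma>(2) by auto
    then show ?thesis
      using \<gamma>T[of v] v u(2) by auto
  qed
  have a1BC: "a1 \<notin> B \<union> C"
    using a1(3) by (simp add: K_def)
  have \<delta>BC: "z \<notin> B \<union> C" if "z \<in> path_image \<delta>" for z
    using \<delta>T[OF that] a1BC by (auto simp: T_def)
  have h: "arc h" "h 0 = p" "h 1 = \<gamma> u"
  proof -
    show "arc h"
      unfolding h_def
    proof (rule arc_join[OF g1(1) \<delta>(1)])
      show "path_image g1 \<inter> path_image \<delta> \<subseteq> {pathstart \<delta>}"
        using \<delta>T g1A \<delta>(3) by (auto simp: T_def pathstart_def)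
    qed (simp add: g1 \<delta> pathstart_def pathfinish_def)
    show "h 0 = p" "h 1 = \<gamma> u"
      by (simp_all add: h_def joinpaths_def g1 \<delta>)
  qed
  have A': "A' = path_image g1 \<union> path_image \<delta>"
    unfolding A'_def h_def by (simp add: path_image_join pathstart_def pathfinish_def g1 \<delta>)
  \<comment> \<open>Neither the removed piece beyond \<open>a1\<close> nor the added arc meets
    \<open>B\<close> or \<open>C\<close>.\<close>
  have AA': "A' \<inter> B = A \<inter> B" "A' \<inter> C = A \<inter> C"
  proof -
    have "A \<subseteq> path_image g1 \<union> g ` {s..1}"
      using s01 by (force simp: g1(2) Ag)
    then have "A \<inter> (B \<union> C) \<subseteq> path_image g1"
      using gs by auto
    then show "A' \<inter> B = A \<inter> B" "A' \<inter> C = A \<inter> C"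
      using g1A \<delta>BC unfolding A' by blast+
  qed
  have tri': "triod p A' (\<gamma> u) B b C c"
    unfolding triod_def
  proof (intro conjI)
    show "arc_between A' p (\<gamma> u)"
      unfolding arc_between_def A'_def using h by (auto simp: pathstart_def pathfinish_def)
    show "\<gamma> u \<notin> B \<union> C"
      using \<delta>BC[of "\<gamma> u"] u(1) by (auto simp: \<delta>(2))
    have "b \<in> B" "c \<in> C"
      using ar arc_between_continuum by metis+
    then show "b \<notin> C \<union> A'" "c \<notin> A' \<union> B"
      using AA' b c by auto
  qed (use ar co AA' in \<open>auto simp: Int_commute\<close>)
  have t1: "triod_turn p (g ` {0..s}) (g s) B b C c = triod_turn p (path_image g) (g 1) B b C c"
    using triod_turn_shrink[OF g(1,3) s01 gs ar(2,3)] b c g(2) by auto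
  have h2: "h ` {0..1/2} = path_image g1" "h (1/2) = a1"
  proof -
    show "h (1/2) = a1"
      by (simp add: h_def joinpaths_def g1)
    have "h ` {0..1/2} = (\<lambda>x. g1 (2 * x)) ` {0..1/2}"
      by (rule image_cong) (auto simp: h_def joinpaths_def)
    also have "\<dots> = g1 ` {0..1}"
    proof -
      have "(\<lambda>x. 2 * x) ` {0..1/2::real} = {0..1}"
        by (simp add: image_mult_atLeastAtMost)
      then show ?thesis
        by (metis image_image)
    qed
    finally show "h ` {0..1/2} = path_image g1"
      by (simp add: path_image_def)
  qed
  have h3: "h v \<notin> B \<union> C" if "v \<in> {1/2..1}" for v
  proof (cases "v = 1/2")
    case False
    then have "h v = \<delta> (2 * v - 1)"
      using that by (simp add: h_def joinpaths_def)
    then show ?thesis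
      using \<delta>BC[of "h v"] that unfolding path_image_def by auto
  qed (metis h2(2) a1BC)
  have t2: "triod_turn p (h ` {0..1/2}) (h (1/2)) B b C c = triod_turn p (path_image h) (h 1) B b C c"
    using triod_turn_shrink[OF h(1,2) _ _ h3 ar(2,3)] tri' unfolding triod_def A'_def by auto
  have "triod_turn p A' (\<gamma> u) B b C c = triod_turn p A a B b C c"
    using t1 t2 h2 s(2) g1(2) g(2,4) h(3) by (simp add: A'_def)
  moreover have "A' \<subseteq> cball 0 R"
    using u(4) g1A R(1) by (auto simp: A' \<delta>(2))
  ultimately show thesis
    using that[OF tri'] u(3) by blast
qed

text \<open>Seen from a point of a circle, the disc it bounds lies in a half plane.\<close>

lemma turn_from_sphere:
  assumes "arc_between B p b" "arc_between C p c" "a \<notin> B \<union> C"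
    and "B \<union> C \<subseteq> cball 0 R" "norm a = R"
  shows "\<bar>Im (turn a C p c - turn a B p b)\<bar> < pi"
proof -
  have "a \<noteq> 0"
  proof
    assume "a = 0"
    then have "p = a"
      using assms(4,5) arc_between_continuum(2)[OF assms(1)] by auto
    then show False
      using assms(3) arc_between_continuum(2)[OF assms(1)] by simp
  qed
  \<comment> \<open>\<open>z / a\<close> lies in the closed unit disc, whose only point of real part
    1 is 1, and \<open>z \<noteq> a\<close>.\<close>
  have pos: "Re (1 - z / a) > 0" if z: "z \<in> B \<union> C" for z
  proof -
    have "norm z \<le> norm a"
      using z assms(4,5) by auto
    then have n: "norm (z / a) \<le> 1"
      using \<open>a \<noteq> 0\<close> by (simp add: norm_divide)
    have "Re (z / a) \<noteq> 1"
    proof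
      assume re: "Re (z / a) = 1"
      have "(norm (z / a))\<^sup>2 = (Re (z / a))\<^sup>2 + (Im (z / a))\<^sup>2"
        by (rule cmod_power2)
      moreover have "(norm (z / a))\<^sup>2 \<le> 1"
        using n by (simp add: power_le_one)
      ultimately have "Im (z / a) = 0"
        using re by (simp del: Im_divide Re_divide)
      then have "z / a = 1"
        using re by (simp add: complex_eq_iff)
      then show False
        using z assms(3) \<open>a \<noteq> 0\<close> by auto
    qed
    moreover have "Re (z / a) \<le> 1"
      using n complex_Re_le_cmod[of "z / a"] by linarith
    ultimately show ?thesis
      by simp
  qed
  have lo: "log_on a (B \<union> C) (\<lambda>z. Ln (1 - z / a) + Ln (- a))"
    unfolding log_on_def
  proof
    show "continuous_on (B \<union> C) (\<lambda>z. Ln (1 - z / a) + Ln (- a))"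
      by (intro continuous_intros) (use pos \<open>a \<noteq> 0\<close> in \<open>force simp: complex_nonpos_Reals_iff\<close>)+
    show "\<forall>z\<in>B \<union> C. exp (Ln (1 - z / a) + Ln (- a)) = z - a"
    proof
      fix z assume "z \<in> B \<union> C"
      then have "1 - z / a \<noteq> 0"
        using pos by fastforce
      then show "exp (Ln (1 - z / a) + Ln (- a)) = z - a"
        using \<open>a \<noteq> 0\<close> by (simp add: exp_add field_simps)
    qed
  qed
  have t: "turn a K p k = Ln (1 - k / a) - Ln (1 - p / a)" if "arc_between K p k" "K \<subseteq> B \<union> C" for K k
    using turn_eq[OF arc_between_connected[OF that(1)] arc_between_continuum(2,3)[OF that(1)]
        log_on_subset[OF lo that(2)]] by simp
  have "turn a C p c - turn a B p b = Ln (1 - c / a) - Ln (1 - b / a)"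
    using t[OF assms(1)] t[OF assms(2)] by simp
  moreover have "\<bar>Im (Ln (1 - c / a))\<bar> < pi / 2" "\<bar>Im (Ln (1 - b / a))\<bar> < pi / 2"
    using pos arc_between_continuum(3) assms(1,2) by (metis Re_Ln_pos_lt_imp UnI1 UnI2)+
  ultimately show ?thesis
    by simp
qed

text \<open>The legs are extended one after the other to a circle around all of them,
  \<open>triod_rotate\<close> bringing each to the first place. Then each of the three angles is
  less than pi.\<close>

lemma triod_turn_bound:
  assumes "triod p A a B b C c"
  shows "\<bar>Im (triod_turn p A a B b C c)\<bar> < 3 * pi"
proof -
  have mem: "a \<in> A" "b \<in> B" "c \<in> C"
    using assms arc_between_continuum unfolding triod_def by metis+
  have "bounded (A \<union> B \<union> C)"
    using assms arc_between_compact unfolding triod_def by (metis bounded_Un compact_imp_bounded)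
  then obtain R where R: "\<And>z. z \<in> A \<union> B \<union> C \<Longrightarrow> norm z < R"
    by (metis bounded_pos_less)
  have sub: "A \<subseteq> cball 0 R" "B \<subseteq> cball 0 R" "C \<subseteq> cball 0 R"
    using R by (auto simp: less_imp_le)
  have lt: "norm a < R" "norm b < R" "norm c < R"
    using R mem by blast+
  obtain A' a' where A': "triod p A' a' B b C c" "A' \<subseteq> cball 0 R" "norm a' = R"
      "triod_turn p A' a' B b C c = triod_turn p A a B b C c"
    by (rule triod_extend[OF assms _ lt(1)]) (use sub in blast)+
  obtain B' b' where B': "triod p B' b' C c A' a'" "B' \<subseteq> cball 0 R" "norm b' = R"
      "triod_turn p B' b' C c A' a' = triod_turn p B b C c A' a'"
    by (rule triod_extend[OF triod_rotate[OF A'(1)] _ lt(2)]) (use sub A'(2) in blast)+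
  obtain C' c' where C': "triod p C' c' A' a' B' b'" "C' \<subseteq> cball 0 R" "norm c' = R"
      "triod_turn p C' c' A' a' B' b' = triod_turn p C c A' a' B' b'"
    by (rule triod_extend[OF triod_rotate[OF B'(1)] _ lt(3)]) (use sub A'(2) B'(2) in blast)+
  have "triod_turn p A a B b C c = triod_turn p C' c' A' a' B' b'"
    using A'(4) B'(4) C'(4) by (simp add: triod_turn_rotate)
  moreover have "\<bar>Im (turn a' C' p c' - turn a' B' p b')\<bar> < pi"
    "\<bar>Im (turn b' A' p a' - turn b' C' p c')\<bar> < pi"
    "\<bar>Im (turn c' B' p b' - turn c' A' p a')\<bar> < pi"
    by (rule turn_from_sphere[where R = R]; use C' A' B' in \<open>auto simp: triod_def\<close>)+
  ultimately show ?thesis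
    unfolding triod_turn_def by simp
qed

section \<open>Ordered spaces with a countable convex network\<close>

text \<open>The order topology is contained in the given one, perhaps properly. Members of
  \<open>\<N>\<close> are not assumed to be open: small members pass through each point but need not
  be neighbourhoods of it.\<close>

locale convex_network =
  fixes S :: "'a::{metric_space, second_countable_topology} set"
    and lt :: "'a \<Rightarrow> 'a \<Rightarrow> bool" (infix \<open>\<sqsubset>\<close> 50)
    and \<N> :: "'a set set"
  assumes irrefl: "a \<in> S \<Longrightarrow> \<not> a \<sqsubset> a"
    and trans: "a \<in> S \<Longrightarrow> b \<in> S \<Longrightarrow> c \<in> S \<Longrightarrow> a \<sqsubset> b \<Longrightarrow> b \<sqsubset> c \<Longrightarrow> a \<sqsubset> c"
    and total: "a \<in> S \<Longrightarrow> b \<in> S \<Longrightarrow> a \<noteq> b \<Longrightarrow> a \<sqsubset> b \<or> b \<sqsubset> a"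
    and below_open: "a \<in> S \<Longrightarrow> openin (top_of_set S) {x \<in> S. x \<sqsubset> a}"
    and above_open: "a \<in> S \<Longrightarrow> openin (top_of_set S) {x \<in> S. a \<sqsubset> x}"
    and countable_network: "countable \<N>"
    and network_subset: "N \<in> \<N> \<Longrightarrow> N \<subseteq> S"
    and network_convex: "N \<in> \<N> \<Longrightarrow> a \<in> N \<Longrightarrow> b \<in> N \<Longrightarrow> c \<in> S \<Longrightarrow> a \<sqsubset> c \<Longrightarrow> c \<sqsubset> b \<Longrightarrow> c \<in> N"
    and network: "e \<in> V \<Longrightarrow> openin (top_of_set S) V \<Longrightarrow> \<exists>N\<in>\<N>. e \<in> N \<and> N \<subseteq> V"
    and hereditarily_disconnected: "hereditarily_disconnected_space (top_of_set S)"
begin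

abbreviation le (infix \<open>\<sqsubseteq>\<close> 50)
  where "a \<sqsubseteq> b \<equiv> a = b \<or> a \<sqsubset> b"

lemma not_less: "a \<in> S \<Longrightarrow> b \<in> S \<Longrightarrow> \<not> a \<sqsubset> b \<longleftrightarrow> b \<sqsubseteq> a"
  using total irrefl trans by blast

text \<open>The set Z of the overview; each member of \<open>\<N>\<close> contributes at most a
  greatest and a least element.\<close>

definition extreme :: "'a set"
  where "extreme = (\<Union>N\<in>\<N>. {c \<in> N. \<forall>x\<in>N. \<not> c \<sqsubset> x} \<union> {c \<in> N. \<forall>x\<in>N. \<not> x \<sqsubset> c})"

lemma countable_extreme: "countable extreme"
proof -
  have "countable ({c \<in> N. \<forall>x\<in>N. \<not> c \<sqsubset> x} \<union> {c \<in> N. \<forall>x\<in>N. \<not> x \<sqsubset> c})" if "N \<in> \<N>" for N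
  proof -
    have one: "countable M" if "\<And>x y. x \<in> M \<Longrightarrow> y \<in> M \<Longrightarrow> x = y" for M :: "'a set"
    proof (cases "M = {}")
      case False
      then obtain m where "m \<in> M"
        by blast
      then have "M = {m}"
        using that by blast
      then show ?thesis
        by simp
    qed simp
    show ?thesis
      using network_subset[OF \<open>N \<in> \<N>\<close>] total
      by (intro countable_Un one) (blast dest: subsetD)+
  qed
  then show ?thesis
    unfolding extreme_def using countable_network by blast
qed

text \<open>A member of \<open>\<N>\<close> through \<open>c\<close> inside \<open>V\<close> has
  points on both sides of \<open>c\<close>, since \<open>c\<close> is extreme in none; by convexity
  it contains the interval between them.\<close>

lemma order_nbhd:
  assumes "c \<in> S" "c \<notin> extreme" "openin (top_of_set S) V" "c \<in> V"
  obtains u v where "u \<in> S" "v \<in> S" "u \<sqsubset> c" "c \<sqsubset> v" "\<And>x. x \<in> S \<Longrightarrow> u \<sqsubset> x \<Longrightarrow> x \<sqsubset> v \<Longrightarrow> x \<in> V"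
proof -
  obtain N where N: "N \<in> \<N>" "c \<in> N" "N \<subseteq> V"
    using network assms by blast
  then obtain u v where uv: "u \<in> N" "v \<in> N" "u \<sqsubset> c" "c \<sqsubset> v"
    using assms(2) unfolding extreme_def by blast
  show thesis
    by (rule that[of u v]) (use uv N network_subset[OF N(1)] network_convex[OF N(1)] in blast)+
qed

section \<open>Clopen initial segments\<close>

definition cut :: "'a set \<Rightarrow> bool"
  where "cut K \<longleftrightarrow> openin (top_of_set S) K \<and> openin (top_of_set S) (S - K) \<and>
    K \<subseteq> S \<and> (\<forall>y\<in>K. \<forall>x\<in>S. x \<sqsubset> y \<longrightarrow> x \<in> K)"

lemma cutI:
  assumes "openin (top_of_set S) K" "openin (top_of_set S) (S - K)"
    and "\<And>x y. y \<in> K \<Longrightarrow> x \<in> S \<Longrightarrow> x \<sqsubset> y \<Longrightarrow> x \<in> K"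
  shows "cut K"
  using assms openin_imp_subset[OF assms(1)] unfolding cut_def by blast

text \<open>If no point of \<open>V\<close> lay between \<open>c\<close> and \<open>d\<close>, then
  \<open>{x \<in> S. x \<sqsubseteq> c}\<close> would be the union of two open sets, the ray below
  \<open>c\<close> and the part of \<open>V\<close> below \<open>d\<close>, hence a cut between
  \<open>a\<close> and \<open>b\<close>. The limit is one in the given topology, not only in the
  order.\<close>

lemma right_limit_if_no_cut:
  assumes ab: "a \<in> S" "b \<in> S" and nocut: "\<forall>K. cut K \<longrightarrow> a \<in> K \<longrightarrow> b \<in> K"
    and c: "c \<in> S" "a \<sqsubseteq> c" "c \<sqsubset> b" and V: "openin (top_of_set S) V" "c \<in> V"
    and d: "d \<in> S" "c \<sqsubset> d"
  obtains x where "x \<in> V" "c \<sqsubset> x" "x \<sqsubset> d"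
proof (rule ccontr)
  assume "\<not> thesis"
  then have no: "\<not> c \<sqsubset> x" if "x \<in> V" "x \<sqsubset> d" for x
    using that \<open>\<And>x. x \<in> V \<Longrightarrow> c \<sqsubset> x \<Longrightarrow> x \<sqsubset> d \<Longrightarrow> thesis\<close> by blast
  have VS: "V \<subseteq> S"
    using V(1) openin_imp_subset by blast
  define K where "K = {x \<in> S. x \<sqsubseteq> c}"
  have K: "K = {x \<in> S. x \<sqsubset> c} \<union> (V \<inter> {x \<in> S. x \<sqsubset> d})"
    using no not_less VS V(2) c(1) d trans[OF _ c(1) d(1)] unfolding K_def by blast
  have "openin (top_of_set S) K"
    unfolding K by (intro openin_Un openin_Int V below_open c d)
  moreover have "S - K = {x \<in> S. c \<sqsubset> x}"
    unfolding K_def using not_less c(1) irrefl trans by blast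
  moreover have "x \<in> K" if "y \<in> K" "x \<in> S" "x \<sqsubset> y" for x y
    using that trans[of x y c] c(1) unfolding K_def by blast
  ultimately have "cut K"
    using above_open[OF c(1)] by (intro cutI) auto
  then have "b \<in> K"
    using nocut c ab unfolding K_def by blast
  then show False
    using c ab irrefl trans unfolding K_def by blast
qed

text \<open>Mirror image: now \<open>{x \<in> S. x \<sqsubset> c}\<close> would be the cut.\<close>

lemma left_limit_if_no_cut:
  assumes ab: "a \<in> S" "b \<in> S" and nocut: "\<forall>K. cut K \<longrightarrow> a \<in> K \<longrightarrow> b \<in> K"
    and c: "c \<in> S" "a \<sqsubset> c" "c \<sqsubseteq> b" and V: "openin (top_of_set S) V" "c \<in> V"
    and d: "d \<in> S" "d \<sqsubset> c"
  obtains x where "x \<in> V" "d \<sqsubset> x" "x \<sqsubset> c"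
proof (rule ccontr)
  assume "\<not> thesis"
  then have no: "\<not> x \<sqsubset> c" if "x \<in> V" "d \<sqsubset> x" for x
    using that \<open>\<And>x. x \<in> V \<Longrightarrow> d \<sqsubset> x \<Longrightarrow> x \<sqsubset> c \<Longrightarrow> thesis\<close> by blast
  have VS: "V \<subseteq> S"
    using V(1) openin_imp_subset by blast
  define K where "K = {x \<in> S. x \<sqsubset> c}"
  have K: "S - K = {x \<in> S. c \<sqsubset> x} \<union> (V \<inter> {x \<in> S. d \<sqsubset> x})"
    using no not_less[OF _ c(1)] VS V(2) c(1) d trans[OF d(1) c(1)] irrefl trans unfolding K_def by blast
  have "openin (top_of_set S) (S - K)"
    unfolding K by (intro openin_Un openin_Int V above_open c d)
  moreover have "openin (top_of_set S) K"
    unfolding K_def by (rule below_open[OF c(1)])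
  moreover have "x \<in> K" if "y \<in> K" "x \<in> S" "x \<sqsubset> y" for x y
    using that trans[of x y c] c(1) unfolding K_def by blast
  ultimately have "cut K"
    by (intro cutI) auto
  then have "b \<in> K"
    using nocut c ab unfolding K_def by blast
  then show False
    using c ab irrefl trans unfolding K_def by blast
qed

text \<open>If \<open>A\<close> has no greatest element, the points below some element of
  \<open>A\<close> form an open initial segment. If its complement \<open>U\<close> had no least
  element either, \<open>U\<close> would be open too, and the segment would be a cut between
  \<open>a\<close> and \<open>b\<close>.\<close>

lemma sup_if_no_cut:
  assumes ab: "a \<in> S" "b \<in> S" and nocut: "\<forall>K. cut K \<longrightarrow> a \<in> K \<longrightarrow> b \<in> K"
    and A: "A \<subseteq> S" "A \<noteq> {}" "\<forall>x\<in>A. a \<sqsubseteq> x \<and> x \<sqsubseteq> b"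
  obtains c where "c \<in> S" "\<forall>x\<in>A. x \<sqsubseteq> c" "\<forall>u\<in>S. u \<sqsubset> c \<longrightarrow> (\<exists>x\<in>A. u \<sqsubset> x)"
proof (cases "\<exists>m\<in>A. \<forall>x\<in>A. x \<sqsubseteq> m")
  case True
  then show ?thesis
    using that A(1) by blast
next
  case False
  then have nomax: "\<exists>x\<in>A. m \<sqsubset> x" if "m \<in> A" for m
    using that not_less A(1) by (metis subsetD)
  define U where "U = {x \<in> S. \<forall>y\<in>A. y \<sqsubset> x}"
  show ?thesis
  proof (cases "\<exists>c\<in>U. \<forall>u\<in>U. c \<sqsubseteq> u")
    case True
    then obtain c where c: "c \<in> U" "\<And>u. u \<in> U \<Longrightarrow> c \<sqsubseteq> u"
      by blast
    have "\<exists>x\<in>A. u \<sqsubset> x" if u: "u \<in> S" "u \<sqsubset> c" for u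
    proof -
      have "u \<notin> U"
        using c u irrefl trans unfolding U_def by blast
      then obtain y where y: "y \<in> A" "\<not> y \<sqsubset> u"
        using u unfolding U_def by blast
      obtain y' where "y' \<in> A" "y \<sqsubset> y'"
        using nomax y(1) by blast
      then show ?thesis
        using y not_less[of y u] trans[of u y y'] A(1) u(1) by (metis subsetD)
    qed
    then show ?thesis
      using that[of c] c unfolding U_def by blast
  next
    case False
    define K where "K = S - U"
    have KU: "K = (\<Union>y\<in>A. {x \<in> S. x \<sqsubset> y})"
    proof
      show "K \<subseteq> (\<Union>y\<in>A. {x \<in> S. x \<sqsubset> y})"
      proof
        fix x assume "x \<in> K"
        then obtain y where y: "x \<in> S" "y \<in> A" "\<not> y \<sqsubset> x"
          unfolding K_def U_def by blast
        obtain y' where "y' \<in> A" "y \<sqsubset> y'"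
          using nomax y(2) by blast
        then have "x \<sqsubset> y'"
          using y not_less[of y x] trans[of x y y'] A(1) by (metis subsetD)
        then show "x \<in> (\<Union>y\<in>A. {x \<in> S. x \<sqsubset> y})"
          using y(1) \<open>y' \<in> A\<close> by blast
      qed
      show "(\<Union>y\<in>A. {x \<in> S. x \<sqsubset> y}) \<subseteq> K"
        unfolding K_def U_def using A(1) irrefl trans by blast
    qed
    have Ueq: "U = (\<Union>u\<in>U. {x \<in> S. u \<sqsubset> x})"
    proof
      show "U \<subseteq> (\<Union>u\<in>U. {x \<in> S. u \<sqsubset> x})"
      proof
        fix x assume "x \<in> U"
        then obtain u where "u \<in> U" "\<not> x \<sqsubseteq> u"
          using False by blast
        then show "x \<in> (\<Union>u\<in>U. {x \<in> S. u \<sqsubset> x})"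
          using total[of u x] \<open>x \<in> U\<close> unfolding U_def by blast
      qed
      show "(\<Union>u\<in>U. {x \<in> S. u \<sqsubset> x}) \<subseteq> U"
      proof
        fix x assume "x \<in> (\<Union>u\<in>U. {x \<in> S. u \<sqsubset> x})"
        then obtain u where u: "u \<in> S" "\<And>y. y \<in> A \<Longrightarrow> y \<sqsubset> u" "x \<in> S" "u \<sqsubset> x"
          unfolding U_def by blast
        then show "x \<in> U"
          using trans[of _ u x] A(1) unfolding U_def by blast
      qed
    qed
    have "openin (top_of_set S) (\<Union>u\<in>U. {x \<in> S. u \<sqsubset> x})"
      using above_open by (intro openin_Union) (auto simp: U_def)
    then have "openin (top_of_set S) U"
      using Ueq by simp
    moreover have "openin (top_of_set S) K"
      unfolding KU using below_open A(1) by (intro openin_Union) auto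
    moreover have "S - K = U"
      unfolding K_def U_def by blast
    moreover have "x \<in> K" if "y \<in> K" "x \<in> S" "x \<sqsubset> y" for x y
      using that trans[of x y] A(1) unfolding KU by blast
    ultimately have "cut K"
      by (intro cutI) auto
    moreover have "a \<in> K"
    proof -
      obtain y where y: "y \<in> A"
        using A(2) by blast
      obtain y' where "y' \<in> A" "y \<sqsubset> y'"
        using nomax y by blast
      moreover have "a \<sqsubseteq> y" "y \<in> S" "y' \<in> S"
        using A(1,3) y \<open>y' \<in> A\<close> by blast+
      ultimately have "a \<sqsubset> y'"
        using trans[of a y y'] ab(1) by metis
      then show ?thesis
        using \<open>y' \<in> A\<close> ab(1) unfolding KU by blast
    qed
    ultimately have "b \<in> K"
      using nocut by blast
    then obtain y where "y \<in> A" "b \<sqsubset> y"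
      unfolding KU by blast
    moreover have "y \<in> S" "y \<sqsubseteq> b"
      using A(1,3) \<open>y \<in> A\<close> by blast+
    ultimately show ?thesis
      using ab(2) irrefl trans[of b y b] by metis
  qed
qed

text \<open>Nested intervals with left ends in \<open>U\<close> and right ends in \<open>V\<close>
  are chosen so that each extreme point is left out of one of them. A supremum \<open>c\<close>
  inside all of them is not extreme, so order intervals around \<open>c\<close> are small; this
  contradicts \<open>c \<in> V\<close> as well as \<open>c \<in> U\<close>.\<close>

lemma no_separation_if_no_cut:
  assumes ab: "a \<in> S" "b \<in> S" "a \<sqsubset> b" and nocut: "\<forall>K. cut K \<longrightarrow> a \<in> K \<longrightarrow> b \<in> K"
    and op: "open U" "open V" "a \<in> U" "b \<in> V"
    and cover: "\<And>x. x \<in> S \<Longrightarrow> a \<sqsubseteq> x \<Longrightarrow> x \<sqsubseteq> b \<Longrightarrow> x \<in> U \<or> x \<in> V"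
    and disj: "\<And>x. x \<in> S \<Longrightarrow> a \<sqsubseteq> x \<Longrightarrow> x \<sqsubseteq> b \<Longrightarrow> x \<in> U \<Longrightarrow> x \<notin> V"
  shows False
proof -
  have opS: "openin (top_of_set S) (S \<inter> U)" "openin (top_of_set S) (S \<inter> V)"
    using op(1,2) by auto
  \<comment> \<open>Inserting \<open>a\<close> keeps the enumerated set from being empty.\<close>
  define f where "f = from_nat_into (insert a extreme)"
  have f: "extreme \<subseteq> range f"
    using countable_extreme range_from_nat_into[of "insert a extreme"] by (auto simp: f_def)
  define P where "P q \<longleftrightarrow> fst q \<in> S \<and> snd q \<in> S \<and> a \<sqsubseteq> fst q \<and> fst q \<sqsubset> snd q \<and> snd q \<sqsubseteq> b \<and>
    fst q \<in> U \<and> snd q \<in> V" for q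
  define Q where "Q z q q' \<longleftrightarrow> fst q \<sqsubset> fst q' \<and> snd q' \<sqsubset> snd q \<and> \<not> (z \<in> S \<and> fst q' \<sqsubseteq> z \<and> z \<sqsubseteq> snd q')" for z q q'
  have step: "\<exists>q'. P q' \<and> Q z q q'" if Pq: "P q" for z q
  proof -
    obtain x y where q: "q = (x, y)"
      by fastforce
    have xy: "x \<in> S" "y \<in> S" "a \<sqsubseteq> x" "x \<sqsubset> y" "y \<sqsubseteq> b" "x \<in> U" "y \<in> V"
      using Pq by (auto simp: P_def q)
    have between: "a \<sqsubseteq> w \<and> w \<sqsubseteq> b" if "w \<in> S" "x \<sqsubseteq> w" "w \<sqsubseteq> y" for w
      using that xy ab trans by blast
    have R: "\<exists>w. w \<in> S \<inter> U \<and> c \<sqsubset> w \<and> w \<sqsubset> d" if c: "c \<in> S" "c \<in> U" "x \<sqsubseteq> c" "c \<sqsubset> y" "d \<in> S" "c \<sqsubset> d" for c d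
    proof -
      have "a \<sqsubseteq> c" "c \<sqsubset> b"
        using c xy ab trans by blast+
      then show ?thesis
        using right_limit_if_no_cut[OF ab(1,2) nocut c(1) _ _ opS(1) _ c(5,6)] c by blast
    qed
    have L: "\<exists>w. w \<in> S \<inter> V \<and> d \<sqsubset> w \<and> w \<sqsubset> c" if c: "c \<in> S" "c \<in> V" "x \<sqsubset> c" "c \<sqsubseteq> y" "d \<in> S" "d \<sqsubset> c" for c d
    proof -
      have "a \<sqsubset> c" "c \<sqsubseteq> b"
        using c xy ab trans by blast+
      then show ?thesis
        using left_limit_if_no_cut[OF ab(1,2) nocut c(1) _ _ opS(2) _ c(5,6)] c by blast
    qed
    have fin: "\<exists>q'. P q' \<and> Q z q q'" if w: "x' \<in> S \<inter> U" "y' \<in> S \<inter> V" "x \<sqsubset> x'" "x' \<sqsubset> y'" "y' \<sqsubset> y"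
      "\<not> (z \<in> S \<and> x' \<sqsubseteq> z \<and> z \<sqsubseteq> y')" for x' y'
    proof -
      have "a \<sqsubseteq> x'" "y' \<sqsubseteq> b"
        using w xy ab trans[of a x x'] trans[of y' y b] by blast+
      then show ?thesis
        using w by (intro exI[of _ "(x', y')"]) (auto simp: P_def Q_def q)
    qed
    \<comment> \<open>If \<open>z\<close> lies inside the interval, the new interval is put to its
      right when \<open>z \<in> U\<close> and to its left when \<open>z \<in> V\<close>; otherwise
      any strictly smaller interval excludes \<open>z\<close>.\<close>
    consider "z \<in> S" "x \<sqsubset> z" "z \<sqsubset> y" "z \<in> U" | "z \<in> S" "x \<sqsubset> z" "z \<sqsubset> y" "z \<in> V"
      | "z \<notin> S \<or> z \<sqsubseteq> x \<or> y \<sqsubseteq> z"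
      using cover between not_less xy(1,2) by blast
    then show ?thesis
    proof cases
      case 1
      obtain x' where x': "x' \<in> S \<inter> U" "z \<sqsubset> x'" "x' \<sqsubset> y"
        using R[of z y] 1 xy by blast
      have "x \<sqsubset> x'"
        using trans[of x z x'] 1 x' xy by blast
      then obtain y' where y': "y' \<in> S \<inter> V" "x' \<sqsubset> y'" "y' \<sqsubset> y"
        using L[of y x'] x' xy by blast
      have "\<not> x' \<sqsubseteq> z"
        using x' 1 irrefl trans by blast
      then show ?thesis
        using fin[of x' y'] x' y' \<open>x \<sqsubset> x'\<close> by blast
    next
      case 2
      obtain y' where y': "y' \<in> S \<inter> V" "x \<sqsubset> y'" "y' \<sqsubset> z"
        using L[of z x] 2 xy by blast
      then obtain x' where x': "x' \<in> S \<inter> U" "x \<sqsubset> x'" "x' \<sqsubset> y'"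
        using R[of x y'] xy by blast
      have "y' \<sqsubset> y"
        using trans[of y' z y] 2 y' xy by blast
      moreover have "\<not> z \<sqsubseteq> y'"
        using y' 2 irrefl trans by blast
      ultimately show ?thesis
        using fin[of x' y'] x' y' by blast
    next
      case 3
      obtain x' where x': "x' \<in> S \<inter> U" "x \<sqsubset> x'" "x' \<sqsubset> y"
        using R[of x y] xy by blast
      obtain y' where y': "y' \<in> S \<inter> V" "x' \<sqsubset> y'" "y' \<sqsubset> y"
        using L[of y x'] x' xy by blast
      have "\<not> (z \<in> S \<and> x' \<sqsubseteq> z \<and> z \<sqsubseteq> y')"
      proof
        assume z: "z \<in> S \<and> x' \<sqsubseteq> z \<and> z \<sqsubseteq> y'"
        then have "x \<sqsubset> z" "z \<sqsubset> y"
          using trans[of x x' z] trans[of z y' y] x' y' xy by blast+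
        then show False
          using 3 z xy trans[of x z x] trans[of y z y] irrefl by blast
      qed
      then show ?thesis
        using fin[of x' y'] x' y' by blast
    qed
  qed
  have "\<exists>q. P (q 0) \<and> (\<forall>n. P (q (Suc n)) \<and> Q (f n) (q n) (q (Suc n)))"
  proof -
    have "\<exists>q. \<forall>n. P (q n) \<and> Q (f n) (q n) (q (Suc n))"
      by (rule dependent_nat_choice) (use ab op step in \<open>auto simp: P_def intro!: exI[of _ "(a, b)"]\<close>)
    then show ?thesis
      by blast
  qed
  then obtain q where q: "\<And>n. P (q n)" "\<And>n. Q (f n) (q n) (q (Suc n))"
    by (metis not0_implies_Suc)
  define x where "x n = fst (q n)" for n
  define y where "y n = snd (q n)" for n
  have xy: "x n \<in> S" "y n \<in> S" "a \<sqsubseteq> x n" "x n \<sqsubset> y n" "y n \<sqsubseteq> b" "x n \<in> U" "y n \<in> V" for n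
    using q(1)[of n] by (auto simp: P_def x_def y_def)
  have stp: "x n \<sqsubset> x (Suc n)" "y (Suc n) \<sqsubset> y n" "\<not> (f n \<in> S \<and> x (Suc n) \<sqsubseteq> f n \<and> f n \<sqsubseteq> y (Suc n))" for n
    using q(2)[of n] by (auto simp: Q_def x_def y_def)
  have xmono: "x n \<sqsubseteq> x (n + k)" for n k
  proof (induction k)
    case (Suc k)
    then show ?case
      using stp(1)[of "n + k"] trans[of "x n" "x (n + k)" "x (Suc (n + k))"] xy(1) by auto
  qed simp
  have ymono: "y (n + k) \<sqsubseteq> y n" for n k
  proof (induction k)
    case (Suc k)
    then show ?case
      using stp(2)[of "n + k"] trans[of "y (Suc (n + k))" "y (n + k)" "y n"] xy(2) by auto
  qed simp
  have xley: "x n \<sqsubset> y m" for n m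
  proof -
    have "x n \<sqsubset> y (n + m)"
      using xmono[of n m] xy(4)[of "n + m"] trans[of "x n" "x (n + m)" "y (n + m)"] xy(1,2) by metis
    moreover have "y (n + m) \<sqsubseteq> y m"
      using ymono[of m n] by (simp add: add.commute)
    ultimately show ?thesis
      using trans[of "x n" "y (n + m)" "y m"] xy(1,2) by metis
  qed
  \<comment> \<open>The supremum is taken of all points of \<open>U\<close> from \<open>a\<close> on
    below every \<open>y n\<close>, not just of the \<open>x n\<close>; so no point of
    \<open>U\<close> below all \<open>y n\<close> is left above \<open>c\<close>.\<close>
  define A where "A = {w \<in> S. w \<in> U \<and> a \<sqsubseteq> w \<and> (\<forall>n. w \<sqsubseteq> y n)}"
  have xA: "x n \<in> A" for n
    using xy xley by (auto simp: A_def)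
  have AD: "w \<in> S" "w \<in> U" "a \<sqsubseteq> w" "w \<sqsubseteq> y n" if "w \<in> A" for w n
    using that by (simp_all add: A_def)
  have Ab: "w \<sqsubseteq> b" if "w \<in> A" for w
    using AD(1)[OF that] AD(4)[OF that, of 0] xy(2,5)[of 0] ab(2) trans[of w "y 0" b] by metis
  obtain c where c: "c \<in> S" "\<forall>w\<in>A. w \<sqsubseteq> c" "\<forall>u\<in>S. u \<sqsubset> c \<longrightarrow> (\<exists>w\<in>A. u \<sqsubset> w)"
  proof (rule sup_if_no_cut[OF ab(1,2) nocut])
    show "A \<subseteq> S" "A \<noteq> {}" "\<forall>w\<in>A. a \<sqsubseteq> w \<and> w \<sqsubseteq> b"
      using AD(1,3) Ab xA by blast+
  qed
  have cy: "c \<sqsubseteq> y n" for n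
  proof (rule ccontr)
    assume "\<not> c \<sqsubseteq> y n"
    then have "y n \<sqsubset> c"
      using c(1) xy(2) not_less by blast
    then obtain w where "w \<in> A" "y n \<sqsubset> w"
      using c(3) xy(2) by blast
    then show False
      using AD(1)[of w] AD(4)[of w n] xy(2)[of n] irrefl trans by metis
  qed
  have xc: "x n \<sqsubseteq> c" for n
    using c(2) xA by blast
  have "c \<notin> extreme"
  proof
    assume "c \<in> extreme"
    then obtain n where "c = f n"
      using f by blast
    then show False
      using stp(3)[of n] cy[of "Suc n"] xc[of "Suc n"] c(1) by metis
  qed
  have "a \<sqsubseteq> c"
    using c(1) xc[of 0] xy(1,3)[of 0] ab trans[of a "x 0" c] by metis
  moreover have "c \<sqsubseteq> b"
    using c(1) cy[of 0] xy(2,5)[of 0] ab trans[of c "y 0" b] by metis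
  ultimately have cab: "a \<sqsubseteq> c" "c \<sqsubseteq> b" .
  show False
  proof (cases "c \<in> U")
    case False
    then have "c \<in> S \<inter> V"
      using cover c(1) cab by blast
    then obtain u v where uv: "u \<in> S" "v \<in> S" "u \<sqsubset> c" "c \<sqsubset> v"
        "\<And>w. w \<in> S \<Longrightarrow> u \<sqsubset> w \<Longrightarrow> w \<sqsubset> v \<Longrightarrow> w \<in> S \<inter> V"
      using order_nbhd[OF c(1) \<open>c \<notin> extreme\<close> opS(2)] by metis
    obtain w where w: "w \<in> A" "u \<sqsubset> w"
      using c(3) uv by blast
    have "w \<sqsubset> v"
      using c(1) c(2) w(1) uv(2,4) AD(1)[OF w(1)] trans[of w c v] by metis
    then have "w \<in> V"
      using uv(5) w(2) AD(1)[OF w(1)] by blast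
    then show False
      using disj[of w] Ab[OF w(1)] AD[OF w(1)] by blast
  next
    case True
    then obtain u v where uv: "u \<in> S" "v \<in> S" "u \<sqsubset> c" "c \<sqsubset> v"
        "\<And>w. w \<in> S \<Longrightarrow> u \<sqsubset> w \<Longrightarrow> w \<sqsubset> v \<Longrightarrow> w \<in> S \<inter> U"
      using order_nbhd[OF c(1) \<open>c \<notin> extreme\<close> opS(1)] c(1) by (metis IntI)
    \<comment> \<open>An interval around \<open>c\<close> lies in \<open>U\<close> and thus contains
      no \<open>y n\<close>. A point \<open>w\<close> of it above \<open>c\<close> is then below all
      \<open>y n\<close>, hence in \<open>A\<close> but above its supremum.\<close>
    have yb: "y n \<notin> U" for n
      using disj[of "y n"] xy[of n] ab trans[of a "x n" "y n"] by blast
    then have cyl: "c \<sqsubset> y n" for n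
      using cy[of n] True by metis
    then have "c \<sqsubset> b"
      using xy(2,5)[of 0] c(1) ab(2) trans[of c "y 0" b] by metis
    then obtain w where w: "w \<in> S" "c \<sqsubset> w" "w \<sqsubset> v"
      using right_limit_if_no_cut[OF ab(1,2) nocut c(1) cab(1) _ openin_subtopology_self c(1) uv(2,4)] by blast
    have wU: "w \<in> U"
      using uv w trans[of u c w] c(1) by blast
    show False
    proof (cases "\<forall>n. w \<sqsubseteq> y n")
      case True
      then have "w \<in> A"
        using w wU cab c(1) ab(1) trans[of a c w] unfolding A_def by blast
      then have "w \<sqsubseteq> c"
        using c(2) by blast
      then show False
        using c(1) w(1,2) irrefl trans[of c w c] by metis
    next
      case False
      then obtain n where "y n \<sqsubset> w"
        using not_less xy(2) w(1) by blast
      then have "y n \<sqsubset> v"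
        using trans[of "y n" w v] xy(2) w(1,3) uv(2) by blast
      moreover have "u \<sqsubset> y n"
        using trans[of u c "y n"] cyl[of n] xy(2) c(1) uv(1,3) by blast
      ultimately show False
        using uv(5)[of "y n"] xy(2) yb by blast
    qed
  qed
qed


text \<open>The interval from \<open>a\<close> to \<open>b\<close> is disconnected. A cut between
  two of its points is also one between \<open>a\<close> and \<open>b\<close>; if there were none,
  \<open>no_separation_if_no_cut\<close> could be applied to one point from each side of a
  separation.\<close>

lemma cut_exists:
  assumes ab: "a \<in> S" "b \<in> S" "a \<sqsubset> b"
  obtains K where "cut K" "a \<in> K" "b \<notin> K"
proof (rule ccontr)
  assume "\<not> thesis"
  then have nocut: "\<forall>K. cut K \<longrightarrow> a \<in> K \<longrightarrow> b \<in> K"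
    using that by blast
  define I where "I = {x \<in> S. a \<sqsubseteq> x \<and> x \<sqsubseteq> b}"
  have "a \<noteq> b"
    using ab irrefl by metis
  then have "nondegenerate I"
    unfolding nondegenerate_def I_def using ab by (intro bexI[of _ a] bexI[of _ b]) auto
  then have "\<not> connected I"
    using hereditarily_disconnected unfolding hereditarily_disconnected_space_def
    by (auto simp: connectedin_subtopology I_def)
  then obtain U V where UV: "open U" "open V" "I \<subseteq> U \<union> V" "U \<inter> V \<inter> I = {}" "U \<inter> I \<noteq> {}" "V \<inter> I \<noteq> {}"
    unfolding connected_def by blast
  have fin: False if xy: "x \<in> I" "y \<in> I" "x \<sqsubset> y" "x \<in> U" "y \<in> V" "open U" "open V"
      "I \<subseteq> U \<union> V" "U \<inter> V \<inter> I = {}" for x y U V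
  proof -
    have xyS: "x \<in> S" "y \<in> S" "a \<sqsubseteq> x" "y \<sqsubseteq> b"
      using xy by (simp_all add: I_def)
    have I: "w \<in> I" if w: "w \<in> S" "x \<sqsubseteq> w" "w \<sqsubseteq> y" for w
    proof -
      have "a \<sqsubseteq> w"
        using xyS w trans[of a x w] ab(1) by metis
      moreover have "w \<sqsubseteq> b"
        using xyS w trans[of w y b] ab(2) by metis
      ultimately show ?thesis
        using w(1) by (simp add: I_def)
    qed
    have nc: "\<forall>K. cut K \<longrightarrow> x \<in> K \<longrightarrow> y \<in> K"
    proof (intro allI impI)
      fix K assume K: "cut K" "x \<in> K"
      then have "a \<in> K"
        using xyS(3) ab(1) unfolding cut_def by blast
      then have "b \<in> K"
        using nocut K(1) by blast
      then show "y \<in> K"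
        using xyS(2,4) K(1) unfolding cut_def by blast
    qed
    show False
    proof (rule no_separation_if_no_cut[OF xyS(1,2) xy(3) nc xy(6,7,4,5)])
      fix w assume "w \<in> S" "x \<sqsubseteq> w" "w \<sqsubseteq> y"
      then have "w \<in> I"
        by (rule I)
      then show "w \<in> U \<or> w \<in> V" "w \<in> U \<Longrightarrow> w \<notin> V"
        using xy(8,9) by blast+
    qed
  qed
  obtain x y where xy: "x \<in> U" "x \<in> I" "y \<in> V" "y \<in> I"
    using UV(5,6) by blast
  then have "x \<noteq> y" "x \<in> S" "y \<in> S"
    using UV(4) by (auto simp: I_def)
  then consider "x \<sqsubset> y" | "y \<sqsubset> x"
    using total by blast
  then show False
  proof cases
    case 1
    show ?thesis
      by (rule fin[OF xy(2,4) 1 xy(1,3) UV(1-4)])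
  next
    case 2
    show ?thesis
      by (rule fin[OF xy(4,2) 2 xy(3,1) UV(2,1)]) (use UV(3,4) in blast)+
  qed
qed

text \<open>Lindelof's theorem for the order relation as a subset of \<open>S \<times> S\<close>,
  which the open sets \<open>K \<times> (S - K)\<close> cover.\<close>

lemma countable_cuts:
  obtains \<kappa> :: "nat \<Rightarrow> 'a set" where "\<And>n. cut (\<kappa> n)"
    "\<And>a b. a \<in> S \<Longrightarrow> b \<in> S \<Longrightarrow> a \<sqsubset> b \<Longrightarrow> \<exists>n. a \<in> \<kappa> n \<and> b \<notin> \<kappa> n"
proof -
  define \<F> where "\<F> = (\<lambda>K. K \<times> (S - K)) ` {K. cut K}"
  have "openin (top_of_set (S \<times> S)) F" if "F \<in> \<F>" for F
    using that unfolding \<F>_def cut_def by (auto intro!: openin_Times)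
  then obtain \<F>' where F': "\<F>' \<subseteq> \<F>" "countable \<F>'" "\<Union>\<F>' = \<Union>\<F>"
    using Lindelof_openin[of \<F> "S \<times> S"] by blast
  then obtain C where C: "C \<subseteq> {K. cut K}" "countable C" "\<F>' = (\<lambda>K. K \<times> (S - K)) ` C"
    unfolding \<F>_def using countable_subset_image[of \<F>' "\<lambda>K. K \<times> (S - K)" "{K. cut K}"] by blast
  have "cut {}"
    by (simp add: cut_def)
  define \<kappa> where "\<kappa> = from_nat_into (insert {} C)"
  have range: "range \<kappa> = insert {} C"
    unfolding \<kappa>_def using C(2) by (intro range_from_nat_into) auto
  show thesis
  proof (rule that)
    show "cut (\<kappa> n)" for n
      using range C(1) \<open>cut {}\<close> by (metis (no_types, lifting) insertE mem_Collect_eq rangeI subsetD)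
    fix a b assume ab: "a \<in> S" "b \<in> S" "a \<sqsubset> b"
    obtain K where "cut K" "a \<in> K" "b \<notin> K"
      using cut_exists[OF ab] .
    then have "(a, b) \<in> \<Union>\<F>"
      using ab(2) unfolding \<F>_def by blast
    then have "(a, b) \<in> \<Union>\<F>'"
      using F'(3) by simp
    then obtain L where "L \<in> C" "a \<in> L" "b \<notin> L"
      unfolding C(3) by blast
    moreover from this(1) obtain n where "L = \<kappa> n"
      using range by blast
    ultimately show "\<exists>n. a \<in> \<kappa> n \<and> b \<notin> \<kappa> n"
      by blast
  qed
qed

text \<open>The level \<open>r\<close> of \<open>h\<close> is chosen to avoid the countably many values of \<open>h\<close> at extreme
  points; then every point of the level set has a small convex clopen neighbourhood, and by the
  two semicontinuity hypotheses such neighbourhoods accumulate only inside \<open>{x. h x \<le> r}\<close>.\<close>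

theorem clopen_below_level:
  fixes h :: "'a \<Rightarrow> real"
  assumes h: "continuous_on S h" and z: "z \<in> S" "h z < r'"
    and right: "\<And>r y. y \<in> S \<Longrightarrow> r < h y \<Longrightarrow> (\<And>V. openin (top_of_set S) V \<Longrightarrow> y \<in> V \<Longrightarrow> \<exists>x\<in>V. y \<sqsubset> x) \<Longrightarrow>
      \<exists>c\<in>S. y \<sqsubset> c \<and> (\<forall>e\<in>S. y \<sqsubset> e \<longrightarrow> e \<sqsubset> c \<longrightarrow> h e \<noteq> r)"
    and left: "\<And>r y. y \<in> S \<Longrightarrow> r < h y \<Longrightarrow> (\<And>V. openin (top_of_set S) V \<Longrightarrow> y \<in> V \<Longrightarrow> \<exists>x\<in>V. x \<sqsubset> y) \<Longrightarrow>
      \<exists>c\<in>S. c \<sqsubset> y \<and> (\<forall>e\<in>S. e \<sqsubset> y \<longrightarrow> c \<sqsubset> e \<longrightarrow> h e \<noteq> r)"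
  obtains U where "openin (top_of_set S) U" "closedin (top_of_set S) U" "z \<in> U" "U \<subseteq> {x \<in> S. h x < r'}"
proof -
  have "uncountable ({h z<..<r'} - h ` extreme)"
    using countable_extreme z(2) uncountable_open_interval uncountable_minus_countable by blast
  then obtain r where r: "h z < r" "r < r'" "r \<notin> h ` extreme"
    by (metis (no_types, lifting) DiffE countable_empty ex_in_conv greaterThanLessThan_iff)
  obtain \<kappa> :: "nat \<Rightarrow> 'a set" where \<kappa>: "\<And>n. cut (\<kappa> n)"
    "\<And>a b. a \<in> S \<Longrightarrow> b \<in> S \<Longrightarrow> a \<sqsubset> b \<Longrightarrow> \<exists>n. a \<in> \<kappa> n \<and> b \<notin> \<kappa> n"
    using countable_cuts by blast
  \<comment> \<open>The cell of \<open>e\<close> in the partition of \<open>S\<close> by the first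
    \<open>n\<close> cuts: convex, clopen, and decreasing in \<open>n\<close>.\<close>
  define piece where "piece n e = {x \<in> S. \<forall>i<n. x \<in> \<kappa> i \<longleftrightarrow> e \<in> \<kappa> i}" for n :: nat and e
  have piece_open: "openin (top_of_set S) (piece n e)" for n e
  proof (induction n)
    case (Suc n)
    have "piece (Suc n) e = piece n e \<inter> (if e \<in> \<kappa> n then \<kappa> n else S - \<kappa> n)"
      using \<kappa>(1)[of n] by (auto simp: piece_def less_Suc_eq cut_def)
    then show ?case
      using Suc \<kappa>(1)[of n] by (auto simp: cut_def intro: openin_Int)
  qed (simp add: piece_def)
  have piece_eq: "piece n x = piece n e" if "x \<in> piece n e" for n x e
    using that unfolding piece_def by auto
  have piece_compl: "openin (top_of_set S) (S - piece n e)" for n e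
  proof -
    have "S - piece n e = (\<Union>x\<in>S - piece n e. piece n x)"
      using piece_eq unfolding piece_def by auto
    moreover have "openin (top_of_set S) (\<Union>x\<in>S - piece n e. piece n x)"
      using piece_open by (intro openin_Union) auto
    ultimately show ?thesis
      by simp
  qed
  have piece_convex: "w \<in> piece n e"
    if "x \<in> piece n e" "y \<in> piece n e" "w \<in> S" "x \<sqsubset> w" "w \<sqsubset> y" for x y w n e
    using that \<kappa>(1) unfolding piece_def cut_def by blast
  define H where "H = {e \<in> S. h e = r}"
  define W where "W = {x \<in> S. h x < r'}"
  have opW: "openin (top_of_set S) {x \<in> S. h x < t}" "openin (top_of_set S) {x \<in> S. t < h x}" for t
    using continuous_openin_preimage_gen[OF h, of "{..<t}"] continuous_openin_preimage_gen[OF h, of "{t<..}"]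
    by (simp_all add: vimage_def Int_def)
  have ex_piece: "\<exists>n. piece n e \<subseteq> W" if "e \<in> H" for e
  proof -
    have e: "e \<in> S" "e \<notin> extreme" "e \<in> W"
      using that r unfolding H_def W_def by auto
    obtain u v where uv: "u \<in> S" "v \<in> S" "u \<sqsubset> e" "e \<sqsubset> v" "\<And>x. x \<in> S \<Longrightarrow> u \<sqsubset> x \<Longrightarrow> x \<sqsubset> v \<Longrightarrow> x \<in> W"
      using order_nbhd[OF e(1,2) _ e(3)] opW(1)[of r'] unfolding W_def by metis
    \<comment> \<open>A cut between \<open>u\<close> and \<open>e\<close> and one between
      \<open>e\<close> and \<open>v\<close> confine the cell to the interval from \<open>u\<close>
      to \<open>v\<close>.\<close>
    obtain i j where ij: "u \<in> \<kappa> i" "e \<notin> \<kappa> i" "e \<in> \<kappa> j" "v \<notin> \<kappa> j"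
      using \<kappa>(2) uv e(1) by meson
    have "piece (Suc (max i j)) e \<subseteq> W"
    proof
      fix x assume "x \<in> piece (Suc (max i j)) e"
      then have x: "x \<in> S" "x \<notin> \<kappa> i" "x \<in> \<kappa> j"
        using ij by (auto simp: piece_def)
      have "u \<sqsubset> x"
      proof (rule ccontr)
        assume "\<not> u \<sqsubset> x"
        then have "x \<sqsubseteq> u"
          using not_less uv(1) x(1) by blast
        then show False
          using ij(1) x(1,2) \<kappa>(1)[of i] unfolding cut_def by blast
      qed
      moreover have "x \<sqsubset> v"
      proof (rule ccontr)
        assume "\<not> x \<sqsubset> v"
        then have "v \<sqsubseteq> x"
          using not_less uv(2) x(1) by blast
        then show False
          using ij(4) x(3) uv(2) \<kappa>(1)[of j] unfolding cut_def by blast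
      qed
      ultimately show "x \<in> W"
        using uv(5) x(1) by blast
    qed
    then show ?thesis
      by blast
  qed
  \<comment> \<open>The least \<open>n\<close> gives the largest cell inside \<open>W\<close>. Cells
    are nested or disjoint, so two of these largest cells that meet are equal.\<close>
  define J where "J e = piece (LEAST n. piece n e \<subseteq> W) e" for e
  have JW: "J e \<subseteq> W" if "e \<in> H" for e
    unfolding J_def using LeastI_ex[OF ex_piece[OF that]] .
  have eJ: "e \<in> J e" if "e \<in> H" for e
    using that by (auto simp: J_def piece_def H_def)
  have J_eq: "J e = J e'" if e: "e \<in> H" "e' \<in> H" "x \<in> J e" "x \<in> J e'" for e e' x
  proof -
    have le: "(LEAST n. piece n e' \<subseteq> W) \<le> (LEAST n. piece n e \<subseteq> W)"
      if H: "e \<in> H" "e' \<in> H" "x \<in> J e" "x \<in> J e'"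
        "(LEAST n. piece n e \<subseteq> W) \<le> (LEAST n. piece n e' \<subseteq> W)" for e e'
    proof (rule Least_le)
      define n where "n = (LEAST n. piece n e \<subseteq> W)"
      have "x \<in> piece n e" "x \<in> piece n e'"
        using H(3,4,5) unfolding J_def n_def by (auto simp: piece_def)
      then have "piece n e' = piece n e"
        using piece_eq by metis
      then show "piece n e' \<subseteq> W"
        using JW[OF H(1)] unfolding J_def n_def by simp
    qed
    have "(LEAST n. piece n e \<subseteq> W) = (LEAST n. piece n e' \<subseteq> W)"
      using le[OF e] le[OF e(2,1,4,3)] by linarith
    then show ?thesis
      using e(3,4) piece_eq unfolding J_def by metis
  qed
  define U where "U = {x \<in> S. h x < r} \<union> (\<Union>e\<in>H. J e)"
  have JU: "J e \<subseteq> U" if "e \<in> H" for e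
    using that by (auto simp: U_def)
  have J_open: "openin (top_of_set S) (J e)" "openin (top_of_set S) (S - J e)" for e
    unfolding J_def by (rule piece_open piece_compl)+
  \<comment> \<open>\<open>M\<close> is the only set \<open>J e\<close> that contains
    \<open>c\<close>, or \<open>{}\<close> if there is none.\<close>
  have slab: "\<exists>M. openin (top_of_set S) (S - M) \<and> y \<notin> M \<and> (\<forall>e\<in>H. c \<in> J e \<longrightarrow> J e = M)"
    if "y \<notin> U" for c y
  proof (cases "\<exists>e\<in>H. c \<in> J e")
    case True
    then obtain e where e: "e \<in> H" "c \<in> J e"
      by blast
    show ?thesis
    proof (intro exI conjI ballI impI)
      show "openin (top_of_set S) (S - J e)"
        by (rule J_open)
      show "y \<notin> J e"
        using that JU[OF e(1)] by blast
      show "J e' = J e" if "e' \<in> H" "c \<in> J e'" for e'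
        using J_eq[OF that(1) e(1) that(2) e(2)] .
    qed
  next
    case False
    then show ?thesis
      by (intro exI[of _ "{}"]) auto
  qed
  have "openin (top_of_set S) U"
    unfolding U_def using J_open opW by (intro openin_Un openin_Union) auto
  moreover have "openin (top_of_set S) (S - U)"
  proof (subst openin_subopen, intro ballI)
    fix y assume "y \<in> S - U"
    then have y: "y \<in> S" "y \<notin> U" "\<not> h y < r" "h y \<noteq> r"
      using JU eJ unfolding U_def H_def by blast+
    then have hy: "r < h y"
      by simp
    \<comment> \<open>The two sides of \<open>y\<close> are treated separately. On the right, no
      point of the level set lies between \<open>y\<close> and \<open>c\<close>. If
      \<open>J e\<close> contains a point between them, then \<open>e \<sqsubseteq> y\<close> or
      \<open>c \<sqsubseteq> e\<close>; by convexity \<open>y \<in> J e\<close>, which is false, or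
      \<open>c \<in> J e\<close>, so that \<open>J e\<close> is the removed set
      \<open>M\<close>.\<close>
    have R: "\<exists>V. openin (top_of_set S) V \<and> y \<in> V \<and> (\<forall>x\<in>V. y \<sqsubset> x \<longrightarrow> x \<notin> U)"
    proof (cases "\<forall>V. openin (top_of_set S) V \<longrightarrow> y \<in> V \<longrightarrow> (\<exists>x\<in>V. y \<sqsubset> x)")
      case False
      then show ?thesis
        by blast
    next
      case True
      then obtain c where c: "c \<in> S" "y \<sqsubset> c" "\<forall>e\<in>S. y \<sqsubset> e \<longrightarrow> e \<sqsubset> c \<longrightarrow> h e \<noteq> r"
        using right[OF y(1) hy] by blast
      obtain M where M: "openin (top_of_set S) (S - M)" "y \<notin> M" "\<forall>e\<in>H. c \<in> J e \<longrightarrow> J e = M"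
        using slab[OF y(2)] by blast
      define V where "V = {x \<in> S. x \<sqsubset> c} \<inter> {x \<in> S. r < h x} \<inter> (S - M)"
      have "x \<notin> U" if x: "x \<in> V" "y \<sqsubset> x" for x
      proof
        assume "x \<in> U"
        then obtain e where e: "e \<in> H" "x \<in> J e"
          using x(1) unfolding U_def V_def by auto
        have eS: "e \<in> S" "h e = r" and xS: "x \<in> S" "x \<sqsubset> c"
          using e(1) x(1) unfolding H_def V_def by auto
        have "\<not> e \<sqsubset> c"
        proof
          assume "e \<sqsubset> c"
          then have "\<not> y \<sqsubset> e"
            using c(3) eS by blast
          then have "e \<sqsubseteq> y"
            using not_less y(1) eS(1) by blast
          moreover have "e \<noteq> y"
            using eS(2) y(4) by blast
          ultimately have "y \<in> J e"
            using piece_convex[of e _ e x y] eJ[OF e(1)] e(2) y(1) x(2) unfolding J_def by blast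
          then show False
            using y(2) JU[OF e(1)] by blast
        qed
        then have "c \<sqsubseteq> e"
          using not_less eS(1) c(1) by blast
        then have "c \<in> J e"
          using piece_convex[of x _ e e c] eJ[OF e(1)] e(2) c(1) xS(2) unfolding J_def by blast
        then show False
          using M(3) e x(1) unfolding V_def by blast
      qed
      moreover have "openin (top_of_set S) V"
        unfolding V_def by (intro openin_Int below_open c opW M)
      moreover have "y \<in> V"
        unfolding V_def using y c(2) hy M(2) by blast
      ultimately show ?thesis
        by blast
    qed
    have L: "\<exists>V. openin (top_of_set S) V \<and> y \<in> V \<and> (\<forall>x\<in>V. x \<sqsubset> y \<longrightarrow> x \<notin> U)"
    proof (cases "\<forall>V. openin (top_of_set S) V \<longrightarrow> y \<in> V \<longrightarrow> (\<exists>x\<in>V. x \<sqsubset> y)")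
      case False
      then show ?thesis
        by blast
    next
      case True
      then obtain c where c: "c \<in> S" "c \<sqsubset> y" "\<forall>e\<in>S. e \<sqsubset> y \<longrightarrow> c \<sqsubset> e \<longrightarrow> h e \<noteq> r"
        using left[OF y(1) hy] by blast
      obtain M where M: "openin (top_of_set S) (S - M)" "y \<notin> M" "\<forall>e\<in>H. c \<in> J e \<longrightarrow> J e = M"
        using slab[OF y(2)] by blast
      define V where "V = {x \<in> S. c \<sqsubset> x} \<inter> {x \<in> S. r < h x} \<inter> (S - M)"
      have "x \<notin> U" if x: "x \<in> V" "x \<sqsubset> y" for x
      proof
        assume "x \<in> U"
        then obtain e where e: "e \<in> H" "x \<in> J e"
          using x(1) unfolding U_def V_def by auto
        have eS: "e \<in> S" "h e = r" and xS: "x \<in> S" "c \<sqsubset> x"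
          using e(1) x(1) unfolding H_def V_def by auto
        have "\<not> c \<sqsubset> e"
        proof
          assume "c \<sqsubset> e"
          then have "\<not> e \<sqsubset> y"
            using c(3) eS by blast
          then have "y \<sqsubseteq> e"
            using not_less y(1) eS(1) by blast
          moreover have "e \<noteq> y"
            using eS(2) y(4) by blast
          ultimately have "y \<in> J e"
            using piece_convex[of x _ e e y] eJ[OF e(1)] e(2) y(1) x(2) unfolding J_def by blast
          then show False
            using y(2) JU[OF e(1)] by blast
        qed
        then have "e \<sqsubseteq> c"
          using not_less eS(1) c(1) by blast
        then have "c \<in> J e"
          using piece_convex[of e _ e x c] eJ[OF e(1)] e(2) c(1) xS(2) unfolding J_def by blast
        then show False
          using M(3) e x(1) unfolding V_def by blast
      qed
      moreover have "openin (top_of_set S) V"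
        unfolding V_def by (intro openin_Int above_open c opW M)
      moreover have "y \<in> V"
        unfolding V_def using y c(2) hy M(2) by blast
      ultimately show ?thesis
        by blast
    qed
    obtain V1 V2 where V: "openin (top_of_set S) V1" "y \<in> V1" "\<forall>x\<in>V1. y \<sqsubset> x \<longrightarrow> x \<notin> U"
        "openin (top_of_set S) V2" "y \<in> V2" "\<forall>x\<in>V2. x \<sqsubset> y \<longrightarrow> x \<notin> U"
      using R L by blast
    have "V1 \<inter> V2 \<subseteq> S - U"
    proof
      fix x assume x: "x \<in> V1 \<inter> V2"
      then have "x \<in> S"
        using V(1) openin_imp_subset by blast
      then show "x \<in> S - U"
        using V(3,6) x total[OF _ y(1), of x] y(2) by blast
    qed
    then show "\<exists>T. openin (top_of_set S) T \<and> y \<in> T \<and> T \<subseteq> S - U"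
      using V by (intro exI[of _ "V1 \<inter> V2"]) (auto intro: openin_Int)
  qed
  moreover have "U \<subseteq> S"
    unfolding U_def J_def piece_def by blast
  ultimately show thesis
    using that[of U] z r JW unfolding U_def W_def closedin_def by force
qed

end

section \<open>Arcs to the root of a smooth dendroid\<close>

lemma infdist_le_hausdorff_dist:
  fixes A B :: "'a::metric_space set"
  assumes "compact A" "compact B"
  shows "a \<in> A \<Longrightarrow> infdist a B \<le> hausdorff_dist A B" "b \<in> B \<Longrightarrow> infdist b A \<le> hausdorff_dist A B"
proof -
  have bdd: "bdd_above ((\<lambda>x. infdist x L) ` K)" if "compact K" for K L :: "'a set"
    using that by (intro bounded_imp_bdd_above compact_imp_bounded compact_continuous_image continuous_intros)
  show "a \<in> A \<Longrightarrow> infdist a B \<le> hausdorff_dist A B" "b \<in> B \<Longrightarrow> infdist b A \<le> hausdorff_dist A B"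
    using cSUP_upper[OF _ bdd[OF assms(1)], of a B] cSUP_upper[OF _ bdd[OF assms(2)], of b A]
    by (auto simp: hausdorff_dist_def intro: max.coboundedI1 max.coboundedI2)
qed

lemma infdist_hausdorff_dist:
  fixes A B :: "'a::heine_borel set"
  assumes "compact A" "compact B" "B \<noteq> {}"
  shows "infdist t A \<le> infdist t B + hausdorff_dist A B"
proof -
  obtain b where b: "b \<in> B" "infdist t B = dist t b"
    using infdist_attains_inf[of B t] assms compact_imp_closed by blast
  have "infdist t A \<le> infdist b A + dist t b"
    by (rule infdist_triangle)
  then show ?thesis
    using infdist_le_hausdorff_dist(2)[OF assms(1,2) b(1)] b(2) by linarith
qed

locale rooted_smooth_dendroid =
  fixes X :: "'a::euclidean_space set" and p :: 'a
  assumes dendroid: "dendroid X" and root: "p \<in> X"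
    and smooth: "\<And>s x. (\<And>n::nat. s n \<in> X) \<Longrightarrow> x \<in> X \<Longrightarrow> s \<longlonglongrightarrow> x \<Longrightarrow>
      (\<lambda>n. hausdorff_dist (alpha X (s n) p) (alpha X x p)) \<longlonglongrightarrow> 0"
begin

abbreviation seg :: "'a \<Rightarrow> 'a set"
  where "seg x \<equiv> alpha X x p"

lemma compact_X: "compact X"
  using dendroid unfolding dendroid_def continuum_def by blast

lemma arc_between_sym: "arc_between A x y \<Longrightarrow> arc_between A y x"
  unfolding arc_between_def by (metis arc_reversepath path_image_reversepath pathfinish_reversepath pathstart_reversepath)

lemma seg_root: "seg p = {p}"
  by (simp add: alpha_def)

lemma seg_eq: "x \<noteq> p \<Longrightarrow> A \<subseteq> X \<Longrightarrow> arc_between A p x \<Longrightarrow> seg x = A"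
  using dendroid_alpha_eq[OF dendroid] arc_between_sym by blast

lemma seg_arc:
  assumes "x \<in> X" "x \<noteq> p"
  shows "seg x \<subseteq> X" "arc_between (seg x) p x"
proof -
  obtain A where "A \<subseteq> X" "arc_between A p x"
    using dendroid assms(1) assms(2)[symmetric] root unfolding dendroid_def arcwise_connected_def by blast
  then show "seg x \<subseteq> X" "arc_between (seg x) p x"
    using seg_eq[OF assms(2)] by simp_all
qed

text \<open>For \<open>x = p\<close> the path is constant, hence the condition on
  injectivity.\<close>

lemma seg_param:
  assumes "x \<in> X"
  obtains g where "continuous_on {0..1::real} g" "g ` {0..1} = seg x" "g 0 = p" "g 1 = x"
    "\<And>u. u \<in> {0..1} \<Longrightarrow> seg (g u) = g ` {0..u}" "x \<noteq> p \<Longrightarrow> inj_on g {0..1}"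
proof (cases "x = p")
  case True
  show ?thesis
    by (rule that[of "\<lambda>_. p"]) (auto simp: True seg_root image_constant_conv)
next
  case False
  obtain g where g: "arc g" "path_image g = seg x" "g 0 = p" "g 1 = x"
    using seg_arc(2)[OF assms False] unfolding arc_between_def pathstart_def pathfinish_def by blast
  have inj: "inj_on g {0..1}"
    using g(1) by (simp add: arc_def)
  have "seg (g u) = g ` {0..u}" if u: "u \<in> {0..1}" for u
  proof (cases "u = 0")
    case True
    then show ?thesis
      by (simp add: g seg_root)
  next
    case u0: False
    have "g u \<noteq> p"
      using inj u u0 g(3) unfolding inj_on_def by (metis atLeastAtMost_iff order_refl zero_le_one)
    moreover have "g ` {0..u} \<subseteq> X"
      using seg_arc(1)[OF assms False] u unfolding g(2)[symmetric] path_image_def by auto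
    ultimately show ?thesis
      using seg_eq arc_between_initial[OF g(1), of u] u u0 g(3) by simp
  qed
  then show ?thesis
    using that[of g] g inj by (auto simp: arc_def path_def path_image_def)
qed

lemma seg_subset: "x \<in> X \<Longrightarrow> seg x \<subseteq> X"
  using seg_arc(1) seg_root root by (cases "x = p") auto

lemma compact_seg: "x \<in> X \<Longrightarrow> compact (seg x)"
  and connected_seg: "x \<in> X \<Longrightarrow> connected (seg x)"
  and root_seg: "x \<in> X \<Longrightarrow> p \<in> seg x"
  and self_seg: "x \<in> X \<Longrightarrow> x \<in> seg x"
proof -
  assume "x \<in> X"
  then obtain g where g: "continuous_on {0..1::real} g" "g ` {0..1} = seg x" "g 0 = p" "g 1 = x"
    using seg_param by blast
  show "compact (seg x)" "connected (seg x)"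
    using compact_continuous_image[OF g(1)] connected_continuous_image[OF g(1)] g(2) by auto
  have "g 0 \<in> g ` {0..1}" "g 1 \<in> g ` {0..1}"
    by auto
  then show "p \<in> seg x" "x \<in> seg x"
    using g by auto
qed

text \<open>Together with \<open>self_seg\<close>, \<open>seg_antisym\<close> and
  \<open>root_seg\<close>: the relation \<open>y \<in> seg x\<close> is a partial order of
  \<open>X\<close> with least element \<open>p\<close>.\<close>

lemma seg_mono:
  assumes "x \<in> X" "y \<in> seg x"
  shows "seg y \<subseteq> seg x"
proof -
  obtain g where g: "g ` {0..1::real} = seg x" "\<And>u. u \<in> {0..1} \<Longrightarrow> seg (g u) = g ` {0..u}"
    using seg_param[OF assms(1)] by metis
  obtain u where u: "u \<in> {0..1}" "y = g u"
    using assms(2) g(1) by blast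
  have "g ` {0..u} \<subseteq> g ` {0..1}"
    using u by (intro image_mono) auto
  then show ?thesis
    using g(1) g(2)[OF u(1)] u(2) by simp
qed

lemma seg_antisym:
  assumes "x \<in> X" "y \<in> X" "x \<in> seg y" "y \<in> seg x"
  shows "x = y"
proof (cases "y = p")
  case True
  then show ?thesis
    using assms(3) by (simp add: seg_root)
next
  case False
  obtain g where g: "g ` {0..1::real} = seg y" "\<And>u. u \<in> {0..1} \<Longrightarrow> seg (g u) = g ` {0..u}"
      "inj_on g {0..1}" "g 1 = y"
    using seg_param[OF assms(2)] False by metis
  obtain u where u: "u \<in> {0..1}" "x = g u"
    using assms(3) g(1) by blast
  then obtain v where v: "v \<in> {0..u}" "y = g v"
    using assms(4) g(2) by auto
  then have "v = 1"
    using g(3,4) u unfolding inj_on_def by auto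
  then show ?thesis
    using u v g(4) by auto
qed

text \<open>A subarc described by the order alone; this description passes to limits by
  \<open>limit_in_seg\<close>.\<close>

lemma seg_between_param:
  assumes x: "x \<in> X" and g: "g ` {0..1::real} = seg x" "\<And>u. u \<in> {0..1} \<Longrightarrow> seg (g u) = g ` {0..u}"
      "x \<noteq> p \<Longrightarrow> inj_on g {0..1}" and uv: "0 \<le> u" "u \<le> v" "v \<le> 1"
  shows "{z \<in> seg (g v). g u \<in> seg z} = g ` {u..v}"
proof (cases "x = p")
  case True
  then have "g w = p" if "w \<in> {0..1}" for w
    using g(1) that by (auto simp: seg_root)
  then show ?thesis
    using uv by (auto simp: seg_root image_iff)
next
  case False
  show ?thesis
  proof
    show "{z \<in> seg (g v). g u \<in> seg z} \<subseteq> g ` {u..v}"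
    proof
      fix z assume z: "z \<in> {z \<in> seg (g v). g u \<in> seg z}"
      then obtain w where w: "w \<in> {0..v}" "z = g w"
        using g(2)[of v] uv by auto
      then obtain w' where w': "w' \<in> {0..w}" "g u = g w'"
        using z g(2)[of w] uv by auto
      then have "u = w'"
        using g(3)[OF False] w uv unfolding inj_on_def by auto
      then show "z \<in> g ` {u..v}"
        using w w' by auto
    qed
    show "g ` {u..v} \<subseteq> {z \<in> seg (g v). g u \<in> seg z}"
      using g(2) uv by auto
  qed
qed

lemma between_continuum:
  assumes "y \<in> X" "x \<in> seg y"
  shows "compact {z \<in> seg y. x \<in> seg z}" "connected {z \<in> seg y. x \<in> seg z}"
proof -
  obtain g where g: "continuous_on {0..1::real} g" "g ` {0..1} = seg y" "g 1 = y"
    "\<And>u. u \<in> {0..1} \<Longrightarrow> seg (g u) = g ` {0..u}" "y \<noteq> p \<Longrightarrow> inj_on g {0..1}"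
    using seg_param[OF assms(1)] by metis
  obtain u where u: "u \<in> {0..1}" "x = g u"
    using assms(2) g(2) by blast
  have eq: "{z \<in> seg y. x \<in> seg z} = g ` {u..1}"
    using seg_between_param[OF assms(1) g(2,4,5), of u 1] u g(3) by auto
  have "continuous_on {u..1} g"
    using u by (intro continuous_on_subset[OF g(1)]) auto
  then show "compact {z \<in> seg y. x \<in> seg z}" "connected {z \<in> seg y. x \<in> seg z}"
    unfolding eq by (auto intro: compact_continuous_image connected_continuous_image)
qed

text \<open>One half of Hausdorff convergence: the order is a closed relation.\<close>

lemma limit_in_seg:
  assumes "\<And>k::nat. s k \<in> X" "x \<in> X" "s \<longlonglongrightarrow> x" "\<And>k. y k \<in> seg (s k)" "y \<longlonglongrightarrow> z"
  shows "z \<in> seg x"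
proof -
  have "(\<lambda>k. infdist (y k) (seg x)) \<longlonglongrightarrow> 0"
  proof (rule tendsto_sandwich[OF _ _ tendsto_const smooth[OF assms(1-3)]])
    show "\<forall>\<^sub>F k in sequentially. infdist (y k) (seg x) \<le> hausdorff_dist (seg (s k)) (seg x)"
      using infdist_le_hausdorff_dist(1)[OF compact_seg compact_seg] assms by simp
  qed (simp add: infdist_nonneg)
  moreover have "(\<lambda>k. infdist (y k) (seg x)) \<longlonglongrightarrow> infdist z (seg x)"
    using assms(5) by (rule tendsto_infdist)
  ultimately have "infdist z (seg x) = 0"
    using LIMSEQ_unique by blast
  then show ?thesis
    using in_closed_iff_infdist_zero[of "seg x" z] compact_seg[OF assms(2)] root_seg[OF assms(2)]
      compact_imp_closed by blast
qed

text \<open>The other half: nearest points of \<open>seg (s k)\<close> converge to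
  \<open>z\<close>.\<close>

lemma approx_in_seg:
  assumes "\<And>k::nat. s k \<in> X" "x \<in> X" "s \<longlonglongrightarrow> x" "z \<in> seg x"
  obtains y where "\<And>k. y k \<in> seg (s k)" "y \<longlonglongrightarrow> z"
proof -
  have "\<exists>y. y \<in> seg (s k) \<and> infdist z (seg (s k)) = dist z y" for k
  proof -
    have "closed (seg (s k))" "seg (s k) \<noteq> {}"
      using compact_imp_closed[OF compact_seg[OF assms(1)]] root_seg[OF assms(1)[of k]] by blast+
    from infdist_attains_inf[OF this] show ?thesis
      by metis
  qed
  then obtain y where y: "\<And>k. y k \<in> seg (s k)" "\<And>k. infdist z (seg (s k)) = dist z (y k)"
    by metis
  have "(\<lambda>k. dist (y k) z) \<longlonglongrightarrow> 0"
  proof (rule tendsto_sandwich[OF _ _ tendsto_const smooth[OF assms(1-3)]])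
    show "\<forall>\<^sub>F k in sequentially. dist (y k) z \<le> hausdorff_dist (seg (s k)) (seg x)"
      using infdist_le_hausdorff_dist(2)[OF compact_seg[OF assms(1)] compact_seg[OF assms(2)] assms(4)]
      by (simp add: y(2) dist_commute)
  qed simp
  then show thesis
    using that y(1) tendsto_dist_iff by blast
qed

text \<open>\<open>infdist t\<close> is 1-Lipschitz in the set with respect to the Hausdorff
  distance.\<close>

lemma continuous_on_infdist_seg: "continuous_on X (\<lambda>x. infdist t (seg x))"
proof (rule continuous_on_sequentiallyI)
  fix s x assume s: "\<forall>n. s n \<in> X" "x \<in> X" "s \<longlonglongrightarrow> x"
  have "(\<lambda>n. infdist t (seg (s n)) - infdist t (seg x)) \<longlonglongrightarrow> 0"
  proof (rule tendsto_rabs_zero_cancel, rule tendsto_sandwich[OF _ _ tendsto_const smooth])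
    have "\<bar>infdist t (seg (s n)) - infdist t (seg x)\<bar> \<le> hausdorff_dist (seg (s n)) (seg x)" for n
    proof -
      have c: "compact (seg (s n))" "compact (seg x)" "seg (s n) \<noteq> {}" "seg x \<noteq> {}"
        using s compact_seg root_seg by blast+
      have "hausdorff_dist (seg (s n)) (seg x) = hausdorff_dist (seg x) (seg (s n))"
        by (simp add: hausdorff_dist_def max.commute)
      then show ?thesis
        using infdist_hausdorff_dist[OF c(1,2,4), of t] infdist_hausdorff_dist[OF c(2,1,3), of t] by linarith
    qed
    then show "\<forall>\<^sub>F n in sequentially. \<bar>infdist t (seg (s n)) - infdist t (seg x)\<bar>
        \<le> hausdorff_dist (seg (s n)) (seg x)"
      by simp
  qed (use s in auto)
  then show "(\<lambda>n. infdist t (seg (s n))) \<longlonglongrightarrow> infdist t (seg x)"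
    by (rule LIM_zero_cancel)
qed

lemma convergent_subsequence:
  assumes "\<And>n::nat. s n \<in> X"
  obtains x r where "x \<in> X" "strict_mono r" "(s \<circ> r) \<longlonglongrightarrow> x"
  using compact_X assms unfolding compact_def by metis

section \<open>Small neighbourhoods of endpoints\<close>

lemma endpoint_maximal:
  assumes "e \<in> endpoints X" "e \<noteq> p" "y \<in> X" "e \<in> seg y"
  shows "y = e"
proof (cases "y = p")
  case True
  then show ?thesis
    using assms by (simp add: seg_root)
next
  case False
  have "\<And>A x y. A \<subseteq> X \<Longrightarrow> arc_between A x y \<Longrightarrow> e \<in> A \<Longrightarrow> e = x \<or> e = y"
    using assms(1) unfolding endpoints_def by blast
  then show ?thesis
    using seg_arc[OF assms(3) False] assms(2,4) by blast
qed

definition up :: "'a \<Rightarrow> 'a set"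
  where "up t = {x \<in> X. t \<in> seg x}"

text \<open>Otherwise points outside \<open>V\<close> lie above points of \<open>seg e\<close> that
  tend to \<open>e\<close>. As the order is closed, a limit of theirs lies above \<open>e\<close>,
  hence is \<open>e\<close> by maximality, although it is not in \<open>V\<close>.\<close>

lemma small_up:
  assumes e: "e \<in> endpoints X" "e \<noteq> p" and V: "open V" "e \<in> V"
  obtains t where "t \<in> seg e" "t \<noteq> e" "up t \<subseteq> V"
proof (rule ccontr)
  assume no: "\<not> thesis"
  have eX: "e \<in> X"
    using e by (simp add: endpoints_def)
  obtain g where g: "continuous_on {0..1::real} g" "g ` {0..1} = seg e" "g 1 = e" "inj_on g {0..1}"
    using seg_param[OF eX] e(2) by metis
  define u where "u n = 1 - inverse (real (Suc (Suc n)))" for n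
  have u: "u n \<in> {0..1}" "u n \<noteq> 1" for n
    by (auto simp: u_def divide_simps)
  have "u \<longlonglongrightarrow> 1 - 0"
    unfolding u_def by (rule tendsto_diff[OF tendsto_const LIMSEQ_Suc[OF LIMSEQ_inverse_real_of_nat]])
  then have gu: "(\<lambda>n. g (u n)) \<longlonglongrightarrow> e"
    using continuous_on_tendsto_compose[OF g(1), of u 1 sequentially] u(1) g(3) by simp
  have "\<exists>y. y \<in> up (g (u n)) \<and> y \<notin> V" for n
  proof -
    have "g (u n) \<in> seg e"
      using u(1) g(2) by blast
    moreover have "g (u n) \<noteq> e"
      using u g(3,4) unfolding inj_on_def by (metis atLeastAtMost_iff order_refl zero_le_one)
    ultimately show ?thesis
      using no that by blast
  qed
  then obtain y where y: "\<And>n. y n \<in> X" "\<And>n. g (u n) \<in> seg (y n)" "\<And>n. y n \<notin> V"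
    unfolding up_def by (metis (no_types, lifting) mem_Collect_eq)
  obtain x r where x: "x \<in> X" "strict_mono r" "(y \<circ> r) \<longlonglongrightarrow> x"
    using convergent_subsequence[of y] y(1) by blast
  have "e \<in> seg x"
    by (rule limit_in_seg[of "y \<circ> r" x "\<lambda>k. g (u (r k))"])
      (use x y LIMSEQ_subseq_LIMSEQ[OF gu x(2)] in \<open>auto simp: o_def\<close>)
  then have "x \<in> V"
    using endpoint_maximal[OF e x(1)] V(2) by simp
  then have "\<forall>\<^sub>F n in sequentially. (y \<circ> r) n \<in> V"
    using x(3) V(1) topological_tendstoD by blast
  then show False
    using y(3) by (auto simp: eventually_sequentially)
qed

text \<open>By compactness, points violating this for smaller and smaller \<open>d\<close>
  accumulate at a point whose arc contains \<open>t\<close>, that is, at a point of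
  \<open>up t\<close>.\<close>

lemma small_infdist:
  assumes "open V" "up t \<subseteq> V"
  obtains d where "d > 0" "\<And>x. x \<in> X \<Longrightarrow> infdist t (seg x) < d \<Longrightarrow> x \<in> V"
proof (rule ccontr)
  assume no: "\<not> thesis"
  have "\<exists>x. x \<in> X \<and> infdist t (seg x) < inverse (real (Suc n)) \<and> x \<notin> V" for n
    using no that[of "inverse (real (Suc n))"] by auto
  then obtain y where y: "\<And>n. y n \<in> X" "\<And>n. infdist t (seg (y n)) < inverse (real (Suc n))" "\<And>n. y n \<notin> V"
    by metis
  obtain x r where x: "x \<in> X" "strict_mono r" "(y \<circ> r) \<longlonglongrightarrow> x"
    using convergent_subsequence[of y] y(1) by blast
  have "(\<lambda>n. infdist t (seg (y n))) \<longlonglongrightarrow> 0"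
    by (rule tendsto_sandwich[OF _ _ tendsto_const LIMSEQ_inverse_real_of_nat])
      (use y(2) in \<open>auto simp: infdist_nonneg less_imp_le\<close>)
  then have "(\<lambda>n. infdist t (seg (y (r n)))) \<longlonglongrightarrow> 0"
    using LIMSEQ_subseq_LIMSEQ[OF _ x(2)] by (auto simp: o_def)
  moreover have "(\<lambda>n. infdist t (seg (y (r n)))) \<longlonglongrightarrow> infdist t (seg x)"
    using continuous_on_tendsto_compose[OF continuous_on_infdist_seg, of "y \<circ> r" x sequentially t] x y(1)
    by (simp add: o_def)
  ultimately have "infdist t (seg x) = 0"
    using LIMSEQ_unique by blast
  then have "t \<in> seg x"
    using in_closed_iff_infdist_zero[of "seg x" t] compact_seg[OF x(1)] root_seg[OF x(1)]
      compact_imp_closed by blast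
  then have "x \<in> V"
    using assms(2) x(1) unfolding up_def by blast
  then have "\<forall>\<^sub>F n in sequentially. (y \<circ> r) n \<in> V"
    using x(3) assms(1) topological_tendstoD by blast
  then show False
    using y(3) by (auto simp: eventually_sequentially)
qed


text \<open>A maximal disjoint family of subarcs of arcs from \<open>p\<close> is countable, since
  \<open>X\<close> is Suslinian. A subarc strictly between \<open>t\<close> and \<open>e\<close>
  meets a member \<open>K\<close> in some \<open>s\<close>; the arc from \<open>t\<close> to
  \<open>s\<close> then lies on the arc from \<open>p\<close> to the top of \<open>K\<close>, where
  it contains a point of rational parameter.\<close>

lemma countable_order_dense:
  assumes "Suslinian X"
  obtains D where "countable D" "D \<subseteq> X"
    "\<And>e t. e \<in> X \<Longrightarrow> t \<in> seg e \<Longrightarrow> t \<noteq> e \<Longrightarrow> \<exists>d\<in>D. d \<in> seg e \<and> d \<noteq> e \<and> t \<in> seg d"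
proof -
  define \<A> where "\<A> = {{z \<in> seg y. x \<in> seg z} | x y. y \<in> X \<and> x \<in> seg y \<and> x \<noteq> y}"
  have "\<exists>\<M>\<in>{\<M>. \<M> \<subseteq> \<A> \<and> pairwise disjnt \<M>}. \<forall>\<M>'\<in>{\<M>. \<M> \<subseteq> \<A> \<and> pairwise disjnt \<M>}.
      \<M> \<subseteq> \<M>' \<longrightarrow> \<M>' = \<M>"
  proof (rule subset_Zorn_nonempty)
    show "{\<M>. \<M> \<subseteq> \<A> \<and> pairwise disjnt \<M>} \<noteq> {}"
      by (auto intro!: exI[of _ "{}"])
    fix \<C> assume C: "subset.chain {\<M>. \<M> \<subseteq> \<A> \<and> pairwise disjnt \<M>} \<C>"
    have "pairwise disjnt (\<Union>\<C>)"
    proof (rule pairwiseI)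
      fix K L assume KL: "K \<in> \<Union>\<C>" "L \<in> \<Union>\<C>" "K \<noteq> L"
      then obtain M N where MN: "K \<in> M" "M \<in> \<C>" "L \<in> N" "N \<in> \<C>"
        by blast
      then have "M \<subseteq> N \<or> N \<subseteq> M" "pairwise disjnt M" "pairwise disjnt N"
        using C unfolding subset.chain_def by blast+
      then obtain P where "K \<in> P" "L \<in> P" "pairwise disjnt P"
        using MN(1,3) by (metis subsetD)
      then show "disjnt K L"
        using KL(3) pairwiseD by metis
    qed
    then show "\<Union>\<C> \<in> {\<M>. \<M> \<subseteq> \<A> \<and> pairwise disjnt \<M>}"
      using C unfolding subset.chain_def by blast
  qed
  then obtain \<M> where M: "\<M> \<subseteq> \<A>" "pairwise disjnt \<M>"
    and max: "\<And>\<M>'. \<M>' \<subseteq> \<A> \<Longrightarrow> pairwise disjnt \<M>' \<Longrightarrow> \<M> \<subseteq> \<M>' \<Longrightarrow> \<M>' = \<M>"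
    by auto
  have A: "continuum K \<and> K \<subseteq> X \<and> nondegenerate K" if "K \<in> \<A>" for K
  proof -
    obtain x y where xy: "K = {z \<in> seg y. x \<in> seg z}" "y \<in> X" "x \<in> seg y" "x \<noteq> y"
      using \<open>K \<in> \<A>\<close> unfolding \<A>_def by blast
    have "x \<in> X"
      using seg_subset xy by blast
    then have "x \<in> K" "y \<in> K"
      using xy self_seg by auto
    then show ?thesis
      using between_continuum[OF xy(2,3)] seg_subset[OF xy(2)] xy
      unfolding continuum_def nondegenerate_def by blast
  qed
  have cM: "countable \<M>"
    using assms A M unfolding Suslinian_def by (metis subsetD)
  define Par where "Par K y g \<longleftrightarrow> y \<in> X \<and> (\<exists>x. K = {z \<in> seg y. x \<in> seg z}) \<and> g ` {0..1::real} = seg y \<and>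
      (\<forall>u\<in>{0..1}. seg (g u) = g ` {0..u}) \<and> inj_on g {0..1}" for K y g
  have "\<exists>y g. Par K y g" if K: "K \<in> \<M>" for K
  proof -
    obtain x y where xy: "K = {z \<in> seg y. x \<in> seg z}" "y \<in> X" "x \<in> seg y" "x \<noteq> y"
      using K M(1) unfolding \<A>_def by blast
    then have "y \<noteq> p"
      using seg_root by auto
    obtain g where g: "g ` {0..1::real} = seg y" "\<And>u. u \<in> {0..1} \<Longrightarrow> seg (g u) = g ` {0..u}" "inj_on g {0..1}"
      using seg_param[OF xy(2)] \<open>y \<noteq> p\<close> by metis
    show ?thesis
      using g xy(1,2) unfolding Par_def by (intro exI[of _ y] exI[of _ g] conjI exI[of _ x]) simp_all
  qed
  then obtain y g where "\<And>K. K \<in> \<M> \<Longrightarrow> Par K (y K) (g K)"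
    by metis
  then have yg: "\<And>K. K \<in> \<M> \<Longrightarrow> y K \<in> X" "\<And>K. K \<in> \<M> \<Longrightarrow> \<exists>x. K = {z \<in> seg (y K). x \<in> seg z}"
    "\<And>K. K \<in> \<M> \<Longrightarrow> g K ` {0..1::real} = seg (y K)"
    "\<And>K u. K \<in> \<M> \<Longrightarrow> u \<in> {0..1} \<Longrightarrow> seg (g K u) = g K ` {0..u}"
    "\<And>K. K \<in> \<M> \<Longrightarrow> inj_on (g K) {0..1}"
    unfolding Par_def by blast+
  \<comment> \<open>Rational parameters on the whole arc from \<open>p\<close> to the top
    \<open>y K\<close>, as \<open>t\<close> and the point sought may lie below
    \<open>K\<close>.\<close>
  define D where "D = (\<Union>K\<in>\<M>. g K ` ({0..1} \<inter> \<rat>))"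
  show thesis
  proof (rule that[of D])
    show "countable D"
      unfolding D_def using cM countable_rat
      by (intro countable_UN countable_image countable_Int2) auto
    show "D \<subseteq> X"
      unfolding D_def using yg(1,3) seg_subset by blast
    fix e t assume et: "e \<in> X" "t \<in> seg e" "t \<noteq> e"
    then have "e \<noteq> p"
      using seg_root by auto
    then obtain h where h: "h ` {0..1::real} = seg e" "h 1 = e"
        "\<And>u. u \<in> {0..1} \<Longrightarrow> seg (h u) = h ` {0..u}" "inj_on h {0..1}"
      using seg_param[OF et(1)] by metis
    obtain u where u: "u \<in> {0..1}" "t = h u"
      using et(2) h(1) by blast
    then have "u < 1"
      using et(3) h(2) by (cases "u = 1") auto
    then obtain u1 u2 where u12: "u < u1" "u1 < u2" "u2 < 1"
      by (meson dense)
    define I where "I = {z \<in> seg (h u2). h u1 \<in> seg z}"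
    have hX: "h v \<in> X" if "v \<in> {0..1}" for v
      using h(1) that seg_subset[OF et(1)] by blast
    have "h u1 \<in> seg (h u2)" "h u1 \<noteq> h u2"
      using h(3)[of u2] h(4) u12 u(1) unfolding inj_on_def by force+
    then have IA: "I \<in> \<A>"
      unfolding \<A>_def I_def using hX[of u2] u u12 by auto
    have Ieq: "I = h ` {u1..u2}"
      unfolding I_def using u u12 h by (intro seg_between_param[OF et(1)]) auto
    have "\<exists>K\<in>\<M>. K \<inter> I \<noteq> {}"
    proof (rule ccontr)
      assume "\<not> ?thesis"
      then have "pairwise disjnt (insert I \<M>)"
        using M(2) by (auto simp: pairwise_insert disjnt_def)
      then have "insert I \<M> = \<M>"
        using M(1) IA by (intro max) auto
      then show False
        using \<open>\<not> (\<exists>K\<in>\<M>. K \<inter> I \<noteq> {})\<close> A[OF IA] unfolding nondegenerate_def by blast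
    qed
    then obtain K s where K: "K \<in> \<M>" "s \<in> K" "s \<in> I"
      by blast
    obtain v where v: "v \<in> {u1..u2}" "s = h v"
      using K(3) Ieq by blast
    have v01: "v \<in> {0..1}" "u < v" "v < 1"
      using v(1) u12 u(1) by auto
    have s: "s \<in> seg (y K)" "s \<in> X" "t \<in> seg s" "t \<noteq> s" "s \<in> seg e" "s \<noteq> e"
    proof -
      show "s \<in> seg (y K)"
        using K(1,2) yg(2) by blast
      show "s \<in> X" "s \<in> seg e"
        using v01 v(2) hX h(1) by auto
      show "t \<in> seg s"
        using h(3)[OF v01(1)] u v v01 by auto
      show "t \<noteq> s"
        using h(4) u v(2) v01 unfolding inj_on_def by fastforce
      show "s \<noteq> e"
        using h(2,4) v(2) v01 unfolding inj_on_def by fastforce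
    qed
    obtain b where b: "b \<in> {0..1}" "s = g K b"
      using s(1) yg(3)[OF K(1)] by blast
    obtain a where a: "a \<in> {0..b}" "t = g K a"
      using s(3) yg(4)[OF K(1) b(1)] b(2) by auto
    have "a < b"
      using a b s(4) by (cases "a = b") auto
    then obtain q where q: "q \<in> \<rat>" "a < q" "q < b"
      using Rats_dense_in_real by blast
    then have q01: "q \<in> {0..1}"
      using a b by auto
    have "g K q \<in> D"
      unfolding D_def using K(1) q(1) q01 by blast
    moreover have d: "g K q \<in> seg s" "t \<in> seg (g K q)"
      using q a b yg(4)[OF K(1) q01] yg(4)[OF K(1) b(1)] by auto
    moreover have "g K q \<in> seg e"
      using d(1) seg_mono[OF et(1) s(5)] by blast
    moreover have "g K q \<noteq> e"
      using d(1) seg_antisym[OF s(2) et(1) s(5)] s(6) by blast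
    ultimately show "\<exists>d\<in>D. d \<in> seg e \<and> d \<noteq> e \<and> t \<in> seg d"
      using d by blast
  qed
qed

end

section \<open>Embedding in the plane\<close>

text \<open>The embedding moves a dendroid of the plane into \<open>complex\<close>, where
  logarithms are available.\<close>

locale planar_smooth_dendroid = rooted_smooth_dendroid X p
  for X :: "'a::euclidean_space set" and p +
  fixes \<iota> :: "'a \<Rightarrow> complex"
  assumes continuous_embedding: "continuous_on X \<iota>" and inj_embedding: "inj_on \<iota> X"
begin

lemma arc_between_image:
  assumes "arc_between A x y" "A \<subseteq> X"
  shows "arc_between (\<iota> ` A) (\<iota> x) (\<iota> y)"
proof -
  obtain g where g: "arc g" "path_image g = A" "pathstart g = x" "pathfinish g = y"
    using assms(1) unfolding arc_between_def by blast
  have sub: "g ` {0..1} \<subseteq> X"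
    using g(2) assms(2) by (simp add: path_image_def)
  have "continuous_on {0..1} (\<iota> \<circ> g)"
    using g(1) continuous_on_subset[OF continuous_embedding sub]
    by (intro continuous_on_compose) (auto simp: arc_def path_def)
  moreover have "inj_on (\<iota> \<circ> g) {0..1}"
    using g(1) inj_on_subset[OF inj_embedding sub] by (intro comp_inj_on) (auto simp: arc_def)
  ultimately have "arc (\<iota> \<circ> g)"
    by (simp add: arc_def path_def)
  then show ?thesis
    unfolding arc_between_def using g
    by (intro exI[of _ "\<iota> \<circ> g"]) (simp add: path_image_compose pathstart_compose pathfinish_compose)
qed

lemma connected_image: "A \<subseteq> X \<Longrightarrow> connected A \<Longrightarrow> connected (\<iota> ` A)"
  using connected_continuous_image continuous_on_subset continuous_embedding by blast

lemma embedding_eq_iff: "x \<in> X \<Longrightarrow> y \<in> X \<Longrightarrow> \<iota> x = \<iota> y \<longleftrightarrow> x = y"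
  using inj_embedding by (auto simp: inj_on_def)

lemma embedding_image_iff: "x \<in> X \<Longrightarrow> A \<subseteq> X \<Longrightarrow> \<iota> x \<in> \<iota> ` A \<longleftrightarrow> x \<in> A"
  using inj_embedding by (auto simp: inj_on_def)

lemma seg_log_ex:
  assumes "x \<in> X" "q \<in> X" "q \<notin> seg x"
  obtains f where "log_on (\<iota> q) (\<iota> ` seg x) f"
proof (cases "x = p")
  case True
  have "q \<noteq> p"
    using assms True by (auto simp: seg_root)
  then have "\<iota> p - \<iota> q \<noteq> 0"
    using embedding_eq_iff assms(2) root by simp
  then show ?thesis
    by (intro that[of "\<lambda>_. Ln (\<iota> p - \<iota> q)"]) (auto simp: log_on_def True seg_root)
next
  case False
  show ?thesis
    using arc_between_log_on_ex[OF arc_between_image[OF seg_arc(2,1)[OF assms(1) False]]]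
      embedding_image_iff[OF assms(2) seg_subset[OF assms(1)]] assms(3) that by blast
qed

text \<open>The change of \<open>log (z - \<iota> q)\<close> along the arc from \<open>p\<close> to
  \<open>x\<close>; its imaginary part is the angle under which \<open>q\<close> sees this
  arc.\<close>

definition \<Phi> :: "'a \<Rightarrow> 'a \<Rightarrow> complex"
  where "\<Phi> q x = turn (\<iota> q) (\<iota> ` seg x) (\<iota> p) (\<iota> x)"

lemma \<Phi>_eq:
  assumes "x \<in> X" "y \<in> seg x" "log_on (\<iota> q) (\<iota> ` seg x) f"
  shows "\<Phi> q y = f (\<iota> y) - f (\<iota> p)"
proof -
  have y: "y \<in> X"
    using assms(1,2) seg_subset by blast
  show ?thesis
    unfolding \<Phi>_def
    using turn_eq[OF connected_image[OF seg_subset[OF y] connected_seg[OF y]] imageI[OF root_seg[OF y]]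
        imageI[OF self_seg[OF y]] log_on_subset[OF assms(3) image_mono[OF seg_mono[OF assms(1,2)]]]] .
qed

lemma \<Phi>_root: "q \<in> X \<Longrightarrow> q \<noteq> p \<Longrightarrow> \<Phi> q p = 0"
  using \<Phi>_eq[OF root self_seg[OF root]] seg_log_ex[OF root, of q] by (metis cancel_comm_monoid_add_class.diff_cancel seg_root singletonD)

text \<open>The subarc from \<open>w\<close> to \<open>y\<close> stays in the open disc about
  \<open>\<iota> w\<close> whose boundary passes through \<open>\<iota> q\<close>. Seen from
  \<open>\<iota> q\<close> this disc lies in a half plane, so the principal logarithm measures the
  change.\<close>

lemma \<Phi>_local:
  assumes "y \<in> X" "q \<in> X" "q \<notin> seg y" "w \<in> seg y"
    and near: "\<And>z. z \<in> seg y \<Longrightarrow> w \<in> seg z \<Longrightarrow> norm (\<iota> z - \<iota> w) < norm (\<iota> w - \<iota> q)"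
  shows "\<Phi> q y - \<Phi> q w = Ln ((\<iota> y - \<iota> q) / (\<iota> w - \<iota> q))"
proof -
  obtain f where f: "log_on (\<iota> q) (\<iota> ` seg y) f"
    using seg_log_ex[OF assms(1-3)] .
  define I where "I = {z \<in> seg y. w \<in> seg z}"
  have w: "w \<in> X" "w \<noteq> q"
    using assms seg_subset by blast+
  then have ne: "\<iota> w - \<iota> q \<noteq> 0"
    using embedding_eq_iff assms(2) by simp
  have I: "w \<in> I" "y \<in> I" "I \<subseteq> seg y" "connected (\<iota> ` I)"
    using assms(1,4) self_seg w(1) between_continuum(2)[OF assms(1,4)] seg_subset[OF assms(1)]
    unfolding I_def by (auto intro!: connected_image)
  have pos: "Re ((z - \<iota> q) / (\<iota> w - \<iota> q)) > 0" if "z \<in> \<iota> ` I" for z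
  proof -
    have "norm (z - \<iota> w) < norm (\<iota> w - \<iota> q)"
      using that near unfolding I_def by auto
    then have "norm ((z - \<iota> w) / (\<iota> w - \<iota> q)) < 1"
      using ne by (simp add: norm_divide)
    moreover have "(z - \<iota> q) / (\<iota> w - \<iota> q) = 1 + (z - \<iota> w) / (\<iota> w - \<iota> q)"
      using ne by (simp add: divide_simps)
    ultimately show ?thesis
      using abs_Re_le_cmod[of "(z - \<iota> w) / (\<iota> w - \<iota> q)"] by simp
  qed
  have "log_on (\<iota> q) (\<iota> ` I) (\<lambda>z. Ln ((z - \<iota> q) / (\<iota> w - \<iota> q)) + Ln (\<iota> w - \<iota> q))"
    unfolding log_on_def
  proof
    show "continuous_on (\<iota> ` I) (\<lambda>z. Ln ((z - \<iota> q) / (\<iota> w - \<iota> q)) + Ln (\<iota> w - \<iota> q))"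
    proof (intro continuous_on_add continuous_on_const continuous_on_Ln')
      show "continuous_on (\<iota> ` I) (\<lambda>z. (z - \<iota> q) / (\<iota> w - \<iota> q))"
        using ne by (intro continuous_intros) auto
      show "(z - \<iota> q) / (\<iota> w - \<iota> q) \<notin> \<real>\<^sub>\<le>\<^sub>0" if "z \<in> \<iota> ` I" for z
        using pos[OF that] by (auto simp: complex_nonpos_Reals_iff)
    qed
    show "\<forall>z\<in>\<iota> ` I. exp (Ln ((z - \<iota> q) / (\<iota> w - \<iota> q)) + Ln (\<iota> w - \<iota> q)) = z - \<iota> q"
    proof
      fix z assume "z \<in> \<iota> ` I"
      then have "(z - \<iota> q) / (\<iota> w - \<iota> q) \<noteq> 0"
        using pos by fastforce
      then show "exp (Ln ((z - \<iota> q) / (\<iota> w - \<iota> q)) + Ln (\<iota> w - \<iota> q)) = z - \<iota> q"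
        using ne by (simp add: exp_add)
    qed
  qed
  from turn_eq[OF I(4) imageI[OF I(1)] imageI[OF I(2)] this]
    turn_eq[OF I(4) imageI[OF I(1)] imageI[OF I(2)] log_on_subset[OF f image_mono[OF I(3)]]]
  have "f (\<iota> y) - f (\<iota> w) = Ln ((\<iota> y - \<iota> q) / (\<iota> w - \<iota> q))"
    using ne by simp
  then show ?thesis
    using \<Phi>_eq[OF assms(1,4) f] \<Phi>_eq[OF assms(1) self_seg[OF assms(1)] f] by simp
qed

lemma tendsto_embedding:
  assumes "\<And>k::nat. s k \<in> X" "x \<in> X" "s \<longlonglongrightarrow> x"
  shows "(\<lambda>k. \<iota> (s k)) \<longlonglongrightarrow> \<iota> x"
  using continuous_on_tendsto_compose[OF continuous_embedding assms(3,2)] assms(1) by simp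

text \<open>If the analogue of \<open>near\<close> failed for infinitely many \<open>k\<close>, a
  limit of the violating points would lie on the subarc from \<open>w\<close> to \<open>y\<close>,
  as the order is closed, and would violate \<open>near\<close>. So \<open>\<Phi>_local\<close>
  applies to almost all \<open>k\<close>, and \<open>Ln\<close> is continuous at the limit.\<close>

lemma tendsto_\<Phi>_diff:
  assumes "y \<in> X" "q \<in> X" "q \<notin> seg y" "w \<in> seg y"
    and near: "\<And>z. z \<in> seg y \<Longrightarrow> w \<in> seg z \<Longrightarrow> norm (\<iota> z - \<iota> w) < norm (\<iota> w - \<iota> q)"
    and seqs: "\<And>k::nat. u k \<in> X" "\<And>k. s k \<in> X" "\<And>k. s k \<notin> seg (u k)" "\<And>k. v k \<in> seg (u k)"
    and lims: "u \<longlonglongrightarrow> y" "s \<longlonglongrightarrow> q" "v \<longlonglongrightarrow> w"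
  shows "(\<lambda>k. \<Phi> (s k) (u k) - \<Phi> (s k) (v k)) \<longlonglongrightarrow> \<Phi> q y - \<Phi> q w"
proof -
  have vX: "v k \<in> X" for k
    using seqs seg_subset by blast
  have wX: "w \<in> X"
    using assms seg_subset by blast
  define bad where "bad k \<longleftrightarrow> (\<exists>z. z \<in> seg (u k) \<and> v k \<in> seg z \<and>
      norm (\<iota> (v k) - \<iota> (s k)) \<le> norm (\<iota> z - \<iota> (v k)))" for k
  have "\<forall>\<^sub>F k in sequentially. \<not> bad k"
  proof (rule ccontr)
    assume "\<not> ?thesis"
    then have "infinite {k. bad k}"
      by (simp add: frequently_def[symmetric] cofinite_eq_sequentially[symmetric] INFM_iff_infinite not_eventually)
    then obtain r0 :: "nat \<Rightarrow> nat" where r0: "strict_mono r0" "\<And>k. bad (r0 k)"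
      using infinite_enumerate by blast
    then obtain z where z: "\<And>k. z k \<in> seg (u (r0 k))" "\<And>k. v (r0 k) \<in> seg (z k)"
      "\<And>k. norm (\<iota> (v (r0 k)) - \<iota> (s (r0 k))) \<le> norm (\<iota> (z k) - \<iota> (v (r0 k)))"
      unfolding bad_def by metis
    have zX: "z k \<in> X" for k
      using z(1) seqs(1) seg_subset by blast
    obtain z' r1 where z': "z' \<in> X" "strict_mono r1" "(z \<circ> r1) \<longlonglongrightarrow> z'"
      using convergent_subsequence[of z] zX by blast
    define r where "r = r0 \<circ> r1"
    have r: "strict_mono r"
      unfolding r_def using r0(1) z'(2) by (rule strict_mono_o)
    have L: "(u \<circ> r) \<longlonglongrightarrow> y" "(s \<circ> r) \<longlonglongrightarrow> q" "(v \<circ> r) \<longlonglongrightarrow> w"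
      using lims r by (auto intro: LIMSEQ_subseq_LIMSEQ)
    have "z' \<in> seg y"
      by (rule limit_in_seg[of "u \<circ> r" y "z \<circ> r1"]) (use seqs assms z z' L in \<open>auto simp: r_def\<close>)
    moreover have "w \<in> seg z'"
      by (rule limit_in_seg[of "z \<circ> r1" z' "v \<circ> r"]) (use zX z z' L in \<open>auto simp: r_def\<close>)
    ultimately have "norm (\<iota> z' - \<iota> w) < norm (\<iota> w - \<iota> q)"
      by (rule near)
    moreover have "norm (\<iota> w - \<iota> q) \<le> norm (\<iota> z' - \<iota> w)"
    proof (rule LIMSEQ_le)
      show "(\<lambda>k. norm (\<iota> ((v \<circ> r) k) - \<iota> ((s \<circ> r) k))) \<longlonglongrightarrow> norm (\<iota> w - \<iota> q)"
        by (intro tendsto_norm tendsto_diff tendsto_embedding L wX assms) (auto simp: vX seqs)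
      show "(\<lambda>k. norm (\<iota> ((z \<circ> r1) k) - \<iota> ((v \<circ> r) k))) \<longlonglongrightarrow> norm (\<iota> z' - \<iota> w)"
        by (intro tendsto_norm tendsto_diff tendsto_embedding L wX z') (auto simp: vX zX)
      show "\<exists>N. \<forall>n\<ge>N. norm (\<iota> ((v \<circ> r) n) - \<iota> ((s \<circ> r) n)) \<le> norm (\<iota> ((z \<circ> r1) n) - \<iota> ((v \<circ> r) n))"
        using z(3) by (auto simp: r_def)
    qed
    ultimately show False
      by simp
  qed
  then have ev: "\<forall>\<^sub>F k in sequentially. \<Phi> (s k) (u k) - \<Phi> (s k) (v k) =
      Ln ((\<iota> (u k) - \<iota> (s k)) / (\<iota> (v k) - \<iota> (s k)))"
  proof (rule eventually_mono)
    fix k assume "\<not> bad k"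
    then show "\<Phi> (s k) (u k) - \<Phi> (s k) (v k) = Ln ((\<iota> (u k) - \<iota> (s k)) / (\<iota> (v k) - \<iota> (s k)))"
      using \<Phi>_local[OF seqs(1,2,3,4), of k] unfolding bad_def by force
  qed
  have ne: "\<iota> w - \<iota> q \<noteq> 0"
    using embedding_eq_iff[OF wX assms(2)] assms(3,4) by auto
  have "Re ((\<iota> y - \<iota> q) / (\<iota> w - \<iota> q)) > 0"
  proof -
    have "norm (\<iota> y - \<iota> w) < norm (\<iota> w - \<iota> q)"
      using near self_seg assms(1,4) by blast
    then have "norm ((\<iota> y - \<iota> w) / (\<iota> w - \<iota> q)) < 1"
      using ne by (simp add: norm_divide)
    moreover have "(\<iota> y - \<iota> q) / (\<iota> w - \<iota> q) = 1 + (\<iota> y - \<iota> w) / (\<iota> w - \<iota> q)"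
      using ne by (simp add: divide_simps)
    ultimately show ?thesis
      using abs_Re_le_cmod[of "(\<iota> y - \<iota> w) / (\<iota> w - \<iota> q)"] by simp
  qed
  then have np: "(\<iota> y - \<iota> q) / (\<iota> w - \<iota> q) \<notin> \<real>\<^sub>\<le>\<^sub>0"
    by (auto simp: complex_nonpos_Reals_iff)
  have "(\<lambda>k. Ln ((\<iota> (u k) - \<iota> (s k)) / (\<iota> (v k) - \<iota> (s k)))) \<longlonglongrightarrow> Ln ((\<iota> y - \<iota> q) / (\<iota> w - \<iota> q))"
    by (intro tendsto_Ln tendsto_divide tendsto_diff tendsto_embedding lims np ne) (auto simp: seqs assms vX wX)
  then show ?thesis
    using tendsto_cong[OF ev] \<Phi>_local[OF assms(1-4) near] by simp
qed

text \<open>Joint continuity is carried along the arc from \<open>p\<close> to \<open>x\<close> in finitely many short steps.\<close>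

lemma tendsto_\<Phi>:
  assumes "x \<in> X" "q \<in> X" "q \<notin> seg x"
    and seqs: "\<And>k::nat. u k \<in> X" "\<And>k. s k \<in> X" "\<And>k. s k \<notin> seg (u k)"
    and lims: "u \<longlonglongrightarrow> x" "s \<longlonglongrightarrow> q"
  shows "(\<lambda>k. \<Phi> (s k) (u k)) \<longlonglongrightarrow> \<Phi> q x"
proof -
  obtain g where g: "continuous_on {0..1::real} g" "g ` {0..1} = seg x" "g 0 = p" "g 1 = x"
    "\<And>u. u \<in> {0..1} \<Longrightarrow> seg (g u) = g ` {0..u}" "x \<noteq> p \<Longrightarrow> inj_on g {0..1}"
    using seg_param[OF assms(1)] by metis
  have gX: "g t \<in> X" "g t \<in> seg x" "q \<notin> seg (g t)" if "t \<in> {0..1}" for t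
    using that g(2) seg_subset[OF assms(1)] seg_mono[OF assms(1)] assms(3) by blast+
  have "compact (\<iota> ` seg x)"
    using compact_seg[OF assms(1)] seg_subset[OF assms(1)] continuous_embedding
    by (meson compact_continuous_image continuous_on_subset)
  moreover have "\<iota> q \<notin> \<iota> ` seg x"
    using embedding_image_iff[OF assms(2) seg_subset[OF assms(1)]] assms(3) by blast
  ultimately obtain r where r: "r > 0" "\<And>z. z \<in> \<iota> ` seg x \<Longrightarrow> r \<le> dist (\<iota> q) z"
    using separate_point_closed[of "\<iota> ` seg x" "\<iota> q"] compact_imp_closed by blast
  have "continuous_on {0..1} (\<lambda>t. \<iota> (g t))"
    using gX by (intro continuous_on_compose2[OF continuous_embedding g(1)]) auto
  then have "uniformly_continuous_on {0..1} (\<lambda>t. \<iota> (g t))"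
    by (intro compact_uniformly_continuous) auto
  then obtain \<eta> where \<eta>: "\<eta> > 0"
      "\<And>t t'. t \<in> {0..1} \<Longrightarrow> t' \<in> {0..1} \<Longrightarrow> dist t' t < \<eta> \<Longrightarrow> dist (\<iota> (g t')) (\<iota> (g t)) < r"
    using r(1) unfolding uniformly_continuous_on_def by metis
  have near: "norm (\<iota> z - \<iota> (g a)) < norm (\<iota> (g a) - \<iota> q)"
    if ab: "0 \<le> a" "a \<le> b" "b \<le> 1" "b - a < \<eta>" and z: "z \<in> seg (g b)" "g a \<in> seg z" for a b z
  proof -
    have "z \<in> g ` {a..b}"
      using seg_between_param[OF assms(1) g(2,5,6) ab(1-3)] z by blast
    then obtain c where c: "c \<in> {a..b}" "z = g c"
      by blast
    have "dist (\<iota> (g c)) (\<iota> (g a)) < r"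
      using ab c by (intro \<eta>(2)) (auto simp: dist_real_def)
    moreover have "r \<le> dist (\<iota> q) (\<iota> (g a))"
      using gX(2)[of a] ab by (intro r(2)) auto
    ultimately show ?thesis
      using c(2) by (simp add: dist_norm norm_minus_commute)
  qed
  \<comment> \<open>All sequences are quantified over, because the step from \<open>a\<close> to
    \<open>b\<close> replaces \<open>u\<close> by points on the arcs to \<open>u k\<close> that
    converge to \<open>g a\<close>.\<close>
  define good where "good t \<longleftrightarrow> (\<forall>u s. (\<forall>k::nat. u k \<in> X) \<longrightarrow> (\<forall>k. s k \<in> X) \<longrightarrow> (\<forall>k. s k \<notin> seg (u k)) \<longrightarrow>
      u \<longlonglongrightarrow> g t \<longrightarrow> s \<longlonglongrightarrow> q \<longrightarrow> (\<lambda>k. \<Phi> (s k) (u k)) \<longlonglongrightarrow> \<Phi> q (g t))" for t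
  have good0: "good 0"
    unfolding good_def
  proof (intro allI impI)
    fix u s :: "nat \<Rightarrow> 'a"
    assume us: "\<forall>k. u k \<in> X" "\<forall>k. s k \<in> X" "\<forall>k. s k \<notin> seg (u k)" "u \<longlonglongrightarrow> g 0" "s \<longlonglongrightarrow> q"
    have "(\<lambda>k. \<Phi> (s k) (u k) - \<Phi> (s k) p) \<longlonglongrightarrow> \<Phi> q (g 0) - \<Phi> q p"
      by (rule tendsto_\<Phi>_diff)
        (use us gX[of 0] near[of 0 0] root_seg \<eta>(1) assms(2) g(3) in auto)
    moreover have "s k \<noteq> p" for k
      using us root_seg by metis
    moreover have "q \<noteq> p"
      using assms root_seg by blast
    ultimately show "(\<lambda>k. \<Phi> (s k) (u k)) \<longlonglongrightarrow> \<Phi> q (g 0)"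
      using us assms(2) by (simp add: \<Phi>_root)
  qed
  have step: "good b" if ab: "0 \<le> a" "a \<le> b" "b \<le> 1" "b - a < \<eta>" and "good a" for a b
    unfolding good_def
  proof (intro allI impI)
    fix u s :: "nat \<Rightarrow> 'a"
    assume us: "\<forall>k. u k \<in> X" "\<forall>k. s k \<in> X" "\<forall>k. s k \<notin> seg (u k)" "u \<longlonglongrightarrow> g b" "s \<longlonglongrightarrow> q"
    have b: "b \<in> {0..1}" and gab: "g a \<in> seg (g b)"
      using ab g(5)[of b] by auto
    obtain v where v: "\<And>k. v k \<in> seg (u k)" "v \<longlonglongrightarrow> g a"
      using approx_in_seg[of u "g b" "g a"] us gX(1)[OF b] gab by metis
    have "(\<lambda>k. \<Phi> (s k) (u k) - \<Phi> (s k) (v k)) \<longlonglongrightarrow> \<Phi> q (g b) - \<Phi> q (g a)"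
      by (rule tendsto_\<Phi>_diff) (use us v gX[OF b] gab near[OF ab] assms(2) in auto)
    moreover have "(\<lambda>k. \<Phi> (s k) (v k)) \<longlonglongrightarrow> \<Phi> q (g a)"
    proof -
      have "v k \<in> X" "s k \<notin> seg (v k)" for k
        using us v(1)[of k] seg_subset seg_mono by blast+
      then show ?thesis
        using \<open>good a\<close> us v(2) unfolding good_def by blast
    qed
    ultimately have "(\<lambda>k. (\<Phi> (s k) (u k) - \<Phi> (s k) (v k)) + \<Phi> (s k) (v k)) \<longlonglongrightarrow> (\<Phi> q (g b) - \<Phi> q (g a)) + \<Phi> q (g a)"
      by (rule tendsto_add)
    then show "(\<lambda>k. \<Phi> (s k) (u k)) \<longlonglongrightarrow> \<Phi> q (g b)"
      by simp
  qed
  have all: "good t" if "t \<in> {0..1}" "t \<le> real n * (\<eta> / 2)" for n t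
    using that
  proof (induction n arbitrary: t)
    case 0
    then show ?case
      using good0 by auto
  next
    case (Suc n)
    define a where "a = max 0 (t - \<eta> / 2)"
    have "a \<le> real n * (\<eta> / 2)"
    proof -
      have "t - \<eta> / 2 \<le> real n * (\<eta> / 2)" "0 \<le> real n * (\<eta> / 2)"
        using Suc.prems(2) \<eta>(1) by (simp_all add: field_simps)
      then show ?thesis
        unfolding a_def by (intro max.boundedI)
    qed
    then have "good a"
      using Suc.prems \<eta>(1) by (intro Suc.IH) (auto simp: a_def)
    then show ?case
      using Suc.prems \<eta>(1) by (intro step[of a t]) (auto simp: a_def)
  qed
  obtain n :: nat where "1 / (\<eta> / 2) < real n"
    using reals_Archimedean2 by blast
  then have "good 1"
    using \<eta>(1) by (intro all[of 1 n]) (simp_all add: field_simps)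
  then show ?thesis
    using seqs lims g(4) unfolding good_def by blast
qed

end

section \<open>The order of the endpoints\<close>

lemma Im_if_exp_minus_one:
  assumes "exp w = - 1" "\<bar>Im w\<bar> < 3 * pi"
  shows "Im w = pi \<or> Im w = - pi"
proof -
  have "exp w = exp (pi * \<i>)"
    using assms(1) by simp
  then obtain n :: int where n: "w = pi * \<i> + (of_int (2 * n) * pi) * \<i>"
    by (metis exp_eq)
  then have im: "Im w = (2 * real_of_int n + 1) * pi"
    by (simp add: algebra_simps)
  then have "\<bar>2 * real_of_int n + 1\<bar> * pi < 3 * pi"
    using assms(2) by (simp add: abs_mult)
  then have "\<bar>2 * real_of_int n + 1\<bar> < 3"
    by simp
  then have "n = 0 \<or> n = - 1"
    by linarith
  then show ?thesis
    using im by auto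
qed

context planar_smooth_dendroid
begin

section \<open>The cyclic order of pairwise incomparable points\<close>

definition incomparable :: "'a \<Rightarrow> 'a \<Rightarrow> bool"
  where "incomparable a b \<longleftrightarrow> a \<in> X \<and> b \<in> X \<and> a \<notin> seg b \<and> b \<notin> seg a"

lemma incomparable_sym: "incomparable a b \<Longrightarrow> incomparable b a"
  by (simp add: incomparable_def)

lemma endpoints_incomparable:
  assumes "a \<in> endpoints X" "a \<noteq> p" "b \<in> X" "b \<notin> seg a"
  shows "incomparable a b"
proof -
  have "a \<in> X"
    using assms(1) by (simp add: endpoints_def)
  moreover have "a \<notin> seg b"
    using endpoint_maximal[OF assms(1-3)] assms(4) self_seg[OF \<open>a \<in> X\<close>] by auto
  ultimately show ?thesis
    using assms(3,4) by (simp add: incomparable_def)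
qed

lemma distinct_endpoints_incomparable:
  assumes "a \<in> endpoints X" "a \<noteq> p" "b \<in> endpoints X" "b \<noteq> p" "a \<noteq> b"
  shows "incomparable a b"
proof -
  have "a \<in> X" "b \<in> X"
    using assms(1,3) by (auto simp: endpoints_def)
  then show ?thesis
    using endpoints_incomparable[OF assms(1,2)] endpoint_maximal[OF assms(3,4)] assms(5) by blast
qed

definition rot :: "'a \<Rightarrow> 'a \<Rightarrow> 'a \<Rightarrow> complex"
  where "rot a b c = (\<Phi> a c - \<Phi> a b) + (\<Phi> b a - \<Phi> b c) + (\<Phi> c b - \<Phi> c a)"

text \<open>Up to sign, \<open>rot a b c\<close> sums the antisymmetric function
  \<open>\<Phi> x y - \<Phi> y x\<close> over the edges \<open>ab\<close>, \<open>bc\<close>,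
  \<open>ca\<close>. So it alternates and is a cocycle.\<close>

lemma rot_swap: "rot a c b = - rot a b c"
  and rot_cocycle: "rot a b c = rot e a b + rot e b c + rot e c a"
  and rot_diag: "rot e a a = 0"
  by (simp_all add: rot_def)

lemma Im_rot:
  assumes "incomparable a b" "incomparable b c" "incomparable a c"
  shows "Im (rot a b c) = pi \<or> Im (rot a b c) = - pi"
proof -
  have X: "a \<in> X" "b \<in> X" "c \<in> X" and ns: "a \<notin> seg b" "a \<notin> seg c" "b \<notin> seg a" "b \<notin> seg c" "c \<notin> seg a" "c \<notin> seg b"
    using assms by (auto simp: incomparable_def)
  have np: "a \<noteq> p" "b \<noteq> p" "c \<noteq> p"
    using ns root_seg X by metis+
  have co: "connected (\<iota> ` seg x \<inter> \<iota> ` seg y)" if "x \<in> X" "y \<in> X" for x y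
  proof -
    have "connected (seg x \<inter> seg y)"
      using dendroid that compact_seg connected_seg seg_subset
      unfolding dendroid_def hereditarily_unicoherent_def continuum_def by blast
    then have "connected (\<iota> ` (seg x \<inter> seg y))"
      using seg_subset[OF that(1)] by (intro connected_image) auto
    moreover have "\<iota> ` (seg x \<inter> seg y) = \<iota> ` seg x \<inter> \<iota> ` seg y"
      using inj_on_image_Int[OF inj_embedding] seg_subset that by blast
    ultimately show ?thesis
      by simp
  qed
  have nm: "\<iota> x \<notin> \<iota> ` seg y" if "x \<in> X" "y \<in> X" "x \<notin> seg y" for x y
    using embedding_image_iff[OF that(1) seg_subset[OF that(2)]] that(3) by blast
  have tri: "triod (\<iota> p) (\<iota> ` seg a) (\<iota> a) (\<iota> ` seg b) (\<iota> b) (\<iota> ` seg c) (\<iota> c)"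
    unfolding triod_def using X ns np nm co arc_between_image seg_arc by simp
  have eq: "triod_turn (\<iota> p) (\<iota> ` seg a) (\<iota> a) (\<iota> ` seg b) (\<iota> b) (\<iota> ` seg c) (\<iota> c) = rot a b c"
    by (simp add: triod_turn_def rot_def \<Phi>_def)
  have "exp (rot a b c) = - 1"
    using exp_triod_turn tri unfolding eq[symmetric] triod_def by blast
  moreover have "\<bar>Im (rot a b c)\<bar> < 3 * pi"
    using triod_turn_bound[OF tri] by (simp add: eq)
  ultimately show ?thesis
    by (rule Im_if_exp_minus_one)
qed

lemma tendsto_rot:
  assumes lim: "incomparable a b" "incomparable b c" "incomparable a c"
    and seq: "\<And>n::nat. incomparable (u n) (v n)" "\<And>n. incomparable (v n) (w n)" "\<And>n. incomparable (u n) (w n)"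
    and conv: "u \<longlonglongrightarrow> a" "v \<longlonglongrightarrow> b" "w \<longlonglongrightarrow> c"
  shows "(\<lambda>n. rot (u n) (v n) (w n)) \<longlonglongrightarrow> rot a b c"
  unfolding rot_def
  by (intro tendsto_add tendsto_diff tendsto_\<Phi> conv) (use lim seq in \<open>auto simp: incomparable_def\<close>)

end

locale endpoint_order = planar_smooth_dendroid X p \<iota>
  for X :: "'a::euclidean_space set" and p \<iota> +
  fixes e0 :: 'a
  assumes suslinian: "Suslinian X"
    and hereditarily_disconnected_endpoints: "hereditarily_disconnected_space (top_of_set (endpoints X))"
    and base: "e0 \<in> endpoints X" "e0 \<noteq> p"
begin

text \<open>At \<open>p\<close> and at the base point \<open>e0\<close> the incomparability behind
  the order fails; the two points are dealt with at the end by
  \<open>clopen_base_at_isolated\<close>.\<close>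

definition S :: "'a set"
  where "S = endpoints X - {p, e0}"

text \<open>The sign \<open>\<sigma> = \<plusminus>1\<close> gives the order and its reverse.\<close>

definition lt :: "real \<Rightarrow> 'a \<Rightarrow> 'a \<Rightarrow> bool"
  where "lt \<sigma> a b \<longleftrightarrow> 0 < \<sigma> * Im (rot e0 a b)"

lemma S_X: "a \<in> S \<Longrightarrow> a \<in> X"
  by (simp add: S_def endpoints_def)

lemma base_X: "e0 \<in> X"
  using base by (simp add: endpoints_def)

lemma incomparable_base: "a \<in> S \<Longrightarrow> incomparable e0 a"
  using distinct_endpoints_incomparable base by (auto simp: S_def)

lemma incomparable_S: "a \<in> S \<Longrightarrow> b \<in> S \<Longrightarrow> a \<noteq> b \<Longrightarrow> incomparable a b"
  using distinct_endpoints_incomparable by (auto simp: S_def)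

lemma lt_reverse: "lt (- \<sigma>) a b \<longleftrightarrow> lt \<sigma> b a"
  by (simp add: lt_def rot_swap[of e0 a b])

lemma lt_irrefl: "\<not> lt \<sigma> a a"
  by (simp add: lt_def rot_diag)

lemma lt_iff:
  assumes "\<sigma> = 1 \<or> \<sigma> = - 1" "a \<in> S" "b \<in> S" "a \<noteq> b"
  shows "lt \<sigma> a b \<longleftrightarrow> \<sigma> * Im (rot e0 a b) = pi" "\<not> lt \<sigma> a b \<longleftrightarrow> \<sigma> * Im (rot e0 a b) = - pi"
  using Im_rot[OF incomparable_base[OF assms(2)] incomparable_S[OF assms(2-4)] incomparable_base[OF assms(3)]]
    assms(1) pi_gt_zero by (auto simp: lt_def)

lemma lt_total:
  assumes "\<sigma> = 1 \<or> \<sigma> = - 1" "a \<in> S" "b \<in> S" "a \<noteq> b"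
  shows "lt \<sigma> a b \<or> lt \<sigma> b a"
  using lt_iff[OF assms] pi_gt_zero by (auto simp: lt_def rot_swap[of e0 a b])

text \<open>By the cocycle identity \<open>\<sigma> * Im (rot a b c)\<close> is
  \<open>2 * pi\<close> minus \<open>\<sigma> * Im (rot e0 a c)\<close>. Both are pi or -pi, so both
  are pi. The second conclusion is independent of \<open>e0\<close> and serves in
  \<open>level_gap_right\<close>.\<close>

lemma lt_trans:
  assumes \<sigma>: "\<sigma> = 1 \<or> \<sigma> = - 1" and S: "a \<in> S" "b \<in> S" "c \<in> S" and lt: "lt \<sigma> a b" "lt \<sigma> b c"
  shows "lt \<sigma> a c" "\<sigma> * Im (rot a b c) = pi"
proof -
  have ne: "a \<noteq> b" "b \<noteq> c"
    using lt lt_irrefl by metis+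
  have ac: "a \<noteq> c"
    using lt rot_swap[of e0 a b] unfolding lt_def by auto
  have R: "\<sigma> * Im (rot a b c) = pi \<or> \<sigma> * Im (rot a b c) = - pi"
    using Im_rot[OF incomparable_S[OF S(1,2) ne(1)] incomparable_S[OF S(2,3) ne(2)] incomparable_S[OF S(1,3) ac]] \<sigma>
    by auto
  have "\<sigma> * Im (rot a b c) = \<sigma> * Im (rot e0 a b) + \<sigma> * Im (rot e0 b c) - \<sigma> * Im (rot e0 a c)"
    using rot_cocycle[of a b c e0] rot_swap[of e0 a c] by (simp add: algebra_simps)
  moreover have "\<sigma> * Im (rot e0 a b) = pi" "\<sigma> * Im (rot e0 b c) = pi"
    using lt_iff(1)[OF \<sigma> S(1,2) ne(1)] lt_iff(1)[OF \<sigma> S(2,3) ne(2)] lt by auto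
  moreover have "\<sigma> * Im (rot e0 a c) = pi \<or> \<sigma> * Im (rot e0 a c) = - pi"
    using lt_iff[OF \<sigma> S(1,3) ac] by blast
  ultimately have "\<sigma> * Im (rot e0 a c) = pi" "\<sigma> * Im (rot a b c) = pi"
    using R pi_gt_zero by auto
  then show "lt \<sigma> a c" "\<sigma> * Im (rot a b c) = pi"
    by (simp_all add: lt_def)
qed

lemma continuous_on_rot:
  assumes "b \<in> X" "c \<in> X" "incomparable b c" "\<And>x. x \<in> M \<Longrightarrow> incomparable x b \<and> incomparable x c"
  shows "continuous_on M (\<lambda>x. Im (rot b x c))"
proof (rule continuous_on_sequentiallyI)
  fix u a assume u: "\<forall>n. u n \<in> M" "a \<in> M" "u \<longlonglongrightarrow> a"
  have "(\<lambda>n. rot b (u n) c) \<longlonglongrightarrow> rot b a c"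
    by (rule tendsto_rot) (use u assms(3,4) incomparable_sym in auto)
  then show "(\<lambda>n. Im (rot b (u n) c)) \<longlonglongrightarrow> Im (rot b a c)"
    by (rule tendsto_Im)
qed

lemma below_open:
  assumes \<sigma>: "\<sigma> = 1 \<or> \<sigma> = - 1" and a: "a \<in> S"
  shows "openin (top_of_set S) {x \<in> S. lt \<sigma> x a}"
proof -
  have "continuous_on (S - {a}) (\<lambda>x. \<sigma> * Im (rot e0 x a))"
    using a incomparable_base incomparable_S incomparable_sym S_X base_X
    by (intro continuous_on_mult continuous_on_const continuous_on_rot) auto
  then have "openin (top_of_set (S - {a})) ((S - {a}) \<inter> (\<lambda>x. \<sigma> * Im (rot e0 x a)) -` {0<..})"
    by (rule continuous_openin_preimage_gen) auto
  moreover have "(S - {a}) \<inter> (\<lambda>x. \<sigma> * Im (rot e0 x a)) -` {0<..} = {x \<in> S. lt \<sigma> x a}"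
    using lt_irrefl by (auto simp: lt_def rot_diag)
  moreover have "openin (top_of_set S) (S - {a})"
    by (simp add: openin_delete)
  ultimately show ?thesis
    using openin_trans by metis
qed

lemma above_open:
  assumes "\<sigma> = 1 \<or> \<sigma> = - 1" "a \<in> S"
  shows "openin (top_of_set S) {x \<in> S. lt \<sigma> a x}"
  using below_open[of "- \<sigma>" a] assms by (auto simp: lt_reverse)

text \<open>All points of \<open>up d\<close> are incomparable to \<open>c\<close> and to
  \<open>e0\<close>, so the side of \<open>c\<close> on which they lie is given by a continuous
  function without zeros on \<open>up d\<close>. Arcs in \<open>up d\<close> join its points to
  \<open>d\<close>; hence all are on the same side of \<open>c\<close>.\<close>

lemma up_convex:
  assumes \<sigma>: "\<sigma> = 1 \<or> \<sigma> = - 1" and d: "d \<in> X" "e0 \<notin> up d"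
    and S: "a \<in> S" "b \<in> S" "c \<in> S" and ab: "a \<in> up d" "b \<in> up d" and lt: "lt \<sigma> a c" "lt \<sigma> c b"
  shows "c \<in> up d"
proof (rule ccontr)
  assume c: "c \<notin> up d"
  have inc: "incomparable x z" if "x \<in> up d" "z \<in> endpoints X" "z \<noteq> p" "z \<notin> up d" for x z
  proof -
    have zX: "z \<in> X" "x \<in> X"
      using that by (auto simp: endpoints_def up_def)
    have "x \<notin> seg z"
      using that seg_mono[OF zX(1), of x] zX(1) unfolding up_def by blast
    then show ?thesis
      using endpoints_incomparable[OF that(2,3) zX(2)] endpoint_maximal[OF that(2,3) zX(2)] that(1,4)
      by (metis incomparable_def zX)
  qed
  have ce: "c \<in> endpoints X" "c \<noteq> p"
    using S(3) by (auto simp: S_def)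
  define k where "k x = \<sigma> * Im (rot e0 x c)" for x
  have cont: "continuous_on (up d) k"
    unfolding k_def
    using inc[OF _ base d(2)] inc[OF _ ce c] incomparable_base[OF S(3)] base_X S_X[OF S(3)]
    by (intro continuous_on_mult continuous_on_const continuous_on_rot) auto
  have nz: "k x \<noteq> 0" if "x \<in> up d" for x
    using Im_rot[of e0 x c] inc[OF that base d(2)] inc[OF that ce c] incomparable_base[OF S(3)]
      incomparable_sym \<sigma> pi_neq_zero unfolding k_def by auto
  have same: "0 < k z \<longleftrightarrow> 0 < k d" if z: "z \<in> up d" for z
  proof -
    have zX: "z \<in> X" "d \<in> seg z"
      using z by (auto simp: up_def)
    define C where "C = {y \<in> seg z. d \<in> seg y}"
    have C: "C \<subseteq> up d" "z \<in> C" "d \<in> C"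
      using zX self_seg d(1) seg_subset[OF zX(1)] unfolding C_def up_def by auto
    have conn: "connected (k ` C)"
      using between_continuum(2)[OF zX] continuous_on_subset[OF cont C(1)]
      unfolding C_def by (rule connected_continuous_image[rotated])
    show ?thesis
    proof (rule ccontr)
      assume "\<not> ?thesis"
      then have "(k z \<le> 0 \<and> 0 \<le> k d) \<or> (k d \<le> 0 \<and> 0 \<le> k z)"
        by auto
      then have "0 \<in> k ` C"
        using connectedD_interval[OF conn imageI[OF C(2)] imageI[OF C(3)], of 0]
          connectedD_interval[OF conn imageI[OF C(3)] imageI[OF C(2)], of 0] by blast
      then show False
        using nz C(1) by auto
    qed
  qed
  have "0 < k a"
    using lt(1) by (simp add: lt_def k_def)
  moreover have "\<not> 0 < k b"
    using lt(2) rot_swap[of e0 b c] by (simp add: lt_def k_def)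
  ultimately show False
    using same ab by blast
qed

text \<open>The network consists of the sets \<open>up d \<inter> S\<close> with \<open>d\<close>
  from a countable order-dense set and \<open>e0 \<notin> up d\<close>. It serves both
  orientations.\<close>

lemma ordered_network:
  obtains \<N> where "\<And>\<sigma>. \<sigma> = 1 \<or> \<sigma> = - 1 \<Longrightarrow> convex_network S (lt \<sigma>) \<N>"
proof -
  obtain D where D: "countable D" "D \<subseteq> X"
    "\<And>e t. e \<in> X \<Longrightarrow> t \<in> seg e \<Longrightarrow> t \<noteq> e \<Longrightarrow> \<exists>d\<in>D. d \<in> seg e \<and> d \<noteq> e \<and> t \<in> seg d"
    using countable_order_dense[OF suslinian] by metis
  define \<N> where "\<N> = (\<lambda>d. up d \<inter> S) ` {d \<in> D. e0 \<notin> up d}"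
  have "convex_network S (lt \<sigma>) \<N>" if \<sigma>: "\<sigma> = 1 \<or> \<sigma> = - 1" for \<sigma>
  proof
    show "\<not> lt \<sigma> a a" for a
      by (rule lt_irrefl)
    show "lt \<sigma> a c" if "a \<in> S" "b \<in> S" "c \<in> S" "lt \<sigma> a b" "lt \<sigma> b c" for a b c
      using lt_trans(1)[OF \<sigma> that] .
    show "lt \<sigma> a b \<or> lt \<sigma> b a" if "a \<in> S" "b \<in> S" "a \<noteq> b" for a b
      using lt_total[OF \<sigma> that] .
    show "openin (top_of_set S) {x \<in> S. lt \<sigma> x a}" "openin (top_of_set S) {x \<in> S. lt \<sigma> a x}"
      if "a \<in> S" for a
      using below_open[OF \<sigma> that] above_open[OF \<sigma> that] .
    show "countable \<N>"
      unfolding \<N>_def using D(1) by (intro countable_image) (rule countable_subset[of _ D], auto)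
    show "N \<subseteq> S" if "N \<in> \<N>" for N
      using that unfolding \<N>_def by blast
    show "c \<in> N" if N: "N \<in> \<N>" "a \<in> N" "b \<in> N" "c \<in> S" "lt \<sigma> a c" "lt \<sigma> c b" for N a b c
    proof -
      obtain d where "d \<in> D" "e0 \<notin> up d" "N = up d \<inter> S"
        using N(1) unfolding \<N>_def by blast
      then show ?thesis
        using up_convex[OF \<sigma>, of d a b c] N D(2) by blast
    qed
    show "\<exists>N\<in>\<N>. e \<in> N \<and> N \<subseteq> V" if V: "e \<in> V" "openin (top_of_set S) V" for e V
    proof -
      obtain G where G: "open G" "V = S \<inter> G"
        using V(2) by (auto simp: openin_open)
      \<comment> \<open>Removing \<open>e0\<close> from \<open>G\<close> ensures that
        \<open>e0 \<notin> up d\<close> for the point \<open>d\<close> found below.\<close>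
      have e: "e \<in> endpoints X" "e \<noteq> p" "e \<in> S" "e \<in> X" "open (G - {e0})" "e \<in> G - {e0}"
        using V(1) G by (auto simp: S_def endpoints_def open_delete)
      obtain t where t: "t \<in> seg e" "t \<noteq> e" "up t \<subseteq> G - {e0}"
        using small_up[OF e(1,2,5,6)] .
      obtain d where d: "d \<in> D" "d \<in> seg e" "t \<in> seg d"
        using D(3)[OF e(4) t(1,2)] by blast
      have "up d \<subseteq> up t"
        using d(3) seg_mono unfolding up_def by blast
      then have "e0 \<notin> up d" "up d \<inter> S \<subseteq> V" "e \<in> up d \<inter> S"
        using t(3) G(2) d(2) e(3,4) by (auto simp: up_def)
      then show ?thesis
        using d(1) unfolding \<N>_def by blast
    qed
    show "hereditarily_disconnected_space (top_of_set S)"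
      using hereditarily_disconnected_endpoints unfolding hereditarily_disconnected_space_def
      by (auto simp: connectedin_subtopology S_def)
  qed
  then show thesis
    using that by blast
qed

end

section \<open>Clopen neighbourhoods of endpoints\<close>

context endpoint_order
begin

text \<open>If points \<open>e\<^sub>i\<close> of the level set descend to \<open>y\<close> and accumulate at \<open>z\<close>, then \<open>z\<close> lies on the
  arc from \<open>p\<close> to \<open>y\<close>: otherwise the orientation of \<open>(x\<^sub>j, e\<^sub>i, c)\<close> would be constant near
  \<open>(y, z, c)\<close>, whereas both orders of \<open>x\<^sub>j\<close> and \<open>e\<^sub>i\<close> occur for \<open>x\<^sub>j\<close> close to \<open>y\<close>.\<close>

lemma level_gap_right:
  assumes \<sigma>: "\<sigma> = 1 \<or> \<sigma> = - 1" and y: "y \<in> S" "r < infdist t (seg y)"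
    and lim: "\<And>V. openin (top_of_set S) V \<Longrightarrow> y \<in> V \<Longrightarrow> \<exists>x\<in>V. lt \<sigma> y x"
  shows "\<exists>c\<in>S. lt \<sigma> y c \<and> (\<forall>e\<in>S. lt \<sigma> y e \<longrightarrow> lt \<sigma> e c \<longrightarrow> infdist t (seg e) \<noteq> r)"
proof (rule ccontr)
  assume "\<not> ?thesis"
  then have no: "\<exists>e\<in>S. lt \<sigma> y e \<and> lt \<sigma> e c \<and> infdist t (seg e) = r" if "c \<in> S" "lt \<sigma> y c" for c
    using that by blast
  have opb: "openin (top_of_set S) (S \<inter> ball y d)" for d
    by auto
  have "\<exists>x. \<forall>n. (x n \<in> S \<and> lt \<sigma> y (x n) \<and> dist (x n) y < inverse (real (Suc n))) \<and> lt \<sigma> (x (Suc n)) (x n)"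
  proof (rule dependent_nat_choice)
    obtain x where "x \<in> S \<inter> ball y 1" "lt \<sigma> y x"
      using lim[OF opb, of 1] y(1) by auto
    then show "\<exists>x. x \<in> S \<and> lt \<sigma> y x \<and> dist x y < inverse (real (Suc 0))"
      by (auto simp: dist_commute)
    fix x n assume x: "x \<in> S \<and> lt \<sigma> y x \<and> dist x y < inverse (real (Suc n))"
    have "openin (top_of_set S) ((S \<inter> ball y (inverse (real (Suc (Suc n))))) \<inter> {z \<in> S. lt \<sigma> z x})"
      using openin_Int[OF opb below_open[OF \<sigma>]] x by blast
    then obtain z where "z \<in> (S \<inter> ball y (inverse (real (Suc (Suc n))))) \<inter> {z \<in> S. lt \<sigma> z x}" "lt \<sigma> y z"
      using lim x y(1) by (metis (no_types, lifting) IntI centre_in_ball inverse_positive_iff_positive mem_Collect_eq of_nat_0_less_iff zero_less_Suc)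
    then show "\<exists>z. (z \<in> S \<and> lt \<sigma> y z \<and> dist z y < inverse (real (Suc (Suc n)))) \<and> lt \<sigma> z x"
      by (auto simp: dist_commute)
  qed
  then obtain x where x: "\<And>n. x n \<in> S" "\<And>n. lt \<sigma> y (x n)" "\<And>n. dist (x n) y < inverse (real (Suc n))"
      "\<And>n. lt \<sigma> (x (Suc n)) (x n)"
    by blast
  have xy: "x \<longlonglongrightarrow> y"
  proof -
    have "(\<lambda>n. dist (x n) y) \<longlonglongrightarrow> 0"
      by (rule tendsto_sandwich[OF _ _ tendsto_const LIMSEQ_inverse_real_of_nat])
        (use x(3) in \<open>auto simp: less_imp_le\<close>)
    then show ?thesis
      using tendsto_dist_iff by blast
  qed
  have xdec: "lt \<sigma> (x (n + Suc k)) (x n)" for n k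
  proof (induction k)
    case 0
    then show ?case
      using x(4) by simp
  next
    case (Suc k)
    then show ?case
      using lt_trans(1)[OF \<sigma> x(1) x(1) x(1) x(4)[of "n + Suc k"]] by simp
  qed
  have xlt: "lt \<sigma> (x m) (x n)" if "n < m" for m n
    using xdec[of n "m - n - 1"] that by simp
  have "\<exists>e. e \<in> S \<and> lt \<sigma> y e \<and> lt \<sigma> e (x n) \<and> infdist t (seg e) = r" for n
    using no[OF x(1,2)] by blast
  then obtain e where e: "\<And>n. e n \<in> S" "\<And>n. lt \<sigma> y (e n)" "\<And>n. lt \<sigma> (e n) (x n)" "\<And>n. infdist t (seg (e n)) = r"
    by metis
  obtain z \<rho> where z: "z \<in> X" "strict_mono \<rho>" "(e \<circ> \<rho>) \<longlonglongrightarrow> z"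
    using convergent_subsequence[of e] S_X[OF e(1)] by blast
  have "(\<lambda>n. infdist t (seg ((e \<circ> \<rho>) n))) \<longlonglongrightarrow> infdist t (seg z)"
    using continuous_on_tendsto_compose[OF continuous_on_infdist_seg z(3,1)] S_X[OF e(1)] by simp
  then have hz: "infdist t (seg z) = r"
    using e(4) by (simp add: LIMSEQ_const_iff)
  have yX: "y \<in> X" and yE: "y \<in> endpoints X" "y \<noteq> p"
    using y(1) S_X by (auto simp: S_def)
  \<comment> \<open>A longer arc is at least as near to \<open>t\<close>, but the arc to
    \<open>y\<close> is farther from \<open>t\<close> than the arc to \<open>z\<close>.\<close>
  have zy: "z \<notin> seg y"
  proof
    assume "z \<in> seg y"
    then have "infdist t (seg y) \<le> infdist t (seg z)"
      using seg_mono[OF yX] root_seg[OF z(1)] by (intro infdist_mono) auto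
    then show False
      using y(2) hz by simp
  qed
  \<comment> \<open>The third point \<open>c = x k\<close> of the triple must be incomparable to
    \<open>z\<close> too.\<close>
  have "\<exists>k. z \<notin> seg (x k)"
  proof (rule ccontr)
    assume "\<not> ?thesis"
    then have "z \<in> seg y"
      using limit_in_seg[of x y "\<lambda>_. z" z] S_X[OF x(1)] yX xy by auto
    then show False
      using zy by simp
  qed
  then obtain k where k: "z \<notin> seg (x k)"
    by blast
  define c where "c = x k"
  have c: "c \<in> S" "c \<in> endpoints X" "c \<noteq> p"
    using x(1) by (auto simp: c_def S_def)
  have ltne: "a \<noteq> b" if "lt \<sigma> a b" for a b
    using that lt_irrefl by metis
  have inc: "incomparable y z" "incomparable z c" "incomparable y c"
    using endpoints_incomparable[OF yE z(1) zy] endpoints_incomparable[OF c(2,3) z(1)] k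
      incomparable_S[OF y(1) c(1)] ltne[OF x(2)] incomparable_sym by (auto simp: c_def)
  \<comment> \<open>After the shift by \<open>Suc k\<close>, both \<open>w n\<close> and
    \<open>x (n + Suc k)\<close> lie strictly below \<open>c = x k\<close>.\<close>
  define w where "w n = e (\<rho> (n + Suc k))" for n
  have w: "w n \<in> S" "lt \<sigma> y (w n)" "lt \<sigma> (w n) (x (n + Suc k))" "lt \<sigma> (w n) c" for n
  proof -
    show "w n \<in> S" "lt \<sigma> y (w n)"
      using e by (simp_all add: w_def)
    have "n + Suc k \<le> \<rho> (n + Suc k)"
      using z(2) by (rule seq_suble)
    then have "x (\<rho> (n + Suc k)) = x (n + Suc k) \<or> lt \<sigma> (x (\<rho> (n + Suc k))) (x (n + Suc k))"
      using xlt by (metis le_neq_implies_less)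
    then show lx: "lt \<sigma> (w n) (x (n + Suc k))"
      using e(3)[of "\<rho> (n + Suc k)"] lt_trans(1)[OF \<sigma> e(1) x(1) x(1)] unfolding w_def by metis
    show "lt \<sigma> (w n) c"
      using lt_trans(1)[OF \<sigma> \<open>w n \<in> S\<close> x(1) x(1) lx] xlt[of k "n + Suc k"] unfolding c_def by simp
  qed
  have wz: "w \<longlonglongrightarrow> z"
    using LIMSEQ_ignore_initial_segment[OF z(3), of "Suc k"] by (simp add: w_def[abs_def] o_def)
  have "\<exists>j\<ge>n + Suc k. lt \<sigma> (x j) (w n)" for n
  proof -
    obtain G where G: "open G" "{a \<in> S. lt \<sigma> a (w n)} = S \<inter> G"
      using below_open[OF \<sigma> w(1)] by (auto simp: openin_open)
    then have "y \<in> G"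
      using w(2) y(1) by blast
    then have "\<forall>\<^sub>F j in sequentially. x j \<in> G"
      using xy G(1) topological_tendstoD by blast
    then obtain j where "j \<ge> n + Suc k" "x j \<in> G"
      unfolding eventually_sequentially by (meson le_cases order_refl)
    then show ?thesis
      using G(2) x(1) by blast
  qed
  then obtain j where j: "\<And>n. n + Suc k \<le> j n" "\<And>n. lt \<sigma> (x (j n)) (w n)"
    by metis
  have lim1: "(\<lambda>n. x (n + Suc k)) \<longlonglongrightarrow> y"
    using xy by (rule LIMSEQ_ignore_initial_segment)
  have lim2: "(\<lambda>n. x (j n)) \<longlonglongrightarrow> y"
  proof -
    have "filterlim j at_top sequentially"
    proof (rule filterlim_at_top_mono[OF filterlim_ident])
      have "n \<le> j n" for n
        using j(1)[of n] by simp
      then show "\<forall>\<^sub>F n in sequentially. n \<le> j n"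
        by simp
    qed
    then show ?thesis
      using xy filterlim_compose by blast
  qed
  have xc: "lt \<sigma> (x (n + Suc k)) c" "lt \<sigma> (x (j n)) c" for n
    using xlt[of k] j(1)[of n] by (auto simp: c_def)
  have inc': "incomparable a b" if "a \<in> S" "b \<in> S" "lt \<sigma> a b \<or> lt \<sigma> b a" for a b
    using incomparable_S[OF that(1,2)] that(3) ltne by blast
  have "(\<lambda>n. rot (x (n + Suc k)) (w n) c) \<longlonglongrightarrow> rot y z c"
    by (rule tendsto_rot[OF inc _ _ _ lim1 wz tendsto_const]) (use inc' x(1) w xc c(1) in blast)+
  then have L1: "(\<lambda>n. \<sigma> * Im (rot (x (n + Suc k)) (w n) c)) \<longlonglongrightarrow> \<sigma> * Im (rot y z c)"
    by (intro tendsto_mult tendsto_const tendsto_Im)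
  \<comment> \<open>Here \<open>w n\<close> precedes \<open>x (n + Suc k)\<close>, while below it
    comes after \<open>x (j n)\<close>. Both sequences tend to \<open>y\<close>, so the same limit
    would be -pi and pi.\<close>
  have "\<sigma> * Im (rot (x (n + Suc k)) (w n) c) = - pi" for n
  proof -
    have "rot (x (n + Suc k)) (w n) c = - rot (w n) (x (n + Suc k)) c"
      by (simp add: rot_def)
    then show ?thesis
      using lt_trans(2)[OF \<sigma> w(1) x(1) c(1) w(3) xc(1)] by simp
  qed
  then have "\<sigma> * Im (rot y z c) = - pi"
    using L1 by (simp add: LIMSEQ_const_iff)
  moreover have "(\<lambda>n. rot (x (j n)) (w n) c) \<longlonglongrightarrow> rot y z c"
    by (rule tendsto_rot[OF inc _ _ _ lim2 wz tendsto_const]) (use inc' x(1) w xc j(2) c(1) in blast)+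
  then have L2: "(\<lambda>n. \<sigma> * Im (rot (x (j n)) (w n) c)) \<longlonglongrightarrow> \<sigma> * Im (rot y z c)"
    by (intro tendsto_mult tendsto_const tendsto_Im)
  have "\<sigma> * Im (rot (x (j n)) (w n) c) = pi" for n
    using lt_trans(2)[OF \<sigma> x(1) w(1) c(1) j(2) w(4)] .
  then have "\<sigma> * Im (rot y z c) = pi"
    using L2 by (simp add: LIMSEQ_const_iff)
  ultimately show False
    using pi_gt_zero by simp
qed

text \<open>\<open>clopen_below_level\<close> is applied to \<open>infdist t (seg x)\<close>, for
  which \<open>small_infdist\<close> puts a sublevel set into \<open>V\<close>. The hypothesis on
  the left is \<open>level_gap_right\<close> for the reversed order,
  \<open>\<sigma> = - 1\<close>.\<close>

lemma small_clopen_S: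
  assumes z: "z \<in> S" and V: "openin (top_of_set S) V" "z \<in> V"
  obtains U where "openin (top_of_set S) U" "closedin (top_of_set S) U" "z \<in> U" "U \<subseteq> V"
proof -
  obtain \<N> where "\<And>\<sigma>. \<sigma> = 1 \<or> \<sigma> = - 1 \<Longrightarrow> convex_network S (lt \<sigma>) \<N>"
    using ordered_network by blast
  then interpret convex_network S "lt 1" \<N>
    by blast
  obtain G where G: "open G" "V = S \<inter> G"
    using V(1) by (auto simp: openin_open)
  have zE: "z \<in> endpoints X" "z \<noteq> p" "z \<in> G"
    using z V(2) G(2) by (auto simp: S_def)
  obtain t where t: "t \<in> seg z" "up t \<subseteq> G"
    using small_up[OF zE(1,2) G(1) zE(3)] by blast
  obtain d where d: "d > 0" "\<And>x. x \<in> X \<Longrightarrow> infdist t (seg x) < d \<Longrightarrow> x \<in> G"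
    using small_infdist[OF G(1) t(2)] by blast
  have cont: "continuous_on S (\<lambda>x. infdist t (seg x))"
    using continuous_on_subset[OF continuous_on_infdist_seg] S_X by blast
  have zd: "infdist t (seg z) < d"
    using t(1) d(1) by simp
  have R: "\<exists>c\<in>S. lt 1 y c \<and> (\<forall>e\<in>S. lt 1 y e \<longrightarrow> lt 1 e c \<longrightarrow> infdist t (seg e) \<noteq> r)"
    if y: "y \<in> S" "r < infdist t (seg y)"
      "\<And>V. openin (top_of_set S) V \<Longrightarrow> y \<in> V \<Longrightarrow> \<exists>x\<in>V. lt 1 y x" for r y
    using level_gap_right[of 1, OF _ y] by simp
  have L: "\<exists>c\<in>S. lt 1 c y \<and> (\<forall>e\<in>S. lt 1 e y \<longrightarrow> lt 1 c e \<longrightarrow> infdist t (seg e) \<noteq> r)"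
    if y: "y \<in> S" "r < infdist t (seg y)"
      "\<And>V. openin (top_of_set S) V \<Longrightarrow> y \<in> V \<Longrightarrow> \<exists>x\<in>V. lt 1 x y" for r y
    using level_gap_right[of "- 1", OF _ y(1,2)] y(3) by (simp add: lt_reverse)
  obtain U where U: "openin (top_of_set S) U" "closedin (top_of_set S) U" "z \<in> U"
      "U \<subseteq> {x \<in> S. infdist t (seg x) < d}"
    by (rule clopen_below_level[OF cont z zd R L])
  then show thesis
    using that[of U] d(2) S_X G(2) by blast
qed

end

section \<open>Clopen bases at single points\<close>

definition clopen_base_at :: "'a::topological_space set \<Rightarrow> 'a \<Rightarrow> bool"
  where "clopen_base_at E z \<longleftrightarrow> (\<forall>V. openin (top_of_set E) V \<longrightarrow> z \<in> V \<longrightarrow>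
    (\<exists>U. openin (top_of_set E) U \<and> closedin (top_of_set E) U \<and> z \<in> U \<and> U \<subseteq> V))"

lemma zero_dimensional_if_clopen_base:
  assumes "\<And>z. z \<in> E \<Longrightarrow> clopen_base_at E z"
  shows "zero_dimensional_space (top_of_set E)"
proof -
  define \<B> where "\<B> = {U. openin (top_of_set E) U \<and> closedin (top_of_set E) U}"
  have "\<exists>\<U>\<subseteq>\<B>. \<Union>\<U> = V" if V: "openin (top_of_set E) V" for V
  proof -
    have "V \<subseteq> E"
      using V openin_imp_subset by blast
    then have "\<exists>U\<in>\<B>. z \<in> U \<and> U \<subseteq> V" if "z \<in> V" for z
      using assms[of z] that V unfolding clopen_base_at_def \<B>_def by blast
    then show ?thesis
      by (intro exI[of _ "{U \<in> \<B>. U \<subseteq> V}"]) blast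
  qed
  then show ?thesis
    unfolding zero_dimensional_space_def by (intro exI[of _ \<B>]) (simp add: \<B>_def)
qed

text \<open>Small clopen sets around the points near \<open>q\<close>, of diameter comparable with their distance
  from \<open>q\<close>, can accumulate only at \<open>q\<close>.\<close>

lemma clopen_base_at_isolated:
  fixes E :: "'a::{metric_space, second_countable_topology} set"
  assumes q: "q \<in> E" and \<rho>: "\<rho> > 0" "\<And>z. z \<in> E \<Longrightarrow> z \<noteq> q \<Longrightarrow> dist z q < \<rho> \<Longrightarrow> clopen_base_at E z"
  shows "clopen_base_at E q"
  unfolding clopen_base_at_def
proof (intro allI impI)
  fix V assume V: "openin (top_of_set E) V" "q \<in> V"
  obtain G where G: "open G" "V = E \<inter> G"
    using V(1) by (auto simp: openin_open)
  then obtain \<epsilon>0 where "\<epsilon>0 > 0" "ball q \<epsilon>0 \<subseteq> G"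
    using V(2) open_contains_ball by blast
  \<comment> \<open>A chosen set that meets the ball of radius \<open>\<epsilon>\<close> will reach
    less than \<open>2 * \<epsilon>\<close> from \<open>q\<close>; this must stay below
    \<open>\<epsilon>0\<close> and \<open>\<rho>\<close>.\<close>
  define \<epsilon> where "\<epsilon> = min \<epsilon>0 \<rho> / 3"
  have \<epsilon>: "\<epsilon> > 0" "2 * \<epsilon> < \<rho>" "E \<inter> ball q (2 * \<epsilon>) \<subseteq> V"
    using \<open>\<epsilon>0 > 0\<close> \<open>ball q \<epsilon>0 \<subseteq> G\<close> \<rho>(1) G(2) unfolding \<epsilon>_def by auto
  define N where "N = E \<inter> ball q \<rho> - {q}"
  have "\<exists>W. openin (top_of_set E) W \<and> closedin (top_of_set E) W \<and> z \<in> W \<and> W \<subseteq> ball z (dist z q / 3)"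
    if z: "z \<in> N" for z
  proof -
    have "clopen_base_at E z"
      using z \<rho>(2) unfolding N_def by (auto simp: dist_commute)
    moreover have "openin (top_of_set E) (E \<inter> ball z (dist z q / 3))" "z \<in> E \<inter> ball z (dist z q / 3)"
      using z by (auto simp: N_def)
    ultimately obtain U where "openin (top_of_set E) U" "closedin (top_of_set E) U" "z \<in> U"
        "U \<subseteq> E \<inter> ball z (dist z q / 3)"
      unfolding clopen_base_at_def by meson
    then show ?thesis
      by (intro exI[of _ U]) simp
  qed
  then obtain W where W: "\<And>z. z \<in> N \<Longrightarrow> openin (top_of_set E) (W z)" "\<And>z. z \<in> N \<Longrightarrow> closedin (top_of_set E) (W z)"
      "\<And>z. z \<in> N \<Longrightarrow> z \<in> W z" "\<And>z. z \<in> N \<Longrightarrow> W z \<subseteq> ball z (dist z q / 3)"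
    by metis
  obtain \<F> where F: "\<F> \<subseteq> W ` N" "countable \<F>" "\<Union>\<F> = \<Union>(W ` N)"
    using Lindelof_openin[of "W ` N" E] W(1) by blast
  define w where "w = from_nat_into (insert {} \<F>)"
  have range: "range w = insert {} \<F>"
    unfolding w_def using F(2) by (intro range_from_nat_into) auto
  have w_in: "w i = {} \<or> (\<exists>z\<in>N. w i = W z)" for i
    using range F(1) by (metis (no_types, lifting) imageE insertE rangeI subsetD)
  have w: "openin (top_of_set E) (w i)" "closedin (top_of_set E) (w i)" for i
    using w_in[of i] W(1,2) by auto
  define G' where "G' i = w i - (\<Union>j<i. w j)" for i :: nat
  have G': "openin (top_of_set E) (G' i)" for i
    unfolding G'_def using w by (intro openin_diff closedin_Union) auto
  have cover: "\<exists>i. z \<in> G' i" if z: "z \<in> N" for z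
  proof -
    have "\<exists>i. z \<in> w i"
      using z W(3) F(3) range by (metis (no_types, lifting) UN_I UnionE image_iff insertCI)
    then have "z \<in> w (LEAST i. z \<in> w i)" "\<And>j. j < (LEAST i. z \<in> w i) \<Longrightarrow> z \<notin> w j"
      by (auto intro: LeastI_ex dest: not_less_Least)
    then show ?thesis
      unfolding G'_def by blast
  qed
  have disj: "i = j" if "x \<in> G' i" "x \<in> G' j" for x i j
    using that unfolding G'_def by (metis DiffE UN_I lessThan_iff linorder_neqE_nat)
  have qG': "q \<notin> G' i" for i
  proof
    assume "q \<in> G' i"
    then obtain z where z: "z \<in> N" "q \<in> W z"
      using w_in[of i] unfolding G'_def by auto
    then have "q \<in> ball z (dist z q / 3)"
      using W(4) by blast
    then have "dist z q < dist z q / 3"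
      by simp
    then show False
      using zero_le_dist[of z q] by linarith
  qed
  define I where "I = {i. G' i \<inter> ball q \<epsilon> \<noteq> {}}"
  define U where "U = insert q (\<Union>i\<in>I. G' i)"
  \<comment> \<open>With \<open>d = dist z q\<close> below, \<open>d < d / 3 + \<epsilon>\<close>
    gives \<open>d < 3 * \<epsilon> / 2\<close>, and then
    \<open>dist x q < 4 * d / 3 < 2 * \<epsilon>\<close>.\<close>
  have near: "dist x q < 2 * \<epsilon>" if x: "i \<in> I" "x \<in> G' i" for i x
  proof -
    obtain y where y: "y \<in> G' i" "dist y q < \<epsilon>"
      using x(1) unfolding I_def by (auto simp: dist_commute)
    obtain z where z: "z \<in> N" "w i = W z"
      using w_in[of i] x(2) unfolding G'_def by auto
    have "dist z x < dist z q / 3" "dist z y < dist z q / 3"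
      using W(4)[OF z(1)] x(2) y(1) z(2) unfolding G'_def by auto
    then show ?thesis
      using y(2) dist_triangle[of z q y] dist_triangle[of x q z] by (simp add: dist_commute)
  qed
  have sub: "U \<subseteq> V"
    using near \<epsilon> V(2) openin_imp_subset[OF G'] unfolding U_def by (fastforce simp: dist_commute)
  \<comment> \<open>This form shows that \<open>U\<close> is open also at \<open>q\<close>: every
    other point of the ball lies in some \<open>G' i\<close>, and then
    \<open>i \<in> I\<close>.\<close>
  have U1: "U = (E \<inter> ball q \<epsilon>) \<union> (\<Union>i\<in>I. G' i)"
  proof -
    have "x \<in> U" if x: "x \<in> E" "dist q x < \<epsilon>" for x
    proof (cases "x = q")
      case False
      then have "x \<in> N"
        using x \<epsilon>(1,2) by (simp add: N_def)
      then obtain i where "x \<in> G' i"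
        using cover by blast
      moreover from this have "x \<in> G' i \<inter> ball q \<epsilon>"
        using x(2) by simp
      then have "i \<in> I"
        unfolding I_def by blast
      ultimately show ?thesis
        unfolding U_def by blast
    qed (simp add: U_def)
    then have "E \<inter> ball q \<epsilon> \<subseteq> U"
      by auto
    moreover have "q \<in> E \<inter> ball q \<epsilon>"
      using q \<epsilon>(1) by simp
    ultimately show ?thesis
      unfolding U_def by blast
  qed
  have "openin (top_of_set E) U"
    unfolding U1 using G' by (intro openin_Un openin_Union) auto
  moreover have "E - U = (\<Union>i\<in>-I. G' i) \<union> (E \<inter> - cball q (2 * \<epsilon>))"
  proof
    show "E - U \<subseteq> (\<Union>i\<in>-I. G' i) \<union> (E \<inter> - cball q (2 * \<epsilon>))"
    proof
      fix x assume x: "x \<in> E - U"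
      show "x \<in> (\<Union>i\<in>-I. G' i) \<union> (E \<inter> - cball q (2 * \<epsilon>))"
      proof (cases "dist q x < \<rho>")
        case True
        then have "x \<in> N"
          using x by (auto simp: N_def U_def)
        then obtain i where "x \<in> G' i"
          using cover by blast
        then show ?thesis
          using x unfolding U_def by blast
      next
        case False
        then show ?thesis
          using x \<epsilon>(2) by auto
      qed
    qed
    show "(\<Union>i\<in>-I. G' i) \<union> (E \<inter> - cball q (2 * \<epsilon>)) \<subseteq> E - U"
    proof
      fix x assume x: "x \<in> (\<Union>i\<in>-I. G' i) \<union> (E \<inter> - cball q (2 * \<epsilon>))"
      have xE: "x \<in> E"
        using x openin_imp_subset[OF G'] by blast
      have "x \<notin> U"
      proof
        assume "x \<in> U"
        then consider "x = q" | i where "i \<in> I" "x \<in> G' i"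
          unfolding U_def by blast
        then show False
        proof cases
          case 1
          then show False
            using x qG' \<epsilon>(1) by auto
        next
          case 2
          then have "dist q x < 2 * \<epsilon>"
            using near[OF 2(1,2)] by (simp add: dist_commute)
          then show False
            using x disj 2 by auto
        qed
      qed
      then show "x \<in> E - U"
        using xE by blast
    qed
  qed
  moreover have "openin (top_of_set E) ((\<Union>i\<in>-I. G' i) \<union> (E \<inter> - cball q (2 * \<epsilon>)))"
    using G' by (intro openin_Un openin_Union openin_open_Int) auto
  ultimately have op: "openin (top_of_set E) U" "openin (top_of_set E) (E - U)"
    by simp_all
  then have "closedin (top_of_set E) U"
    using openin_imp_subset[OF op(1)] by (simp add: closedin_def)
  then show "\<exists>U. openin (top_of_set E) U \<and> closedin (top_of_set E) U \<and> q \<in> U \<and> U \<subseteq> V"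
    using sub op(1) by (intro exI[of _ U]) (simp add: U_def)
qed

theorem (in endpoint_order) zero_dimensional_endpoints:
  "zero_dimensional_space (top_of_set (endpoints X))"
proof (rule zero_dimensional_if_clopen_base)
  define E where "E = endpoints X"
  have SE: "S \<subseteq> E" "S = E - {p, e0}"
    by (auto simp: E_def S_def)
  have opS: "openin (top_of_set E) S"
  proof -
    have "S = E - {e0} - {p}"
      using SE(2) by blast
    then show ?thesis
      using openin_delete[OF openin_delete[OF openin_subtopology_self]] by metis
  qed
  have good: "clopen_base_at E z" if z: "z \<in> S" for z
    unfolding clopen_base_at_def
  proof (intro allI impI)
    fix V assume V: "openin (top_of_set E) V" "z \<in> V"
    \<comment> \<open>The closed ball of this radius misses \<open>p\<close> and \<open>e0\<close>,
      so a set closed in \<open>S\<close> and contained in the ball is closed in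
      \<open>E\<close>.\<close>
    define r where "r = min (dist z p) (dist z e0) / 2"
    have r: "r > 0" "p \<notin> cball z r" "e0 \<notin> cball z r"
    proof -
      have "dist z p > 0" "dist z e0 > 0"
        using z by (auto simp: S_def)
      then show "r > 0" "p \<notin> cball z r" "e0 \<notin> cball z r"
        by (auto simp: r_def)
    qed
    obtain G where G: "open G" "V = E \<inter> G"
      using V(1) by (auto simp: openin_open)
    have "openin (top_of_set S) (S \<inter> (G \<inter> ball z r))" "z \<in> S \<inter> (G \<inter> ball z r)"
      using G V(2) z r(1) by (auto intro: openin_open_Int)
    then obtain U where U: "openin (top_of_set S) U" "closedin (top_of_set S) U" "z \<in> U" "U \<subseteq> S \<inter> (G \<inter> ball z r)"
      using small_clopen_S[OF z] by metis
    obtain C where C: "closed C" "U = S \<inter> C"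
      using U(2) by (auto simp: closedin_closed)
    have "E \<inter> cball z r \<subseteq> S"
      using r(2,3) SE(2) by blast
    moreover have "U \<subseteq> cball z r"
      using U(4) ball_subset_cball by blast
    ultimately have "U = E \<inter> (C \<inter> cball z r)"
      using C(2) SE(1) by blast
    then have "closedin (top_of_set E) U"
      using closedin_closed_Int[OF closed_Int[OF C(1) closed_cball]] by metis
    moreover have "openin (top_of_set E) U"
      using U(1) opS openin_trans by blast
    ultimately show "\<exists>U. openin (top_of_set E) U \<and> closedin (top_of_set E) U \<and> z \<in> U \<and> U \<subseteq> V"
      using U(3,4) SE(1) G(2) by blast
  qed
  fix z assume "z \<in> endpoints X"
  then have z: "z \<in> E"
    by (simp add: E_def)
  have pe: "dist p e0 > 0"
    using base by simp
  have "clopen_base_at E z"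
  proof (cases "z \<in> S")
    case False
    then have pe0: "z = p \<or> z = e0"
      using z SE by blast
    \<comment> \<open>Within distance \<open>dist p e0\<close> of one of the two points, the other
      one does not occur.\<close>
    show ?thesis
    proof (rule clopen_base_at_isolated[OF z pe])
      fix w assume w: "w \<in> E" "w \<noteq> z" "dist w z < dist p e0"
      then have "w \<noteq> p \<and> w \<noteq> e0"
        using pe0 by (auto simp: dist_commute)
      then show "clopen_base_at E w"
        using good w(1) SE(2) by blast
    qed
  qed (rule good)
  then show "clopen_base_at (endpoints X) z"
    by (simp add: E_def)
qed

theorem theorem17:
  fixes X :: "(real ^ 2) set"
  assumes "smooth_dendroid X"
    and "Suslinian X"
    and "hereditarily_disconnected_space (top_of_set (endpoints X))"
  shows "zero_dimensional_space (top_of_set (endpoints X))"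
proof -
  obtain p where p: "p \<in> X" "\<And>s x. (\<And>n::nat. s n \<in> X) \<Longrightarrow> x \<in> X \<Longrightarrow> s \<longlonglongrightarrow> x \<Longrightarrow>
      (\<lambda>n. hausdorff_dist (alpha X (s n) p) (alpha X x p)) \<longlonglongrightarrow> 0"
    using assms(1) unfolding smooth_dendroid_def by blast
  show ?thesis
  \<comment> \<open>The order needs a base endpoint other than \<open>p\<close>; without one there
    is at most one endpoint.\<close>
  proof (cases "endpoints X \<subseteq> {p}")
    case True
    have "clopen_base_at (endpoints X) z" if "z \<in> endpoints X" for z
      unfolding clopen_base_at_def
    proof (intro allI impI)
      fix V assume "openin (top_of_set (endpoints X)) V" "z \<in> V"
      moreover from this have "endpoints X = V"
        using True openin_imp_subset by blast
      ultimately show "\<exists>U. openin (top_of_set (endpoints X)) U \<and> closedin (top_of_set (endpoints X)) U \<and> z \<in> U \<and> U \<subseteq> V"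
        by (intro exI[of _ "endpoints X"]) auto
    qed
    then show ?thesis
      by (rule zero_dimensional_if_clopen_base)
  next
    case False
    then obtain e where e: "e \<in> endpoints X" "e \<noteq> p"
      by blast
    define \<iota> where "\<iota> v = complex_of_real (v $ 1) + \<i> * complex_of_real (v $ 2)" for v :: "real ^ 2"
    have "inj \<iota>"
      by (rule injI) (simp add: \<iota>_def complex_eq_iff vec_eq_iff forall_2)
    moreover have "continuous_on X \<iota>"
      unfolding \<iota>_def by (intro continuous_intros)
    ultimately interpret endpoint_order X p \<iota> e
      using assms p e
      by unfold_locales (auto simp: smooth_dendroid_def intro: inj_on_subset)
    show ?thesis
      by (rule zero_dimensional_endpoints)
  qed
qed

end
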